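(* Let $\tilde G=(\tilde V,\tilde E)$ be a finite simple $\Gamma$-symmetric graph with respect to an action $\theta:\Gamma\to\mathrm{Aut}(\tilde G)$ that is free on $\tilde V$, let $\tau:\Gamma\to O(\mathbb{R}^2)$ be a homomorphism with $\tau(\Gamma)=\mathcal{C}_3$ (so $\Gamma=\mathbb{Z}_3$), and let $(\tilde G,p)$ be a $\Gamma$-generic framework in $\mathbb{R}^2$ (with respect to $\theta$ and $\tau$). If $\tilde G$ is 6-mixed-connected, then $(\tilde G,p)$ is infinitesimally rigid.
   Context: Symmetric graphs. An action of a group $\Gamma$ on a finite simple graph $\tilde G=(\tilde V,\tilde E)$ is a homomorphism $\theta:\Gamma\to\mathrm{Aut}(\tilde G)$; write $\gamma i$ for $\theta(\gamma)(i)$. It is free on $\tilde V$ if $\gamma i\ne i$ for all $i\in\tilde V$ and all $\gamma\neq\mathrm{id}$. $\tilde G$ is then called $\Gamma$-symmetric (with respect to $\theta$). Frameworks. A framework in $\mathbb{R}^2$ is a pair $(\tilde G,p)$ with $p:\tilde V\to\mathbb{R}^2$ injective. It is $\Gamma$-symmetric (with respect to $\theta$ and $\tau$) if $\tau(\gamma)p(i)=p(\gamma i)$ for all $\gamma\in\Gamma$, $i\in\tilde V$. It is $\Gamma$-generic if it is $\Gamma$-symmetric and the coordinates of the points $p(i)$, $i$ ranging over one representative of each vertex orbit, are algebraically independent over the field $\mathbb{Q}_\Gamma$ generated by $\mathbb{Q}$ and the entries of the matrices in $\tau(\Gamma)$. $\mathcal{C}_3$ is the group of order 3 generated by the rotation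 about the origin by $2\pi/3$. Rigidity. An infinitesimal motion of $(\tilde G,p)$ is $u:\tilde V\to\mathbb{R}^2$ with $\langle p_i-p_j,u_i-u_j\rangle=0$ for all $\{i,j\}\in\tilde E$. It is trivial if there are a skew-symmetric matrix $S$ and a vector $t$ with $u_i=Sp_i+t$ for all $i$. $(\tilde G,p)$ is infinitesimally rigid if every infinitesimal motion is trivial. Mixed connectivity. $\tilde G$ is $n$-mixed-connected if $\tilde G-W-F$ is connected for all $W\subseteq\tilde V$ and $F\subseteq\tilde E$ with $2|W|+|F|\le n-1$. *)

theory Defs
  imports
    "HOL-Analysis.Analysis"
    "HOL-Algebra.Group_Action"
    "HOL-Algebra.Generated_Groups"
    "HOL-Algebra.Generated_Fields"
    "HOL-Algebra.Algebraic_Closure_Type"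
    "HOL-Library.Poly_Mapping"
begin

section \<open>Finite simple graphs\<close>

definition finite_simple_graph :: "'v set \<Rightarrow> 'v set set \<Rightarrow> bool" where
  "finite_simple_graph V E \<longleftrightarrow>
     finite V \<and> (\<forall>e\<in>E. \<exists>u\<in>V. \<exists>v\<in>V. u \<noteq> v \<and> e = {u, v})"

text \<open>The graph without vertices counts as connected here.\<close>

definition connected_graph :: "'v set \<Rightarrow> 'v set set \<Rightarrow> bool" where
  "connected_graph V E \<longleftrightarrow>
     (\<forall>u\<in>V. \<forall>v\<in>V. (u, v) \<in> {(x, y). x \<in> V \<and> y \<in> V \<and> {x, y} \<in> E}\<^sup>*)"

text \<open>The bound is written with \<open><\<close> because subtraction on \<^typ>\<open>nat\<close> truncates.\<close>

definition mixed_connected :: "nat \<Rightarrow> 'v set \<Rightarrow> 'v set set \<Rightarrow> bool" where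
  "mixed_connected n V E \<longleftrightarrow>
     (\<forall>W F. W \<subseteq> V \<longrightarrow> F \<subseteq> E \<longrightarrow> 2 * card W + card F < n \<longrightarrow>
        connected_graph (V - W) {e \<in> E - F. e \<inter> W = {}})"

definition graph_automorphisms :: "'v set \<Rightarrow> 'v set set \<Rightarrow> ('v \<Rightarrow> 'v) set" where
  "graph_automorphisms V E =
     {f \<in> Bij V. \<forall>u\<in>V. \<forall>v\<in>V. {f u, f v} \<in> E \<longleftrightarrow> {u, v} \<in> E}"

definition graph_aut_group :: "'v set \<Rightarrow> 'v set set \<Rightarrow> ('v \<Rightarrow> 'v) monoid" where
  "graph_aut_group V E = (BijGroup V)\<lparr>carrier := graph_automorphisms V E\<rparr>"

lemma group_graph_aut_group: "group (graph_aut_group V E)"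
proof -
  have "subgroup (graph_automorphisms V E) (BijGroup V)"
  proof (rule group.subgroupI[OF group_BijGroup])
    show "graph_automorphisms V E \<subseteq> carrier (BijGroup V)"
      by (auto simp: graph_automorphisms_def BijGroup_def)
    have "(\<lambda>x\<in>V. x) \<in> graph_automorphisms V E"
      by (simp add: graph_automorphisms_def id_Bij)
    then show "graph_automorphisms V E \<noteq> {}" by blast
  next
    fix f assume f: "f \<in> graph_automorphisms V E"
    then have fB: "f \<in> Bij V" by (simp add: graph_automorphisms_def)
    have sur: "f (inv_into V f x) = x" "inv_into V f x \<in> V" if "x \<in> V" for x
      using fB that by (auto simp: Bij_def bij_betw_def f_inv_into_f inv_into_into)
    have "{inv_into V f u, inv_into V f v} \<in> E \<longleftrightarrow> {u, v} \<in> E" if "u \<in> V" "v \<in> V" for u v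
    proof -
      have "{f (inv_into V f u), f (inv_into V f v)} \<in> E \<longleftrightarrow> {inv_into V f u, inv_into V f v} \<in> E"
        using f sur(2)[OF that(1)] sur(2)[OF that(2)] unfolding graph_automorphisms_def by blast
      then show ?thesis by (simp only: sur(1)[OF that(1)] sur(1)[OF that(2)])
    qed
    then have "restrict (inv_into V f) V \<in> graph_automorphisms V E"
      using fB by (simp add: graph_automorphisms_def restrict_inv_into_Bij)
    then show "inv\<^bsub>BijGroup V\<^esub> f \<in> graph_automorphisms V E"
      using fB by (simp add: inv_BijGroup)
  next
    fix f g assume f: "f \<in> graph_automorphisms V E" and g: "g \<in> graph_automorphisms V E"
    then have B: "f \<in> Bij V" "g \<in> Bij V" by (auto simp: graph_automorphisms_def)
    have "g x \<in> V" if "x \<in> V" for x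
      using B(2) that Bij_imp_funcset by blast
    then have "compose V f g \<in> graph_automorphisms V E"
      using f g B by (simp add: graph_automorphisms_def compose_Bij compose_eq)
    then show "f \<otimes>\<^bsub>BijGroup V\<^esub> g \<in> graph_automorphisms V E"
      using B by (simp add: BijGroup_def)
  qed
  then show ?thesis
    unfolding graph_aut_group_def
    by (rule group.subgroup_imp_group[OF group_BijGroup])
qed

definition free_action :: "('g, 'm) monoid_scheme \<Rightarrow> 'v set \<Rightarrow> ('g \<Rightarrow> 'v \<Rightarrow> 'v) \<Rightarrow> bool" where
  "free_action \<Gamma> V \<theta> \<longleftrightarrow>
     (\<forall>\<gamma>\<in>carrier \<Gamma>. \<gamma> \<noteq> \<one>\<^bsub>\<Gamma>\<^esub> \<longrightarrow> (\<forall>i\<in>V. \<theta> \<gamma> i \<noteq> i))"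

section \<open>The orthogonal group and its cyclic subgroup of order three\<close>

definition orthogonal_group :: "(real^'n^'n) monoid" where
  "orthogonal_group = \<lparr>carrier = {A. orthogonal_matrix A}, mult = (**), one = mat 1\<rparr>"

lemma group_orthogonal_group: "group (orthogonal_group :: (real^'n^'n) monoid)"
proof (rule groupI)
  fix A :: "real^'n^'n" assume "A \<in> carrier orthogonal_group"
  then have "transpose A \<in> carrier orthogonal_group"
    "transpose A \<otimes>\<^bsub>orthogonal_group\<^esub> A = \<one>\<^bsub>orthogonal_group\<^esub>"
    by (auto simp: orthogonal_group_def orthogonal_matrix_def)
  then show "\<exists>B\<in>carrier orthogonal_group. B \<otimes>\<^bsub>orthogonal_group\<^esub> A = \<one>\<^bsub>orthogonal_group\<^esub>"
    by blast
qed (auto simp: orthogonal_group_def orthogonal_matrix_mul orthogonal_matrix_id matrix_mul_assoc)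

definition rotation2 :: "real \<Rightarrow> real^2^2" where
  "rotation2 \<phi> = vector [vector [cos \<phi>, - sin \<phi>], vector [sin \<phi>, cos \<phi>]]"

definition C3 :: "(real^2^2) set" where
  "C3 = generate orthogonal_group {rotation2 (2 * pi / 3)}"

section \<open>Algebraic independence\<close>

text \<open>
  A polynomial with real coefficients in variables indexed by \<^typ>\<open>'i\<close> is a finitely supported
  map from monomials to coefficients, a monomial a finitely supported map from variables to
  exponents.
\<close>

definition eval_poly_mapping :: "(('i \<Rightarrow>\<^sub>0 nat) \<Rightarrow>\<^sub>0 real) \<Rightarrow> ('i \<Rightarrow> real) \<Rightarrow> real" where
  "eval_poly_mapping P x =
     (\<Sum>m\<in>Poly_Mapping.keys P.
        Poly_Mapping.lookup P m * (\<Prod>i\<in>Poly_Mapping.keys m. x i ^ Poly_Mapping.lookup m i))"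

definition algebraically_independent_over :: "real set \<Rightarrow> 'i set \<Rightarrow> ('i \<Rightarrow> real) \<Rightarrow> bool" where
  "algebraically_independent_over K I x \<longleftrightarrow>
     (\<forall>P. P \<noteq> 0 \<longrightarrow>
        (\<forall>m\<in>Poly_Mapping.keys P. Poly_Mapping.lookup P m \<in> K \<and> Poly_Mapping.keys m \<subseteq> I) \<longrightarrow>
        eval_poly_mapping P x \<noteq> 0)"

definition matrix_field :: "(real^'n^'n) set \<Rightarrow> real set" where
  "matrix_field M = generate_field ring_of_type_algebra (\<rat> \<union> {A $ k $ l | A k l. A \<in> M})"

section \<open>Frameworks\<close>

text \<open>
  Values of placements and velocity assignments outside the vertex set are irrelevant.
\<close>

definition framework :: "'v set \<Rightarrow> ('v \<Rightarrow> real^'n) \<Rightarrow> bool" where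
  "framework V p \<longleftrightarrow> inj_on p V"

definition symmetric_framework ::
  "('g, 'm) monoid_scheme \<Rightarrow> ('g \<Rightarrow> 'v \<Rightarrow> 'v) \<Rightarrow> ('g \<Rightarrow> real^'n^'n) \<Rightarrow> 'v set \<Rightarrow> ('v \<Rightarrow> real^'n) \<Rightarrow> bool"
where
  "symmetric_framework \<Gamma> \<theta> \<tau> V p \<longleftrightarrow>
     framework V p \<and> (\<forall>\<gamma>\<in>carrier \<Gamma>. \<forall>i\<in>V. \<tau> \<gamma> *v p i = p (\<theta> \<gamma> i))"

definition orbit_representatives ::
  "('g, 'm) monoid_scheme \<Rightarrow> ('g \<Rightarrow> 'v \<Rightarrow> 'v) \<Rightarrow> 'v set \<Rightarrow> 'v set \<Rightarrow> bool" where
  "orbit_representatives \<Gamma> \<theta> V R \<longleftrightarrow>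
     R \<subseteq> V \<and> (\<forall>i\<in>V. \<exists>!r. r \<in> R \<and> r \<in> Group_Action.orbit \<Gamma> \<theta> i)"

text \<open>
  The choice of representatives is immaterial: another choice changes the coordinates by
  invertible linear maps over the field generated by the matrix entries.
\<close>

definition generic_framework ::
  "('g, 'm) monoid_scheme \<Rightarrow> ('g \<Rightarrow> 'v \<Rightarrow> 'v) \<Rightarrow> ('g \<Rightarrow> real^'n^'n) \<Rightarrow> 'v set \<Rightarrow> ('v \<Rightarrow> real^'n) \<Rightarrow> bool"
where
  "generic_framework \<Gamma> \<theta> \<tau> V p \<longleftrightarrow>
     symmetric_framework \<Gamma> \<theta> \<tau> V p \<and>
     (\<exists>R. orbit_representatives \<Gamma> \<theta> V R \<and>
        algebraically_independent_over (matrix_field (\<tau> ` carrier \<Gamma>))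
          (R \<times> UNIV) (\<lambda>(i, k). p i $ k))"

section \<open>Infinitesimal rigidity\<close>

definition infinitesimal_motion ::
  "'v set \<Rightarrow> 'v set set \<Rightarrow> ('v \<Rightarrow> real^'n) \<Rightarrow> ('v \<Rightarrow> real^'n) \<Rightarrow> bool" where
  "infinitesimal_motion V E p u \<longleftrightarrow>
     (\<forall>i\<in>V. \<forall>j\<in>V. {i, j} \<in> E \<longrightarrow> (p i - p j) \<bullet> (u i - u j) = 0)"

definition trivial_motion :: "'v set \<Rightarrow> ('v \<Rightarrow> real^'n) \<Rightarrow> ('v \<Rightarrow> real^'n) \<Rightarrow> bool" where
  "trivial_motion V p u \<longleftrightarrow>
     (\<exists>(S :: real^'n^'n) t. transpose S = - S \<and> (\<forall>i\<in>V. u i = S *v p i + t))"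

definition infinitesimally_rigid :: "'v set \<Rightarrow> 'v set set \<Rightarrow> ('v \<Rightarrow> real^'n) \<Rightarrow> bool" where
  "infinitesimally_rigid V E p \<longleftrightarrow>
     (\<forall>u. infinitesimal_motion V E p u \<longrightarrow> trivial_motion V p u)"

end

theory Submission
  imports Defs
begin

text \<open>
  Identify the plane with the complex numbers, so that the rotation multiplies by a third root of unity.
  After complexification, the space of infinitesimal motions is the direct sum of its components for
  the three characters of the group. So it is enough to show, for each character, that the motions of
  this character are rigid. Such motions are determined by their values at orbit representatives, and
  each edge orbit imposes one equation. With \<open>n\<close> vertex orbits there are \<open>2 n\<close> unknowns, and the rigid
  motions of one character form a line; so the edge orbits must have rank \<open>2 n - 1\<close>.

  The key is a local form of rigidity in the plane (\<open>local_rigidity\<close>): if all motions of a set of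
  edges preserve the distance of a pair of vertices, then the pair lies in a vertex set that is rigid by
  means of its own edges. To prove it, take a minimal dependent set of edges through the pair. If it
  is not of full rank on the orbits that it touches, it has a vertex orbit of degree three, by counting, and
  none of smaller degree, by genericity (\<open>circuit_meets_orbit_thrice\<close>). Moving this vertex to the midpoint
  between two of its neighbours shows that the three neighbours keep their mutual distances even without
  it (\<open>extend_by_three_edges\<close>), and induction supplies rigid sets for these three pairs.

  Consequently each maximal rigid set, or block, \<open>Z\<close> contains at least \<open>2 |Z| - 3\<close> of the edges
  of the whole graph that come from a basis of the matroid (\<open>block_edges\<close>). This holds for the blocks that
  are disjoint from their rotated copies as well as for the invariant ones, whatever the character. Since
  distinct blocks share at most one vertex, these edges are counted once. But in a
  6-mixed-connected graph the sum of \<open>2 |Z| - 3\<close> over the blocks is at least \<open>2 |V|\<close> unless \<open>V\<close> is a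
  block (\<open>mixed_connected_cover\<close>), whereas three times the rank is at most \<open>2 |V| - 3\<close>.

  Apart from the absence of collinear triples, genericity is used through one principle: an edge set that is independent for some symmetric
  placement is independent for the given one, because independence is the nonvanishing of a
  polynomial in the coordinates of the representatives (\<open>generic_threefoldI\<close>).
\<close>

section \<open>Systems of linear functionals\<close>

lemma underdetermined_system:
  fixes a :: "'e \<Rightarrow> 'c \<Rightarrow> 'a::field"
  assumes "finite E" "finite C" "card E < card C"
  shows "\<exists>x. (\<exists>c\<in>C. x c \<noteq> 0) \<and> (\<forall>e\<in>E. (\<Sum>c\<in>C. a e c * x c) = 0)"
  using assms
proof (induction E arbitrary: a C rule: finite_induct)
  case empty
  then have "C \<noteq> {}" by auto
  then show ?case by (intro exI[of _ "\<lambda>_. 1"]) auto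
next
  case (insert e E)
  show ?case
  proof (cases "\<forall>c\<in>C. a e c = 0")
    case True
    have "card E < card C" using insert by simp
    from insert.IH[OF insert.prems(1) this, of a] obtain x where
      x: "\<exists>c\<in>C. x c \<noteq> 0" "\<forall>f\<in>E. (\<Sum>c\<in>C. a f c * x c) = 0" by blast
    have "(\<Sum>c\<in>C. a e c * x c) = 0" using True by simp
    then show ?thesis using x by blast
  next
    case False
    then obtain d where d: "d \<in> C" "a e d \<noteq> 0" by blast
    define C' where "C' = C - {d}"
    have fC: "finite C'" and dC: "d \<notin> C'" and CC: "C = insert d C'"
      using insert.prems d by (auto simp: C'_def)
    have "card E < card C'"
      using insert d fC dC unfolding CC by simp
    from insert.IH[OF fC this, of "\<lambda>f c. a f c - a f d * a e c / a e d"] obtain x where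
      x: "\<exists>c\<in>C'. x c \<noteq> 0"
         "\<forall>f\<in>E. (\<Sum>c\<in>C'. (a f c - a f d * a e c / a e d) * x c) = 0" by blast
    define s where "s = (\<Sum>c\<in>C'. a e c * x c)"
    define y where "y = x(d := - s / a e d)"
    have y: "(\<Sum>c\<in>C. a f c * y c) = a f d * (- s / a e d) + (\<Sum>c\<in>C'. a f c * x c)" for f
    proof -
      have "(\<Sum>c\<in>C'. a f c * y c) = (\<Sum>c\<in>C'. a f c * x c)"
        by (rule sum.cong) (use dC in \<open>auto simp: y_def\<close>)
      then show ?thesis unfolding CC using fC dC by (simp add: y_def)
    qed
    have "(\<Sum>c\<in>C. a f c * y c) = 0" if "f \<in> E" for f
    proof -
      have "0 = (\<Sum>c\<in>C'. a f c * x c - (a f d / a e d) * (a e c * x c))"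
        using bspec[OF x(2) that] by (simp add: algebra_simps)
      also have "\<dots> = (\<Sum>c\<in>C'. a f c * x c) - (a f d / a e d) * s"
        by (simp add: sum_subtractf sum_distrib_left s_def)
      finally show ?thesis unfolding y by simp
    qed
    moreover have "(\<Sum>c\<in>C. a e c * y c) = 0"
      unfolding y using d by (simp add: s_def)
    moreover have "\<exists>c\<in>C. y c \<noteq> 0"
      using x(1) dC unfolding y_def CC by auto
    ultimately show ?thesis by blast
  qed
qed

text \<open>The rigidity matroid is treated through its motions. A family of functionals is independent when
  each member is detected by a common zero of the others; in mechanical terms, removing a bar allows
  a motion that changes its length.\<close>

definition subspace_of_functions :: "('k \<Rightarrow> 'a::field) set \<Rightarrow> bool" where
  "subspace_of_functions S \<longleftrightarrow>
     (\<lambda>_. 0) \<in> S \<and> (\<forall>u\<in>S. \<forall>w\<in>S. \<forall>c. (\<lambda>k. u k + c * w k) \<in> S)"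

definition linear_functional :: "(('k \<Rightarrow> 'a::field) \<Rightarrow> 'a) \<Rightarrow> bool" where
  "linear_functional f \<longleftrightarrow> (\<forall>u w c. f (\<lambda>k. u k + c * w k) = f u + c * f w)"

definition solutions :: "('k \<Rightarrow> 'a::field) set \<Rightarrow> ('i \<Rightarrow> ('k \<Rightarrow> 'a) \<Rightarrow> 'a) \<Rightarrow> 'i set \<Rightarrow> ('k \<Rightarrow> 'a) set" where
  "solutions S f I = {u \<in> S. \<forall>i\<in>I. f i u = 0}"

definition independent_on :: "('k \<Rightarrow> 'a::field) set \<Rightarrow> ('i \<Rightarrow> ('k \<Rightarrow> 'a) \<Rightarrow> 'a) \<Rightarrow> 'i set \<Rightarrow> bool" where
  "independent_on S f I \<longleftrightarrow> (\<forall>i\<in>I. \<exists>u\<in>solutions S f (I - {i}). f i u \<noteq> 0)"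

definition coordinates_of :: "('k \<Rightarrow> 'a::field) set \<Rightarrow> 'k set \<Rightarrow> bool" where
  "coordinates_of S C \<longleftrightarrow> finite C \<and> (\<forall>x. \<exists>u\<in>S. \<forall>c\<in>C. u c = x c) \<and>
     (\<forall>u\<in>S. (\<forall>c\<in>C. u c = 0) \<longrightarrow> u = (\<lambda>_. 0))"

lemma linear_functionalD:
  "linear_functional f \<Longrightarrow> f (\<lambda>k. u k + c * w k) = f u + c * f w"
  by (simp add: linear_functional_def)

lemma subspace_of_functionsD:
  "subspace_of_functions S \<Longrightarrow> u \<in> S \<Longrightarrow> w \<in> S \<Longrightarrow> (\<lambda>k. u k + c * w k) \<in> S"
  by (simp add: subspace_of_functions_def)

lemma linear_functional_0: "linear_functional f \<Longrightarrow> f (\<lambda>_. 0) = 0"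
proof -
  assume "linear_functional f"
  from linear_functionalD[OF this, of "\<lambda>_. 0" "- 1" "\<lambda>_. 0"] show ?thesis by simp
qed

lemma linear_functional_sum:
  assumes "linear_functional f" "finite C"
  shows "f (\<lambda>k. \<Sum>c\<in>C. x c * b c k) = (\<Sum>c\<in>C. x c * f (b c))"
  using assms(2)
proof (induction C rule: finite_induct)
  case empty
  then show ?case using linear_functional_0[OF assms(1)] by simp
next
  case (insert c C)
  have "f (\<lambda>k. (\<Sum>c\<in>C. x c * b c k) + x c * b c k) = f (\<lambda>k. \<Sum>c\<in>C. x c * b c k) + x c * f (b c)"
    by (rule linear_functionalD[OF assms(1)])
  then show ?case using insert by (simp add: add.commute)
qed

lemma subspace_sum:
  assumes "subspace_of_functions S" "finite C" "\<And>c. c \<in> C \<Longrightarrow> b c \<in> S"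
  shows "(\<lambda>k. \<Sum>c\<in>C. x c * b c k) \<in> S"
  using assms(2,3)
proof (induction C rule: finite_induct)
  case empty
  then show ?case using assms(1) by (simp add: subspace_of_functions_def)
next
  case (insert c C)
  have "(\<lambda>k. (\<Sum>c\<in>C. x c * b c k) + x c * b c k) \<in> S"
    by (rule subspace_of_functionsD[OF assms(1)]) (use insert in auto)
  then show ?case using insert by (simp add: add.commute)
qed

lemma subspace_solutions:
  assumes "subspace_of_functions S" "\<And>i. linear_functional (f i)"
  shows "subspace_of_functions (solutions S f I)"
  using assms linear_functional_0[OF assms(2)]
  unfolding subspace_of_functions_def solutions_def linear_functional_def by auto

lemma solutions_antimono: "I \<subseteq> J \<Longrightarrow> solutions S f J \<subseteq> solutions S f I"
  by (auto simp: solutions_def)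

lemma solutions_insert: "solutions S f (insert i I) = {u \<in> solutions S f I. f i u = 0}"
  by (auto simp: solutions_def)

lemma independent_on_subset: "independent_on S f J \<Longrightarrow> I \<subseteq> J \<Longrightarrow> independent_on S f I"
  unfolding independent_on_def
  by (meson Diff_mono equalityD1 in_mono solutions_antimono)

text \<open>Subtracting a suitable multiple of the solution that detects the new functional repairs
  the witnesses of the old ones.\<close>

lemma independent_on_insert:
  assumes S: "subspace_of_functions S" and lin: "\<And>i. linear_functional (f i)"
    and ind: "independent_on S f I" and u: "u \<in> solutions S f I" "f j u \<noteq> 0"
  shows "independent_on S f (insert j I)"
  unfolding independent_on_def
proof
  fix i assume i: "i \<in> insert j I"
  show "\<exists>w\<in>solutions S f (insert j I - {i}). f i w \<noteq> 0"
  proof (cases "i = j")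
    case True
    then show ?thesis using u solutions_antimono[of "insert j I - {i}" I S f] by auto
  next
    case False
    then have "i \<in> I" using i by simp
    then obtain w where w: "w \<in> solutions S f (I - {i})" "f i w \<noteq> 0"
      using ind unfolding independent_on_def by blast
    define w' where "w' = (\<lambda>k. w k + (- f j w / f j u) * u k)"
    have val: "f l w' = f l w + (- f j w / f j u) * f l u" for l
      unfolding w'_def by (rule linear_functionalD[OF lin])
    have "w' \<in> S"
      unfolding w'_def by (rule subspace_of_functionsD[OF S]) (use u(1) w(1) in \<open>auto simp: solutions_def\<close>)
    then have "w' \<in> solutions S f (insert j I - {i})"
      using w(1) u unfolding solutions_def by (auto simp: val)
    moreover have "f i w' \<noteq> 0"
      using w(2) u(1) \<open>i \<in> I\<close> by (simp add: val solutions_def)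
    ultimately show ?thesis by blast
  qed
qed

text \<open>Induction on the number of functionals: on the kernel of one of them the others suffice, and
  what remains is a multiple of that one.\<close>

lemma functional_in_span:
  assumes "finite I" "subspace_of_functions S" "\<And>i. linear_functional (f i)"
    "linear_functional g" "\<And>u. u \<in> solutions S f I \<Longrightarrow> g u = 0"
  shows "\<exists>l. \<forall>u\<in>S. g u = (\<Sum>i\<in>I. l i * f i u)"
  using assms
proof (induction I arbitrary: S rule: finite_induct)
  case empty
  then show ?case by (simp add: solutions_def)
next
  case (insert j I)
  let ?S = "solutions S f {j}"
  have "subspace_of_functions ?S" by (rule subspace_solutions) (use insert in auto)
  moreover have "g u = 0" if "u \<in> solutions ?S f I" for u
    using that insert.prems(4)[of u] by (auto simp: solutions_def)
  ultimately obtain l where l: "\<forall>u\<in>?S. g u = (\<Sum>i\<in>I. l i * f i u)"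
    using insert.IH[of ?S] insert.prems by blast
  define h where "h = (\<lambda>u. g u - (\<Sum>i\<in>I. l i * f i u))"
  have h_lin: "h (\<lambda>k. u k + c * w k) = h u + c * h w" for u w c
  proof -
    have "g (\<lambda>k. u k + c * w k) = g u + c * g w" "\<And>i. f i (\<lambda>k. u k + c * w k) = f i u + c * f i w"
      using insert.prems(2,3) by (auto simp: linear_functional_def)
    then show ?thesis
      by (simp add: h_def algebra_simps sum.distrib sum_distrib_left)
  qed
  have "\<exists>c. \<forall>u\<in>S. h u = c * f j u"
  proof (cases "\<forall>u\<in>S. f j u = 0")
    case True
    then show ?thesis using l by (auto simp: h_def solutions_def intro!: exI[of _ 0])
  next
    case False
    then obtain w where w: "w \<in> S" "f j w \<noteq> 0" by blast
    have "h u = (h w / f j w) * f j u" if "u \<in> S" for u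
    proof -
      let ?v = "\<lambda>k. u k + (- f j u / f j w) * w k"
      have "f j ?v = f j u + (- f j u / f j w) * f j w"
        by (rule linear_functionalD[OF insert.prems(2)])
      moreover have "?v \<in> S"
        by (rule subspace_of_functionsD[OF insert.prems(1) that w(1)])
      ultimately have "?v \<in> ?S" using w(2) by (simp add: solutions_def)
      then have "h ?v = 0" using l by (simp add: h_def)
      then show ?thesis unfolding h_lin using w(2) by (simp add: field_simps)
    qed
    then show ?thesis by blast
  qed
  then obtain c where c: "\<forall>u\<in>S. h u = c * f j u" by blast
  have "g u = (\<Sum>i\<in>insert j I. (l(j := c)) i * f i u)" if "u \<in> S" for u
  proof -
    have "(\<Sum>i\<in>I. (l(j := c)) i * f i u) = (\<Sum>i\<in>I. l i * f i u)"
      by (rule sum.cong) (use insert.hyps in auto)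
    moreover have "g u - (\<Sum>i\<in>I. l i * f i u) = c * f j u" using c that by (simp add: h_def)
    ultimately show ?thesis using insert.hyps by (simp add: algebra_simps)
  qed
  then show ?case by blast
qed

lemma independent_on_iff_coefficients:
  assumes S: "subspace_of_functions S" and lin: "\<And>i. linear_functional (f i)" and I: "finite I"
  shows "independent_on S f I \<longleftrightarrow>
    (\<forall>l. (\<forall>u\<in>S. (\<Sum>i\<in>I. l i * f i u) = 0) \<longrightarrow> (\<forall>i\<in>I. l i = 0))"
    (is "_ \<longleftrightarrow> ?R")
proof
  assume ind: "independent_on S f I"
  show ?R
  proof (intro allI impI ballI)
    fix l i assume l: "\<forall>u\<in>S. (\<Sum>i\<in>I. l i * f i u) = 0" and i: "i \<in> I"
    obtain u where u: "u \<in> solutions S f (I - {i})" "f i u \<noteq> 0"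
      using ind i unfolding independent_on_def by blast
    have "(\<Sum>i\<in>I. l i * f i u) = l i * f i u + (\<Sum>j\<in>I - {i}. l j * f j u)"
      using I i by (rule sum.remove)
    also have "(\<Sum>j\<in>I - {i}. l j * f j u) = 0"
      using u(1) by (intro sum.neutral) (auto simp: solutions_def)
    finally show "l i = 0" using l u by (auto simp: solutions_def)
  qed
next
  assume R: ?R
  show "independent_on S f I"
    unfolding independent_on_def
  proof (rule ballI, rule ccontr)
    fix i assume i: "i \<in> I" and "\<not> (\<exists>u\<in>solutions S f (I - {i}). f i u \<noteq> 0)"
    then obtain l where l: "\<forall>u\<in>S. f i u = (\<Sum>j\<in>I - {i}. l j * f j u)"
      using functional_in_span[of "I - {i}" S f "f i"] S lin I by blast
    define m where "m = l(i := - 1)"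
    have "(\<Sum>j\<in>I. m j * f j u) = 0" if "u \<in> S" for u
    proof -
      have "(\<Sum>j\<in>I. m j * f j u) = m i * f i u + (\<Sum>j\<in>I - {i}. m j * f j u)"
        using I i by (rule sum.remove)
      also have "(\<Sum>j\<in>I - {i}. m j * f j u) = (\<Sum>j\<in>I - {i}. l j * f j u)"
        by (rule sum.cong) (auto simp: m_def)
      finally show ?thesis using l that by (simp add: m_def)
    qed
    then have "m i = 0" using R i by blast
    then show False by (simp add: m_def)
  qed
qed

text \<open>The dual basis of the coordinates is a basis: a vector and its expansion have the same
  coordinates, and coordinates determine a vector.\<close>

lemma coordinate_basis:
  assumes "subspace_of_functions S" "coordinates_of S C"
  shows "\<exists>b. (\<forall>c\<in>C. b c \<in> S) \<and> (\<forall>c\<in>C. \<forall>d\<in>C. b c d = (if d = c then 1 else 0)) \<and>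
    (\<forall>u\<in>S. u = (\<lambda>k. \<Sum>c\<in>C. u c * b c k))"
proof -
  have *: "\<forall>c. \<exists>u. u \<in> S \<and> (\<forall>d\<in>C. u d = (if d = c then 1 else 0))"
  proof
    fix c :: 'a
    have "\<forall>x. \<exists>u\<in>S. \<forall>d\<in>C. u d = x d" using assms(2) by (simp add: coordinates_of_def)
    from this[rule_format, of "\<lambda>d. if d = c then 1 else 0"]
    show "\<exists>u. u \<in> S \<and> (\<forall>d\<in>C. u d = (if d = c then 1 else 0))"
      unfolding Bex_def by assumption
  qed
  obtain b where b': "\<forall>c. b c \<in> S \<and> (\<forall>d\<in>C. b c d = (if d = c then 1 else 0))"
    using choice[OF *] by (rule exE)
  have b: "b c \<in> S" "d \<in> C \<Longrightarrow> b c d = (if d = c then 1 else 0)" for c d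
    using b' by simp_all
  have fin: "finite C" using assms(2) by (simp add: coordinates_of_def)
  have "\<forall>u\<in>S. u = (\<lambda>k. \<Sum>c\<in>C. u c * b c k)"
  proof
    fix u assume u: "u \<in> S"
    let ?s = "\<lambda>k. \<Sum>c\<in>C. u c * b c k"
    have "?s \<in> S" using assms(1) fin b(1) by (rule subspace_sum)
    then have v: "(\<lambda>k. u k + (- 1) * ?s k) \<in> S"
      by (intro subspace_of_functionsD[OF assms(1) u])
    have *: "u d + (- 1) * ?s d = 0" if "d \<in> C" for d
    proof -
      have "?s d = (\<Sum>c\<in>C. if c = d then u c else 0)"
        by (rule sum.cong) (use b(2) that in auto)
      then show ?thesis using fin that by simp
    qed
    have "\<forall>w\<in>S. (\<forall>c\<in>C. w c = 0) \<longrightarrow> w = (\<lambda>_. 0)"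
      using assms(2) by (simp add: coordinates_of_def)
    from bspec[OF this v] have "(\<forall>c\<in>C. u c + (- 1) * ?s c = 0) \<longrightarrow> (\<lambda>k. u k + (- 1) * ?s k) = (\<lambda>_. 0)" .
    then have "(\<lambda>k. u k + (- 1) * ?s k) = (\<lambda>_. 0)" by (rule mp) (intro ballI *)
    then have *: "u k + (- 1) * ?s k = 0" for k by (rule fun_cong)
    show "u = ?s"
    proof
      show "u k = ?s k" for k using *[of k] by simp
    qed
  qed
  moreover have "\<forall>c\<in>C. b c \<in> S" and "\<forall>c\<in>C. \<forall>d\<in>C. b c d = (if d = c then 1 else 0)"
    using b by simp_all
  ultimately have "(\<forall>c\<in>C. b c \<in> S) \<and> (\<forall>c\<in>C. \<forall>d\<in>C. b c d = (if d = c then 1 else 0)) \<and>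
      (\<forall>u\<in>S. u = (\<lambda>k. \<Sum>c\<in>C. u c * b c k))" by (rule_tac conjI[OF _ conjI])
  note * = this
  show ?thesis by (rule exI[of _ b], rule *)
qed

lemma solutions_nonzero:
  assumes S: "subspace_of_functions S" "coordinates_of S C" and lin: "\<And>i. linear_functional (f i)"
    and I: "finite I" "card I < card C"
  shows "\<exists>u\<in>solutions S f I. u \<noteq> (\<lambda>_. 0)"
proof -
  obtain b where b': "\<forall>c\<in>C. b c \<in> S" "\<forall>c\<in>C. \<forall>d\<in>C. b c d = (if d = c then 1 else 0)"
    "\<forall>u\<in>S. u = (\<lambda>k. \<Sum>c\<in>C. u c * b c k)"
    using coordinate_basis[OF S] by (elim exE conjE) (rule that)
  note b = b'[rule_format]
  have fin: "finite C" using S(2) by (simp add: coordinates_of_def)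
  obtain x where x: "\<exists>c\<in>C. x c \<noteq> 0" "\<forall>i\<in>I. (\<Sum>c\<in>C. f i (b c) * x c) = 0"
    using underdetermined_system[OF I(1) fin I(2), of "\<lambda>i c. f i (b c)"] by blast
  let ?u = "\<lambda>k. \<Sum>c\<in>C. x c * b c k"
  have u: "?u \<in> S" using S(1) fin b(1) by (rule subspace_sum)
  have v: "f i ?u = 0" if "i \<in> I" for i
    using linear_functional_sum[OF lin fin, of i x b] x(2) that by (simp add: mult.commute)
  have nz: "?u \<noteq> (\<lambda>_. 0)"
  proof -
    obtain d where d: "d \<in> C" "x d \<noteq> 0" using x(1) by blast
    have "?u d = (\<Sum>c\<in>C. if c = d then x c else 0)"
      by (rule sum.cong) (use b(2) d in auto)
    then have "?u d = x d" using fin d by simp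
    then have d0: "?u d \<noteq> 0" using d(2) by simp
    show ?thesis
    proof
      assume "?u = (\<lambda>_. 0)"
      then have "?u d = 0" by (rule fun_cong)
      with d0 show False by (rule notE)
    qed
  qed
  show ?thesis
  proof (rule bexI)
    show "?u \<noteq> (\<lambda>_. 0)" by (rule nz)
    show "?u \<in> solutions S f I" unfolding solutions_def using u v by simp
  qed
qed

text \<open>The coefficient form is the one that is stable under small changes of the functionals.\<close>

lemma independent_on_iff_rows:
  assumes S: "subspace_of_functions S" and lin: "\<And>i. linear_functional (f i)" and I: "finite I"
    and C: "finite C" and b: "\<And>c. c \<in> C \<Longrightarrow> b c \<in> S"
      "\<And>u. u \<in> S \<Longrightarrow> u = (\<lambda>k. \<Sum>c\<in>C. u c * b c k)"
  shows "independent_on S f I \<longleftrightarrow>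
    (\<forall>l. (\<forall>c\<in>C. (\<Sum>i\<in>I. l i * f i (b c)) = 0) \<longrightarrow> (\<forall>i\<in>I. l i = 0))"
proof -
  have "(\<forall>u\<in>S. (\<Sum>i\<in>I. l i * f i u) = 0) \<longleftrightarrow> (\<forall>c\<in>C. (\<Sum>i\<in>I. l i * f i (b c)) = 0)" for l
  proof (intro iffI ballI)
    fix u assume *: "\<forall>c\<in>C. (\<Sum>i\<in>I. l i * f i (b c)) = 0" and u: "u \<in> S"
    have "f i u = (\<Sum>c\<in>C. u c * f i (b c))" for i
      by (rule trans[OF arg_cong[where f = "f i", OF b(2)[OF u]] linear_functional_sum[OF lin C]])
    then have "(\<Sum>i\<in>I. l i * f i u) = (\<Sum>i\<in>I. \<Sum>c\<in>C. u c * (l i * f i (b c)))"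
      by (simp add: sum_distrib_left algebra_simps)
    also have "\<dots> = (\<Sum>c\<in>C. u c * (\<Sum>i\<in>I. l i * f i (b c)))"
      by (subst sum.swap) (simp add: sum_distrib_left)
    finally show "(\<Sum>i\<in>I. l i * f i u) = 0" using * by simp
  qed (use b(1) in blast)
  then show ?thesis using independent_on_iff_coefficients[OF S lin I] by simp
qed

lemma independent_on_card_le:
  assumes S: "subspace_of_functions S" "coordinates_of S C" and lin: "\<And>i. linear_functional (f i)"
    and I: "finite I" "independent_on S f I"
  shows "card I \<le> card C"
proof (rule ccontr)
  assume "\<not> card I \<le> card C"
  then have less: "card C < card I" by simp
  have fin: "finite C" using S(2) by (simp add: coordinates_of_def)
  obtain b where b': "\<forall>c\<in>C. b c \<in> S" "\<forall>c\<in>C. \<forall>d\<in>C. b c d = (if d = c then 1 else 0)"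
    "\<forall>u\<in>S. u = (\<lambda>k. \<Sum>c\<in>C. u c * b c k)"
    using coordinate_basis[OF S] by (elim exE conjE) (rule that)
  note b = b'[rule_format]
  obtain l where l: "\<exists>i\<in>I. l i \<noteq> 0" "\<forall>c\<in>C. (\<Sum>i\<in>I. f i (b c) * l i) = 0"
    using underdetermined_system[OF fin I(1) less, of "\<lambda>c i. f i (b c)"] by blast
  have l': "\<forall>c\<in>C. (\<Sum>i\<in>I. l i * f i (b c)) = 0"
    using l(2) by (simp add: mult.commute)
  have iff: "independent_on S f I \<longleftrightarrow>
      (\<forall>l. (\<forall>c\<in>C. (\<Sum>i\<in>I. l i * f i (b c)) = 0) \<longrightarrow> (\<forall>i\<in>I. l i = 0))"
    using S(1) lin I(1) fin b(1,3) by (rule independent_on_iff_rows)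
  have "\<forall>i\<in>I. l i = 0" by (rule mp[OF spec[OF iffD1[OF iff I(2)]] l'])
  then show False using l(1) by blast
qed

text \<open>A functional that does not vanish on the common zeros of an independent family can be added to
  it; one that does vanish there changes nothing.\<close>

lemma exists_independent_basis:
  assumes S: "subspace_of_functions S" and lin: "\<And>i. linear_functional (f i)" and "finite I"
  shows "\<exists>B\<subseteq>I. independent_on S f B \<and> solutions S f B = solutions S f I"
  using \<open>finite I\<close>
proof (induction I rule: finite_induct)
  case empty
  then show ?case by (auto simp: independent_on_def)
next
  case (insert i I)
  then obtain B where B: "B \<subseteq> I" "independent_on S f B" "solutions S f B = solutions S f I" by blast
  show ?case
  proof (cases "\<exists>u\<in>solutions S f B. f i u \<noteq> 0")
    case True
    then have "independent_on S f (insert i B)"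
      using independent_on_insert[OF S lin B(2)] by blast
    moreover have "solutions S f (insert i B) = solutions S f (insert i I)"
      using B(3) by (simp add: solutions_insert)
    moreover have "insert i B \<subseteq> insert i I" using B(1) by blast
    ultimately show ?thesis by blast
  next
    case False
    then have "solutions S f B = solutions S f (insert i I)"
      using B(3) by (auto simp: solutions_insert)
    then show ?thesis using B by (intro exI[of _ B]) blast
  qed
qed

text \<open>In a minimal subfamily \<open>J\<close> that forces \<open>e\<close> to vanish, dropping a member \<open>i\<close> leaves a common zero
  that detects \<open>e\<close>; by the choice of \<open>J\<close> it also detects \<open>i\<close>.\<close>

lemma exists_circuit:
  assumes S: "subspace_of_functions S" and lin: "\<And>i. linear_functional (f i)" and "finite I"
    and e: "\<And>u. u \<in> solutions S f I \<Longrightarrow> f e u = 0" "e \<notin> I"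
  shows "\<exists>J\<subseteq>I. (\<forall>u\<in>solutions S f J. f e u = 0) \<and> independent_on S f J \<and>
           (\<forall>i\<in>J. independent_on S f (insert e J - {i}))"
proof -
  let ?P = "\<lambda>J. J \<subseteq> I \<and> (\<forall>u\<in>solutions S f J. f e u = 0)"
  have "?P I" using e by blast
  then obtain J where J: "?P J" and min: "\<And>J'. ?P J' \<Longrightarrow> card J \<le> card J'"
    using ex_has_least_nat[of ?P I card] by blast
  have finJ: "finite J" using J \<open>finite I\<close> finite_subset by blast
  have wit: "\<exists>u\<in>solutions S f (J - {i}). f e u \<noteq> 0" if "i \<in> J" for i
  proof (rule ccontr)
    assume "\<not> ?thesis"
    then have "card J \<le> card (J - {i})" using J by (intro min) auto
    then show False using that finJ by (meson card_Diff1_less leD)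
  qed
  have ind: "independent_on S f J"
    unfolding independent_on_def
  proof
    fix i assume i: "i \<in> J"
    then obtain u where u: "u \<in> solutions S f (J - {i})" "f e u \<noteq> 0" using wit by blast
    have "f i u \<noteq> 0"
    proof
      assume "f i u = 0"
      then have "u \<in> solutions S f J" using u(1) by (auto simp: solutions_def)
      then show False using J u(2) by blast
    qed
    then show "\<exists>u\<in>solutions S f (J - {i}). f i u \<noteq> 0" using u by blast
  qed
  moreover have "independent_on S f (insert e J - {i})" if i: "i \<in> J" for i
  proof -
    have "e \<noteq> i" using i J e(2) by blast
    then have "insert e J - {i} = insert e (J - {i})" by blast
    moreover have "independent_on S f (J - {i})"
      by (rule independent_on_subset[OF ind]) blast
    moreover obtain u where "u \<in> solutions S f (J - {i})" "f e u \<noteq> 0" using wit[OF i] by blast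
    ultimately show ?thesis by (simp add: independent_on_insert[OF S lin])
  qed
  ultimately show ?thesis using J by blast
qed

section \<open>Polynomial functions and generic rank\<close>

text \<open>Sums and products of polynomial functions with coefficients in a ring are polynomial functions; the
  complex ones have real and imaginary parts of this kind. A polynomial function that does not vanish
  identically does not vanish at algebraically independent coordinates.\<close>

definition monomial_value :: "('i \<Rightarrow>\<^sub>0 nat) \<Rightarrow> ('i \<Rightarrow> real) \<Rightarrow> real" where
  "monomial_value m x = (\<Prod>i\<in>Poly_Mapping.keys m. x i ^ Poly_Mapping.lookup m i)"

definition polys_over :: "real set \<Rightarrow> 'i set \<Rightarrow> (('i \<Rightarrow>\<^sub>0 nat) \<Rightarrow>\<^sub>0 real) set" where
  "polys_over K I = {P. \<forall>m\<in>Poly_Mapping.keys P. Poly_Mapping.lookup P m \<in> K \<and> Poly_Mapping.keys m \<subseteq> I}"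

definition real_polys :: "real set \<Rightarrow> 'i set \<Rightarrow> (('i \<Rightarrow> real) \<Rightarrow> real) set" where
  "real_polys K I = eval_poly_mapping ` polys_over K I"

definition complex_polys :: "real set \<Rightarrow> 'i set \<Rightarrow> (('i \<Rightarrow> real) \<Rightarrow> complex) set" where
  "complex_polys K I = {f. \<exists>g\<in>real_polys K I. \<exists>h\<in>real_polys K I. \<forall>x. f x = Complex (g x) (h x)}"

definition real_subring :: "real set \<Rightarrow> bool" where
  "real_subring K \<longleftrightarrow> 0 \<in> K \<and> 1 \<in> K \<and> - 1 \<in> K \<and> (\<forall>x\<in>K. \<forall>y\<in>K. x + y \<in> K \<and> x * y \<in> K)"

lemma monomial_value_superset:
  assumes "finite S" "Poly_Mapping.keys m \<subseteq> S"
  shows "monomial_value m x = (\<Prod>i\<in>S. x i ^ Poly_Mapping.lookup m i)"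
  unfolding monomial_value_def
  by (rule prod.mono_neutral_left) (use assms in \<open>auto simp: in_keys_iff\<close>)

lemma monomial_value_add: "monomial_value (m + n) x = monomial_value m x * monomial_value n x"
proof -
  let ?S = "Poly_Mapping.keys m \<union> Poly_Mapping.keys n"
  have "Poly_Mapping.keys (m + n) \<subseteq> ?S" by (rule Poly_Mapping.keys_add)
  then have "monomial_value (m + n) x = (\<Prod>i\<in>?S. x i ^ Poly_Mapping.lookup (m + n) i)"
    by (intro monomial_value_superset) auto
  also have "\<dots> = (\<Prod>i\<in>?S. x i ^ Poly_Mapping.lookup m i) * (\<Prod>i\<in>?S. x i ^ Poly_Mapping.lookup n i)"
    by (simp add: lookup_add power_add prod.distrib)
  also have "\<dots> = monomial_value m x * monomial_value n x"
    by (simp add: monomial_value_superset[of ?S])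
  finally show ?thesis .
qed

lemma eval_superset:
  assumes "finite M" "Poly_Mapping.keys P \<subseteq> M"
  shows "eval_poly_mapping P x = (\<Sum>m\<in>M. Poly_Mapping.lookup P m * monomial_value m x)"
  unfolding eval_poly_mapping_def monomial_value_def
  by (rule sum.mono_neutral_left) (use assms in \<open>auto simp: in_keys_iff\<close>)

lemma eval_eq: "eval_poly_mapping P x = (\<Sum>m\<in>Poly_Mapping.keys P. Poly_Mapping.lookup P m * monomial_value m x)"
  by (rule eval_superset) auto

lemma eval_add: "eval_poly_mapping (P + Q) x = eval_poly_mapping P x + eval_poly_mapping Q x"
proof -
  let ?M = "Poly_Mapping.keys P \<union> Poly_Mapping.keys Q"
  have "Poly_Mapping.keys (P + Q) \<subseteq> ?M" by (rule Poly_Mapping.keys_add)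
  then have "eval_poly_mapping (P + Q) x = (\<Sum>m\<in>?M. Poly_Mapping.lookup (P + Q) m * monomial_value m x)"
    by (intro eval_superset) auto
  also have "\<dots> = (\<Sum>m\<in>?M. Poly_Mapping.lookup P m * monomial_value m x) +
      (\<Sum>m\<in>?M. Poly_Mapping.lookup Q m * monomial_value m x)"
    by (simp add: lookup_add distrib_right sum.distrib)
  also have "\<dots> = eval_poly_mapping P x + eval_poly_mapping Q x"
    by (simp add: eval_superset[of ?M])
  finally show ?thesis .
qed

lemma eval_single: "eval_poly_mapping (Poly_Mapping.single m c) x = c * monomial_value m x"
  by (subst eval_superset[of "{m}"]) simp_all

lemma real_polys_add:
  assumes K: "real_subring K" and "f \<in> real_polys K I" "g \<in> real_polys K I"
  shows "(\<lambda>x. f x + g x) \<in> real_polys K I"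
proof -
  obtain P Q where P: "P \<in> polys_over K I" "f = eval_poly_mapping P"
    and Q: "Q \<in> polys_over K I" "g = eval_poly_mapping Q"
    using assms(2,3) unfolding real_polys_def by blast
  have PK: "Poly_Mapping.lookup P m \<in> K" "Poly_Mapping.lookup Q m \<in> K" for m
    using P(1) Q(1) K unfolding polys_over_def real_subring_def
    by (cases "m \<in> Poly_Mapping.keys P"; cases "m \<in> Poly_Mapping.keys Q"; simp add: in_keys_iff)+
  have "P + Q \<in> polys_over K I"
    unfolding polys_over_def mem_Collect_eq
  proof (intro ballI conjI)
    fix m assume m: "m \<in> Poly_Mapping.keys (P + Q)"
    show "Poly_Mapping.lookup (P + Q) m \<in> K"
      using PK[of m] K by (simp add: lookup_add real_subring_def)
    have "m \<in> Poly_Mapping.keys P \<union> Poly_Mapping.keys Q" by (rule subsetD[OF Poly_Mapping.keys_add m])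
    then show "Poly_Mapping.keys m \<subseteq> I" using P(1) Q(1) unfolding polys_over_def by blast
  qed
  moreover have "(\<lambda>x. f x + g x) = eval_poly_mapping (P + Q)" using P Q by (simp add: eval_add fun_eq_iff)
  ultimately show ?thesis unfolding real_polys_def by simp
qed

lemma real_polys_monomial:
  assumes "c \<in> K" "Poly_Mapping.keys m \<subseteq> I"
  shows "(\<lambda>x. c * monomial_value m x) \<in> real_polys K I"
proof -
  have "Poly_Mapping.single m c \<in> polys_over K I"
    using assms by (auto simp: polys_over_def)
  moreover have "(\<lambda>x. c * monomial_value m x) = eval_poly_mapping (Poly_Mapping.single m c)"
    by (simp add: eval_single fun_eq_iff)
  ultimately show ?thesis unfolding real_polys_def by simp
qed

lemma real_polys_const: "c \<in> K \<Longrightarrow> (\<lambda>x. c) \<in> real_polys K I"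
  using real_polys_monomial[of c K 0 I] by (simp add: monomial_value_def)

lemma real_polys_var:
  assumes "1 \<in> K" "i \<in> I" shows "(\<lambda>x. x i) \<in> real_polys K I"
  using real_polys_monomial[of 1 K "Poly_Mapping.single i 1" I] assms
  by (simp add: monomial_value_def)

lemma real_polys_sum:
  assumes K: "real_subring K" and "finite J" "\<And>j. j \<in> J \<Longrightarrow> f j \<in> real_polys K I"
  shows "(\<lambda>x. \<Sum>j\<in>J. f j x) \<in> real_polys K I"
  using assms(2,3)
proof (induction J rule: finite_induct)
  case empty
  then show ?case using K real_polys_const[of 0 K I] by (simp add: real_subring_def)
next
  case (insert j J)
  then have "(\<lambda>x. f j x + (\<Sum>j\<in>J. f j x)) \<in> real_polys K I"
    by (intro real_polys_add[OF K]) auto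
  then show ?case using insert.hyps by simp
qed

lemma real_polys_mult:
  assumes K: "real_subring K" and "f \<in> real_polys K I" "g \<in> real_polys K I"
  shows "(\<lambda>x. f x * g x) \<in> real_polys K I"
proof -
  obtain P Q where P: "P \<in> polys_over K I" "f = eval_poly_mapping P"
    and Q: "Q \<in> polys_over K I" "g = eval_poly_mapping Q"
    using assms(2,3) unfolding real_polys_def by blast
  let ?t = "\<lambda>m n x. (Poly_Mapping.lookup P m * Poly_Mapping.lookup Q n) * monomial_value (m + n) x"
  have "f x * g x = (\<Sum>m\<in>Poly_Mapping.keys P. \<Sum>n\<in>Poly_Mapping.keys Q. ?t m n x)" for x
    unfolding P(2) Q(2) eval_eq sum_product by (intro sum.cong refl) (simp add: monomial_value_add)
  then have e: "(\<lambda>x. f x * g x) = (\<lambda>x. \<Sum>m\<in>Poly_Mapping.keys P. \<Sum>n\<in>Poly_Mapping.keys Q. ?t m n x)"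
    by (rule ext)
  show ?thesis
    unfolding e
  proof (intro real_polys_sum[OF K] finite_keys real_polys_monomial)
    fix m n assume m: "m \<in> Poly_Mapping.keys P" and n: "n \<in> Poly_Mapping.keys Q"
    show "Poly_Mapping.lookup P m * Poly_Mapping.lookup Q n \<in> K"
      using P(1) Q(1) K m n unfolding polys_over_def real_subring_def by simp
    have "Poly_Mapping.keys (m + n) \<subseteq> Poly_Mapping.keys m \<union> Poly_Mapping.keys n"
      by (rule Poly_Mapping.keys_add)
    then show "Poly_Mapping.keys (m + n) \<subseteq> I"
      using P(1) Q(1) m n unfolding polys_over_def by blast
  qed
qed

lemma real_polys_minus:
  assumes "real_subring K" "f \<in> real_polys K I" shows "(\<lambda>x. - f x) \<in> real_polys K I"
proof -
  have "(\<lambda>x. - 1 * f x) \<in> real_polys K I"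
    by (intro real_polys_mult assms real_polys_const) (use assms in \<open>simp add: real_subring_def\<close>)
  then show ?thesis by simp
qed

lemma complex_polysI:
  "g \<in> real_polys K I \<Longrightarrow> h \<in> real_polys K I \<Longrightarrow> (\<And>x. f x = Complex (g x) (h x)) \<Longrightarrow> f \<in> complex_polys K I"
  unfolding complex_polys_def by blast

lemma complex_polysE:
  assumes "f \<in> complex_polys K I"
  obtains g h where "g \<in> real_polys K I" "h \<in> real_polys K I" "\<And>x. f x = Complex (g x) (h x)"
  using assms unfolding complex_polys_def by blast

lemma complex_polys_add:
  assumes K: "real_subring K" and "f \<in> complex_polys K I" "g \<in> complex_polys K I"
  shows "(\<lambda>x. f x + g x) \<in> complex_polys K I"
proof -
  obtain f1 f2 where f: "f1 \<in> real_polys K I" "f2 \<in> real_polys K I" "\<And>x. f x = Complex (f1 x) (f2 x)"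
    using assms(2) by (rule complex_polysE) (rule that)
  obtain g1 g2 where g: "g1 \<in> real_polys K I" "g2 \<in> real_polys K I" "\<And>x. g x = Complex (g1 x) (g2 x)"
    using assms(3) by (rule complex_polysE) (rule that)
  show ?thesis
    by (rule complex_polysI[OF real_polys_add[OF K f(1) g(1)] real_polys_add[OF K f(2) g(2)]])
      (simp add: f(3) g(3) complex_eq_iff)
qed

lemma complex_polys_mult:
  assumes K: "real_subring K" and "f \<in> complex_polys K I" "g \<in> complex_polys K I"
  shows "(\<lambda>x. f x * g x) \<in> complex_polys K I"
proof -
  obtain f1 f2 where f: "f1 \<in> real_polys K I" "f2 \<in> real_polys K I" "\<And>x. f x = Complex (f1 x) (f2 x)"
    using assms(2) by (rule complex_polysE) (rule that)
  obtain g1 g2 where g: "g1 \<in> real_polys K I" "g2 \<in> real_polys K I" "\<And>x. g x = Complex (g1 x) (g2 x)"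
    using assms(3) by (rule complex_polysE) (rule that)
  note m = real_polys_mult[OF K] real_polys_add[OF K] real_polys_minus[OF K]
  show ?thesis
  proof (rule complex_polysI)
    show "(\<lambda>x. f1 x * g1 x + - (f2 x * g2 x)) \<in> real_polys K I"
      by (intro m f g)
    show "(\<lambda>x. f1 x * g2 x + f2 x * g1 x) \<in> real_polys K I"
      by (intro m f g)
    show "f x * g x = Complex (f1 x * g1 x + - (f2 x * g2 x)) (f1 x * g2 x + f2 x * g1 x)" for x
      by (simp add: f(3) g(3) complex_eq_iff)
  qed
qed

lemma complex_polys_cnj:
  assumes K: "real_subring K" and "f \<in> complex_polys K I"
  shows "(\<lambda>x. cnj (f x)) \<in> complex_polys K I"
proof -
  obtain f1 f2 where f: "f1 \<in> real_polys K I" "f2 \<in> real_polys K I" "\<And>x. f x = Complex (f1 x) (f2 x)"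
    using assms(2) by (rule complex_polysE) (rule that)
  show ?thesis
    by (rule complex_polysI[OF f(1) real_polys_minus[OF K f(2)]]) (simp add: f(3) complex_eq_iff)
qed

lemma complex_polys_const:
  assumes "Re c \<in> K" "Im c \<in> K" shows "(\<lambda>x. c) \<in> complex_polys K I"
  by (rule complex_polysI[OF real_polys_const[OF assms(1)] real_polys_const[OF assms(2)]]) (simp add: complex_eq_iff)

lemma complex_polys_diff:
  assumes K: "real_subring K" and "f \<in> complex_polys K I" "g \<in> complex_polys K I"
  shows "(\<lambda>x. f x - g x) \<in> complex_polys K I"
proof -
  have "(\<lambda>x. f x + - 1 * g x) \<in> complex_polys K I"
    by (intro complex_polys_add[OF K] complex_polys_mult[OF K] complex_polys_const assms(2,3))
      (use K in \<open>simp_all add: real_subring_def\<close>)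
  then show ?thesis by simp
qed

lemma complex_polys_generic:
  assumes alg: "algebraically_independent_over K I x" and f: "f \<in> complex_polys K I" "f y \<noteq> 0"
  shows "f x \<noteq> 0"
proof -
  obtain g h where gh: "g \<in> real_polys K I" "h \<in> real_polys K I" "\<And>x. f x = Complex (g x) (h x)"
    using f(1) by (rule complex_polysE) (rule that)
  have nz: "p x \<noteq> 0" if "p \<in> real_polys K I" "p y \<noteq> 0" for p
  proof -
    obtain P where P: "P \<in> polys_over K I" "p = eval_poly_mapping P"
      using \<open>p \<in> real_polys K I\<close> unfolding real_polys_def by blast
    have "P \<noteq> 0" using that(2) P(2) by (auto simp: eval_eq)
    then show ?thesis using alg P unfolding algebraically_independent_over_def polys_over_def by blast
  qed
  have "g y \<noteq> 0 \<or> h y \<noteq> 0" using f(2) gh(3)[of y] by (auto simp: complex_eq_iff)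
  then have "g x \<noteq> 0 \<or> h x \<noteq> 0" using nz gh(1,2) by blast
  then show ?thesis using gh(3)[of x] by (auto simp: complex_eq_iff)
qed

text \<open>Fraction-free elimination: rows that are independent at one point remain so wherever a certain
  function of their entries, the product of the pivots, does not vanish.\<close>

lemma independent_rows_open:
  fixes r :: "'e \<Rightarrow> 'c \<Rightarrow> 'x \<Rightarrow> 'a::field"
  assumes "finite F"
    and one: "(\<lambda>_. 1) \<in> A" and mult: "\<And>f g. f \<in> A \<Longrightarrow> g \<in> A \<Longrightarrow> (\<lambda>x. f x * g x) \<in> A"
    and diff: "\<And>f g. f \<in> A \<Longrightarrow> g \<in> A \<Longrightarrow> (\<lambda>x. f x - g x) \<in> A"
    and "\<And>e c. e \<in> F \<Longrightarrow> c \<in> C \<Longrightarrow> r e c \<in> A"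
    and "\<And>l. (\<forall>c\<in>C. (\<Sum>e\<in>F. l e * r e c y) = 0) \<Longrightarrow> \<forall>e\<in>F. l e = 0"
  shows "\<exists>f\<in>A. f y \<noteq> 0 \<and> (\<forall>x. f x \<noteq> 0 \<longrightarrow>
    (\<forall>l. (\<forall>c\<in>C. (\<Sum>e\<in>F. l e * r e c x) = 0) \<longrightarrow> (\<forall>e\<in>F. l e = 0)))"
  using assms(1,5,6)
proof (induction F arbitrary: r rule: finite_induct)
  case empty
  then show ?case using one by (intro bexI[of _ "\<lambda>_. 1"]) simp_all
next
  case (insert e F)
  have "\<exists>c\<in>C. r e c y \<noteq> 0"
  proof (rule ccontr)
    assume no: "\<not> ?thesis"
    let ?l = "\<lambda>f. if f = e then 1 else 0 :: 'a"
    have "(\<Sum>f\<in>insert e F. ?l f * r f c y) = 0" if "c \<in> C" for c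
      using no that insert.hyps by (intro sum.neutral) auto
    then have "\<forall>f\<in>insert e F. ?l f = 0" by (intro insert.prems(2)) blast
    then show False by simp
  qed
  then obtain c where c: "c \<in> C" "r e c y \<noteq> 0" by blast
  define s where "s f d = (\<lambda>x. r e c x * r f d x - r f c x * r e d x)" for f d
  have expand: "(\<Sum>f\<in>F. l f * s f d x) =
      r e c x * (\<Sum>f\<in>F. l f * r f d x) - (\<Sum>f\<in>F. l f * r f c x) * r e d x" for l d x
    by (simp add: s_def sum_distrib_left sum_distrib_right sum_subtractf[symmetric] algebra_simps)
  have sA: "s f d \<in> A" if "f \<in> F" "d \<in> C" for f d
    unfolding s_def using that c(1) by (intro mult diff insert.prems(1)) auto
  have sind: "\<forall>f\<in>F. l f = 0" if l: "\<forall>d\<in>C. (\<Sum>f\<in>F. l f * s f d y) = 0" for l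
  proof -
    define m where "m f = (if f = e then - (\<Sum>f\<in>F. l f * r f c y) else r e c y * l f)" for f
    have "(\<Sum>f\<in>insert e F. m f * r f d y) = 0" if "d \<in> C" for d
    proof -
      have "(\<Sum>f\<in>F. m f * r f d y) = (\<Sum>f\<in>F. r e c y * (l f * r f d y))"
        by (rule sum.cong) (use insert.hyps in \<open>auto simp: m_def\<close>)
      then have "(\<Sum>f\<in>insert e F. m f * r f d y) = (\<Sum>f\<in>F. l f * s f d y)"
        using insert.hyps by (simp add: expand sum_distrib_left[symmetric]) (simp add: m_def)
      then show ?thesis using l that by simp
    qed
    then have "\<forall>f\<in>insert e F. m f = 0" by (intro insert.prems(2)) blast
    then show ?thesis using c(2) insert.hyps by (auto simp: m_def split: if_splits)
  qed
  have "\<exists>f\<in>A. f y \<noteq> 0 \<and> (\<forall>x. f x \<noteq> 0 \<longrightarrow>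
    (\<forall>l. (\<forall>c\<in>C. (\<Sum>e\<in>F. l e * s e c x) = 0) \<longrightarrow> (\<forall>e\<in>F. l e = 0)))"
    using sA sind by (rule insert.IH)
  then obtain g where g: "g \<in> A" "g y \<noteq> 0"
    "\<forall>x. g x \<noteq> 0 \<longrightarrow> (\<forall>l. (\<forall>d\<in>C. (\<Sum>f\<in>F. l f * s f d x) = 0) \<longrightarrow> (\<forall>f\<in>F. l f = 0))"
    by (elim bexE conjE) (rule that)
  have "\<forall>f\<in>insert e F. l f = 0"
    if x: "g x * r e c x \<noteq> 0" and l: "\<forall>d\<in>C. (\<Sum>f\<in>insert e F. l f * r f d x) = 0" for x l
  proof -
    have l': "(\<Sum>f\<in>F. l f * r f d x) = - (l e * r e d x)" if "d \<in> C" for d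
      using bspec[OF l that] insert.hyps by (simp add: eq_neg_iff_add_eq_0 add.commute)
    have "(\<Sum>f\<in>F. l f * s f d x) = 0" if "d \<in> C" for d
      unfolding expand l'[OF that] l'[OF c(1)] by (simp add: algebra_simps)
    moreover have "g x \<noteq> 0" using x by auto
    ultimately have 0: "\<forall>f\<in>F. l f = 0" using g(3) by blast
    then have "(\<Sum>f\<in>F. l f * r f c x) = 0" by (intro sum.neutral) simp
    then have "l e = 0" using l'[OF c(1)] x by simp
    then show ?thesis using 0 by simp
  qed
  moreover have "(\<lambda>x. g x * r e c x) \<in> A" using g(1) insert.prems(1) c(1) by (intro mult) auto
  moreover have "g y * r e c y \<noteq> 0" using g(2) c(2) by simp
  ultimately show ?case by (intro bexI[of _ "\<lambda>x. g x * r e c x"]) blast+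
qed

text \<open>On the unit circle conjugation is inversion, which turns the collinearity determinant into a
  quotient of the Vandermonde determinant of the three points.\<close>

lemma unit_circle_general_position:
  fixes x y z :: complex
  assumes "cmod x = 1" "cmod y = 1" "cmod z = 1" and d: "x \<noteq> y" "x \<noteq> z" "y \<noteq> z"
  shows "cnj (z - x) * (z - y) \<noteq> (z - x) * cnj (z - y)"
proof
  have c: "w * cnj w = 1" if "cmod w = 1" for w
    using that by (simp add: complex_norm_square[symmetric])
  have "x * y * z * (cnj (z - x) * (z - y) - (z - x) * cnj (z - y)) =
    (z * cnj z) * x * y * (z - y) - (x * cnj x) * y * z * (z - y) -
    (z * cnj z) * x * y * (z - x) + (y * cnj y) * x * z * (z - x)"
    by (simp add: algebra_simps)
  also have "\<dots> = (z - x) * (z - y) * (x - y)"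
    by (simp add: c assms algebra_simps)
  finally have e: "x * y * z * (cnj (z - x) * (z - y) - (z - x) * cnj (z - y)) = (z - x) * (z - y) * (x - y)" .
  assume "cnj (z - x) * (z - y) = (z - x) * cnj (z - y)"
  then have "(z - x) * (z - y) * (x - y) = 0" using e by simp
  then show False using d by simp
qed

section \<open>Counting blocks in mixed-connected graphs\<close>

lemma mixed_connected_no_separation:
  assumes conn: "mixed_connected n V E" and small: "2 * card W + card F < n"
    and sub: "W \<subseteq> V" "F \<subseteq> E" and parts: "A \<union> B = V - W" "A \<inter> B = {}"
    and sep: "\<And>a b. a \<in> A \<Longrightarrow> b \<in> B \<Longrightarrow> {a, b} \<in> E \<Longrightarrow> {a, b} \<in> F"
  shows "A = {} \<or> B = {}"
proof (rule ccontr)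
  assume "\<not> (A = {} \<or> B = {})"
  then obtain a b where ab: "a \<in> A" "b \<in> B" by blast
  let ?R = "{(x, y). x \<in> V - W \<and> y \<in> V - W \<and> {x, y} \<in> {e \<in> E - F. e \<inter> W = {}}}"
  have "connected_graph (V - W) {e \<in> E - F. e \<inter> W = {}}"
    using conn small sub unfolding mixed_connected_def by blast
  moreover have "a \<in> V - W" "b \<in> V - W" using ab parts by blast+
  ultimately have "(a, b) \<in> ?R\<^sup>*" unfolding connected_graph_def by blast
  then have "b \<in> A"
  proof (induction rule: rtrancl_induct)
    case base
    then show ?case using ab by simp
  next
    case (step x y)
    then have "y \<in> A \<union> B" "{x, y} \<in> E" "{x, y} \<notin> F" unfolding parts(1) by auto
    then show ?case using step.IH sep[of x y] by blast
  qed
  then show False using ab parts(2) by blast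
qed

lemma mixed_connected_degree:
  assumes G: "finite_simple_graph V E" and conn: "mixed_connected n V E"
    and v: "v \<in> V" "V \<noteq> {v}"
  shows "n \<le> card {e \<in> E. v \<in> e}"
proof (rule ccontr)
  assume "\<not> n \<le> card {e \<in> E. v \<in> e}"
  then have "{v} = {} \<or> V - {v} = {}"
    by (intro mixed_connected_no_separation[OF conn, of "{}" "{e \<in> E. v \<in> e}"]) (use v in auto)
  then show False using v by blast
qed

text \<open>A discharging argument. A block with \<open>k\<close> vertices distributes \<open>2 k - 3\<close> units: the vertex \<open>v\<close> receives
  \<open>2 - c/2\<close> units, where its cost \<open>c\<close> is 3 if \<open>k = 2\<close>; otherwise it is 0 if \<open>v\<close> lies in no other block, 1 if
  \<open>v\<close> lies in just one other block and that block has two vertices (\<open>v\<close> is weak), and 2 in the remaining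
  case (\<open>v\<close> is strong).

  The block can afford this if its costs add up to at least 6. For \<open>k \<ge> 3\<close>, deleting the strong
  vertices and, at each weak vertex, the edge that forms its other block cuts the block off from the
  rest of the graph. Since a deleted vertex counts twice and a deleted edge once, the cost is the size
  of a mixed cut.

  Every vertex receives at least 2 units: if all its blocks have two vertices, it has at least six of
  them because its degree is at least 6, and the other cases are immediate from the costs.\<close>

theorem mixed_connected_cover:
  assumes G: "finite_simple_graph V E" and conn: "mixed_connected 6 V E" and V2: "2 \<le> card V"
    and sub: "\<And>Z. Z \<in> \<B> \<Longrightarrow> Z \<subset> V \<and> 2 \<le> card Z"
    and meet: "\<And>Z Y x y. Z \<in> \<B> \<Longrightarrow> Y \<in> \<B> \<Longrightarrow> {x, y} \<subseteq> Z \<inter> Y \<Longrightarrow> x \<noteq> y \<Longrightarrow> Z = Y"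
    and cov: "\<And>e. e \<in> E \<Longrightarrow> \<exists>Z\<in>\<B>. e \<subseteq> Z"
  shows "2 * card V + 3 * card \<B> \<le> 2 * (\<Sum>Z\<in>\<B>. card Z)"
proof -
  have finV: "finite V" using G by (simp add: finite_simple_graph_def)
  have edge: "card e = 2 \<and> e \<subseteq> V" if "e \<in> E" for e
    using G that unfolding finite_simple_graph_def by (metis card_2_iff empty_subsetI insert_subset)
  have finB: "finite \<B>"
    by (rule finite_subset[of _ "Pow V"]) (use sub finV in auto)
  have finX: "finite Z" if "Z \<in> \<B>" for Z
    using sub[OF that] finV finite_subset by blast
  define others where "others Z v = {Y \<in> \<B>. v \<in> Y \<and> Y \<noteq> Z}" for Z v
  define weak where "weak Z v \<longleftrightarrow> (\<exists>Y. others Z v = {Y} \<and> card Y = 2)" for Z v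
  define cost :: "'a set \<Rightarrow> 'a \<Rightarrow> nat" where
    "cost Z v = (if card Z = 2 then 3 else if others Z v = {} then 0 else if weak Z v then 1 else 2)" for Z v
  have cost_le: "cost Z v \<le> 4" for Z v by (simp add: cost_def)
  have total: "6 \<le> (\<Sum>v\<in>Z. cost Z v)" if Z: "Z \<in> \<B>" for Z
  proof (cases "card Z = 2")
    case True
    then show ?thesis by (simp add: cost_def)
  next
    case False
    then have X3: "3 \<le> card Z" using sub[OF Z] by linarith
    define S where "S = {v \<in> Z. others Z v \<noteq> {} \<and> \<not> weak Z v}"
    define K where "K = {v \<in> Z. weak Z v}"
    have SK: "S \<inter> K = {}" "S \<subseteq> Z" "K \<subseteq> Z" by (auto simp: S_def K_def)
    have fin: "finite S" "finite K" using SK finX[OF Z] finite_subset by blast+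
    have "(\<Sum>v\<in>Z. cost Z v) = (\<Sum>v\<in>S \<union> K. cost Z v)"
      by (rule sum.mono_neutral_right) (use finX[OF Z] False in \<open>auto simp: S_def K_def cost_def\<close>)
    also have "\<dots> = (\<Sum>v\<in>S. cost Z v) + (\<Sum>v\<in>K. cost Z v)"
      by (rule sum.union_disjoint) (use fin SK in auto)
    also have "(\<Sum>v\<in>S. cost Z v) = (\<Sum>v\<in>S. 2)"
      by (rule sum.cong) (use False in \<open>auto simp: S_def cost_def\<close>)
    also have "(\<Sum>v\<in>K. cost Z v) = (\<Sum>v\<in>K. 1)"
      by (rule sum.cong) (use False in \<open>auto simp: K_def cost_def weak_def\<close>)
    finally have cost: "(\<Sum>v\<in>Z. cost Z v) = 2 * card S + card K" by simp
    show ?thesis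
    proof (rule ccontr)
      assume "\<not> ?thesis"
      then have small: "2 * card S + card K < 6" using cost by simp
      define F where "F = {e \<in> E. \<exists>v\<in>K. e \<in> others Z v}"
      have "F \<subseteq> (\<lambda>v. the_elem (others Z v)) ` K"
      proof
        fix e assume "e \<in> F"
        then obtain v where v: "v \<in> K" "e \<in> others Z v" by (auto simp: F_def)
        then have "others Z v = {e}" unfolding K_def weak_def by auto
        then show "e \<in> (\<lambda>v. the_elem (others Z v)) ` K" using v(1) by (metis image_eqI the_elem_eq)
      qed
      then have "card F \<le> card K"
        using fin(2) by (meson card_image_le card_mono finite_imageI order_trans)
      then have "2 * card S + card F < 6" using small by linarith
      then have "Z - S = {} \<or> V - Z = {}"
      proof (rule mixed_connected_no_separation[OF conn])
        show "S \<subseteq> V" "Z - S \<union> (V - Z) = V - S" "(Z - S) \<inter> (V - Z) = {}" "F \<subseteq> E"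
          using SK sub[OF Z] by (auto simp: F_def)
        fix a b assume a: "a \<in> Z - S" and b: "b \<in> V - Z" and e: "{a, b} \<in> E"
        obtain Y where Y: "Y \<in> \<B>" "{a, b} \<subseteq> Y" using cov[OF e] by blast
        then have "Y \<in> others Z a" using b by (auto simp: others_def)
        moreover from this have "weak Z a" using a by (auto simp: S_def)
        ultimately have "card Y = 2" by (auto simp: weak_def)
        then have "Y = {a, b}"
          using Y edge[OF e] finX[OF Y(1)] card_subset_eq by metis
        then show "{a, b} \<in> F"
          using e a \<open>weak Z a\<close> \<open>Y \<in> others Z a\<close> by (auto simp: F_def K_def)
      qed
      then have "Z = S" using sub[OF Z] SK by blast
      then show False using small X3 by simp
    qed
  qed
  have share: "4 \<le> (\<Sum>Z\<in>{Z \<in> \<B>. v \<in> Z}. 4 - cost Z v)" if v: "v \<in> V" for v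
  proof -
    let ?B = "{Z \<in> \<B>. v \<in> Z}"
    have fB: "finite ?B" using finB by simp
    show ?thesis
    proof (cases "\<exists>Z\<in>?B. card Z \<noteq> 2")
      case False
      have "{e \<in> E. v \<in> e} \<subseteq> ?B"
      proof
        fix e assume e: "e \<in> {e \<in> E. v \<in> e}"
        then obtain Z where Z: "Z \<in> \<B>" "e \<subseteq> Z" using cov by blast
        then have "Z = e" using False e edge[of e] finX[OF Z(1)] card_subset_eq by (metis mem_Collect_eq subsetD)
        then show "e \<in> ?B" using Z e by blast
      qed
      then have "card {e \<in> E. v \<in> e} \<le> card ?B" using fB by (simp add: card_mono)
      moreover have "6 \<le> card {e \<in> E. v \<in> e}"
        by (rule mixed_connected_degree[OF G conn v]) (use V2 in auto)
      moreover have "(\<Sum>Z\<in>?B. 4 - cost Z v) = (\<Sum>Z\<in>?B. 1)"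
        by (rule sum.cong) (use False in \<open>auto simp: cost_def\<close>)
      ultimately show ?thesis by simp
    next
      case True
      then obtain Z where Z: "Z \<in> \<B>" "v \<in> Z" "card Z \<noteq> 2" by blast
      have B: "?B = insert Z (others Z v)" "Z \<notin> others Z v" using Z by (auto simp: others_def)
      have fO: "finite (others Z v)" using finB by (simp add: others_def)
      have sumB: "(\<Sum>Z\<in>?B. 4 - cost Z v) = (4 - cost Z v) + (\<Sum>Y\<in>others Z v. 4 - cost Y v)"
        unfolding B(1) using B(2) fO by simp
      show ?thesis
      proof (cases "others Z v = {}")
        case True
        then show ?thesis unfolding sumB using Z by (simp add: cost_def)
      next
        case ne: False
        show ?thesis
        proof (cases "\<exists>Y\<in>others Z v. card Y \<noteq> 2")
          case True
          then obtain Y where Y: "Y \<in> others Z v" "card Y \<noteq> 2" by blast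
          have "4 - cost Y v \<le> (\<Sum>Y\<in>others Z v. 4 - cost Y v)"
            by (rule member_le_sum) (use Y fO in auto)
          moreover have "cost Z v \<le> 2" "cost Y v \<le> 2" using Z Y by (auto simp: cost_def)
          ultimately show ?thesis unfolding sumB by linarith
        next
          case False
          have "(\<Sum>Y\<in>others Z v. 4 - cost Y v) = (\<Sum>Y\<in>others Z v. 1)"
            by (rule sum.cong) (use False in \<open>auto simp: cost_def\<close>)
          then have o: "(\<Sum>Y\<in>others Z v. 4 - cost Y v) = card (others Z v)" by simp
          show ?thesis
          proof (cases "card (others Z v) = 1")
            case True
            then have "weak Z v" using False unfolding weak_def
              by (metis card_1_singletonE insertI1)
            then have "cost Z v = 1" using Z ne by (simp add: cost_def)
            then show ?thesis unfolding sumB o using True by simp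
          next
            case False
            moreover have "card (others Z v) \<noteq> 0" using ne fO by simp
            ultimately have "2 \<le> card (others Z v)" by linarith
            moreover have "cost Z v \<le> 2" using Z by (simp add: cost_def)
            ultimately show ?thesis unfolding sumB o by linarith
          qed
        qed
      qed
    qed
  qed
  have "4 * card V = (\<Sum>v\<in>V. 4)" by simp
  also have "\<dots> \<le> (\<Sum>v\<in>V. \<Sum>Z\<in>{Z \<in> \<B>. v \<in> Z}. 4 - cost Z v)"
    by (rule sum_mono) (rule share)
  also have "\<dots> = (\<Sum>Z\<in>\<B>. \<Sum>v\<in>{v \<in> V. v \<in> Z}. 4 - cost Z v)"
    by (rule sum.swap_restrict[OF finV finB])
  also have "\<dots> = (\<Sum>Z\<in>\<B>. \<Sum>v\<in>Z. 4 - cost Z v)"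
    by (intro sum.cong refl) (use sub in auto)
  finally have 1: "4 * card V \<le> (\<Sum>Z\<in>\<B>. \<Sum>v\<in>Z. 4 - cost Z v)" .
  have "(\<Sum>v\<in>Z. 4 - cost Z v) + 6 \<le> 4 * card Z" if Z: "Z \<in> \<B>" for Z
  proof -
    have "(\<Sum>v\<in>Z. 4 - cost Z v) + (\<Sum>v\<in>Z. cost Z v) = (\<Sum>v\<in>Z. 4)"
      unfolding sum.distrib[symmetric] by (rule sum.cong) (use cost_le in auto)
    then show ?thesis using total[OF Z] by simp
  qed
  then have "(\<Sum>Z\<in>\<B>. (\<Sum>v\<in>Z. 4 - cost Z v) + 6) \<le> (\<Sum>Z\<in>\<B>. 4 * card Z)"
    by (rule sum_mono)
  then have "(\<Sum>Z\<in>\<B>. \<Sum>v\<in>Z. 4 - cost Z v) + 6 * card \<B> \<le> 4 * (\<Sum>Z\<in>\<B>. card Z)"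
    by (simp add: sum.distrib sum_distrib_left)
  with 1 show ?thesis by linarith
qed

section \<open>Symmetric velocities of a threefold symmetric configuration\<close>

text \<open>A free action of the cyclic group of order three with generator \<open>\<sigma>\<close> and orbit representatives \<open>R\<close>,
  together with a primitive third root of unity \<open>\<omega>\<close> for the rotation and the value \<open>\<eta>\<close> at \<open>\<sigma>\<close> of a
  character of the group.\<close>

locale threefold_action =
  fixes V :: "'v set" and \<sigma> :: "'v \<Rightarrow> 'v" and R :: "'v set" and \<omega> \<eta> :: complex
  assumes finV: "finite V"
    and sigma_in: "x \<in> V \<Longrightarrow> \<sigma> x \<in> V"
    and sigma3: "x \<in> V \<Longrightarrow> \<sigma> (\<sigma> (\<sigma> x)) = x"
    and sigma_free: "x \<in> V \<Longrightarrow> \<sigma> x \<noteq> x"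
    and RV: "R \<subseteq> V"
    and reps: "x \<in> V \<Longrightarrow> \<exists>!r. r \<in> R \<and> x \<in> {r, \<sigma> r, \<sigma> (\<sigma> r)}"
    and omega: "\<omega> ^ 3 = 1" "\<omega> \<noteq> 1"
    and eta: "\<eta> ^ 3 = 1"
begin

definition orb :: "'v \<Rightarrow> 'v set" where "orb x = {x, \<sigma> x, \<sigma> (\<sigma> x)}"

lemma omega3: "\<omega> * \<omega> * \<omega> = 1" and eta3: "\<eta> * \<eta> * \<eta> = 1"
  using omega eta by (simp_all add: power3_eq_cube)

lemma character_cubes:
  "\<eta> * \<omega> * (\<eta> * \<omega>) * (\<eta> * \<omega>) = 1"
  "\<eta> * (\<omega> * \<omega>) * (\<eta> * (\<omega> * \<omega>)) * (\<eta> * (\<omega> * \<omega>)) = 1"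
proof -
  have "\<eta> * \<omega> * (\<eta> * \<omega>) * (\<eta> * \<omega>) = (\<eta> * \<eta> * \<eta>) * (\<omega> * \<omega> * \<omega>)"
    by (simp add: algebra_simps)
  then show "\<eta> * \<omega> * (\<eta> * \<omega>) * (\<eta> * \<omega>) = 1" by (simp add: omega3 eta3)
  have "\<eta> * (\<omega> * \<omega>) * (\<eta> * (\<omega> * \<omega>)) * (\<eta> * (\<omega> * \<omega>)) =
      (\<eta> * \<eta> * \<eta>) * (\<omega> * \<omega> * \<omega>) * (\<omega> * \<omega> * \<omega>)"
    by (simp add: algebra_simps)
  then show "\<eta> * (\<omega> * \<omega>) * (\<eta> * (\<omega> * \<omega>)) * (\<eta> * (\<omega> * \<omega>)) = 1"
    by (simp add: omega3 eta3)
qed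

lemma cmod_omega: "cmod \<omega> = 1"
proof -
  have "cmod \<omega> ^ 3 = 1" using omega(1) by (metis norm_one norm_power)
  then show ?thesis using power_eq_imp_eq_base[of "cmod \<omega>" 3 1] by simp
qed

lemma cnj_omega: "cnj \<omega> = \<omega> * \<omega>"
proof -
  have "\<omega> * cnj \<omega> = 1" using cmod_omega by (simp add: complex_norm_square[symmetric])
  then have "\<omega> * \<omega> * (\<omega> * cnj \<omega>) = \<omega> * \<omega>" by simp
  then show ?thesis using omega3 by (simp add: mult.assoc[symmetric])
qed

lemma sigma_distinct:
  assumes "x \<in> V" shows "\<sigma> (\<sigma> x) \<noteq> x" "\<sigma> (\<sigma> x) \<noteq> \<sigma> x"
  using assms by (metis sigma3 sigma_free, metis sigma_free sigma_in)

lemma sigma_inj: "x \<in> V \<Longrightarrow> y \<in> V \<Longrightarrow> \<sigma> x = \<sigma> y \<longleftrightarrow> x = y"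
  using sigma3 by metis

lemma orb_V: "x \<in> V \<Longrightarrow> orb x \<subseteq> V"
  by (simp add: orb_def sigma_in)

lemma orb_sigma: "x \<in> V \<Longrightarrow> orb (\<sigma> x) = orb x"
  by (auto simp: orb_def sigma3)

lemma orb_eq: "x \<in> V \<Longrightarrow> y \<in> orb x \<Longrightarrow> orb y = orb x"
  using orb_sigma[of x] orb_sigma[of "\<sigma> x"] sigma_in[of x] by (metis empty_iff insert_iff orb_def)

lemma mem_orb: "x \<in> orb x" by (simp add: orb_def)

lemma mem_orb_sym: "x \<in> V \<Longrightarrow> y \<in> V \<Longrightarrow> y \<in> orb x \<longleftrightarrow> x \<in> orb y"
  using orb_eq mem_orb by blast

lemma sigma_mem_orb: "x \<in> V \<Longrightarrow> y \<in> V \<Longrightarrow> \<sigma> y \<in> orb x \<longleftrightarrow> y \<in> orb x"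
  using orb_sigma orb_eq mem_orb mem_orb_sym sigma_in by metis

lemma card_orb: "x \<in> V \<Longrightarrow> card (orb x) = 3"
  using sigma_free[of x] sigma_distinct[of x] by (simp add: orb_def)

text \<open>Every vertex is the image of its representative under a power of \<open>\<sigma>\<close>, and \<open>phase\<close> is the exponent.\<close>

definition rep :: "'v \<Rightarrow> 'v" where "rep x = (THE r. r \<in> R \<and> x \<in> orb r)"

definition phase :: "'v \<Rightarrow> nat" where
  "phase x = (if x = rep x then 0 else if x = \<sigma> (rep x) then 1 else 2)"

lemma rep: "x \<in> V \<Longrightarrow> rep x \<in> R" "x \<in> V \<Longrightarrow> x \<in> orb (rep x)"
  using theI'[OF reps[of x]] unfolding rep_def orb_def by auto

lemma rep_eqI: "x \<in> V \<Longrightarrow> r \<in> R \<Longrightarrow> x \<in> orb r \<Longrightarrow> rep x = r"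
  using reps[of x] rep[of x] unfolding orb_def by blast

lemma rep_V: "x \<in> V \<Longrightarrow> rep x \<in> V"
  using rep(1) RV by blast

lemma rep_sigma: "x \<in> V \<Longrightarrow> rep (\<sigma> x) = rep x"
  by (rule rep_eqI) (simp_all add: rep rep_V sigma_in sigma_mem_orb)

lemma rep_rep: "r \<in> R \<Longrightarrow> rep r = r"
  using RV by (intro rep_eqI) (auto simp: orb_def)

lemma phase_rep: "r \<in> R \<Longrightarrow> phase r = 0"
  by (simp add: phase_def rep_rep)

lemma rep_phase: "x \<in> V \<Longrightarrow> x = (\<sigma> ^^ phase x) (rep x)"
  using rep(2)[of x] by (auto simp: phase_def orb_def numeral_2_eq_2)

lemma power_phase_sigma:
  fixes z :: complex
  assumes "x \<in> V" "z * z * z = 1"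
  shows "z ^ phase (\<sigma> x) = z * z ^ phase x"
proof -
  let ?r = "rep x"
  have r: "?r \<in> V" using assms(1) by (rule rep_V)
  have "x = ?r \<or> x = \<sigma> ?r \<or> x = \<sigma> (\<sigma> ?r)" using rep(2)[OF assms(1)] by (simp add: orb_def)
  then show ?thesis
  proof (elim disjE)
    assume x: "x = ?r"
    then have "\<sigma> x = \<sigma> ?r" by simp
    then show ?thesis using x r sigma_free[OF r] by (simp add: phase_def rep_sigma[OF assms(1)])
  next
    assume x: "x = \<sigma> ?r"
    then have "\<sigma> x = \<sigma> (\<sigma> ?r)" by simp
    then show ?thesis using x r sigma_free[OF r] sigma_distinct[OF r]
      by (simp add: phase_def rep_sigma[OF assms(1)] power2_eq_square)
  next
    assume x: "x = \<sigma> (\<sigma> ?r)"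
    then have s: "\<sigma> x = ?r" using sigma3[OF r] by simp
    have "phase (\<sigma> x) = 0" unfolding phase_def rep_sigma[OF assms(1)] using s by simp
    moreover have "phase x = 2"
      using x sigma_distinct[OF r] unfolding phase_def by metis
    ultimately show ?thesis using assms(2) by (simp add: power2_eq_square mult.assoc)
  qed
qed

definition invariant :: "'v set \<Rightarrow> bool" where
  "invariant U \<longleftrightarrow> U \<subseteq> V \<and> (\<forall>x\<in>U. \<sigma> x \<in> U)"

lemma invariant_iff: "invariant U \<Longrightarrow> x \<in> V \<Longrightarrow> \<sigma> x \<in> U \<longleftrightarrow> x \<in> U"
  unfolding invariant_def using sigma3 by metis

lemma invariant_V: "invariant V" by (simp add: invariant_def sigma_in)

lemma invariant_orb: "invariant U \<Longrightarrow> x \<in> V \<Longrightarrow> y \<in> orb x \<Longrightarrow> y \<in> U \<longleftrightarrow> x \<in> U"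
  unfolding orb_def using invariant_iff sigma_in by auto

lemma card_invariant:
  assumes "invariant U" shows "card U = 3 * card (R \<inter> U)"
proof -
  have UV: "U \<subseteq> V" using assms by (simp add: invariant_def)
  have "U = (\<Union>r\<in>R \<inter> U. orb r)"
  proof
    show "U \<subseteq> (\<Union>r\<in>R \<inter> U. orb r)"
    proof
      fix x assume x: "x \<in> U"
      then have xV: "x \<in> V" using UV by blast
      have "rep x \<in> R \<inter> U"
        using rep[OF xV] invariant_orb[OF assms rep_V[OF xV] rep(2)[OF xV]] x by blast
      then show "x \<in> (\<Union>r\<in>R \<inter> U. orb r)" using rep(2)[OF xV] by blast
    qed
    show "(\<Union>r\<in>R \<inter> U. orb r) \<subseteq> U"
      using invariant_orb[OF assms] RV by blast
  qed
  also have "card \<dots> = (\<Sum>r\<in>R \<inter> U. card (orb r))"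
  proof (rule card_UN_disjoint)
    show "finite (R \<inter> U)" using UV finV finite_subset by blast
    show "\<forall>r\<in>R \<inter> U. finite (orb r)" by (simp add: orb_def)
    show "\<forall>r\<in>R \<inter> U. \<forall>s\<in>R \<inter> U. r \<noteq> s \<longrightarrow> orb r \<inter> orb s = {}"
    proof (intro ballI impI)
      fix r s assume r: "r \<in> R \<inter> U" and s: "s \<in> R \<inter> U" and ne: "r \<noteq> s"
      have "x \<notin> orb s" if "x \<in> orb r" for x
      proof
        assume "x \<in> orb s"
        moreover have "x \<in> V" using that orb_V r UV by blast
        ultimately show False using rep_eqI[of x r] rep_eqI[of x s] that r s ne by simp
      qed
      then show "orb r \<inter> orb s = {}" by blast
    qed
  qed
  also have "\<dots> = (\<Sum>r\<in>R \<inter> U. 3)"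
    by (rule sum.cong) (use UV in \<open>auto intro: card_orb\<close>)
  finally show ?thesis by simp
qed

text \<open>A real velocity field is encoded by its complex values and their conjugates; over the complex
  numbers the two halves become independent unknowns, indexed by \<open>Inl\<close> and \<open>Inr\<close>. The velocities of
  character \<open>\<eta>\<close> supported on \<open>U\<close> are determined by their values at the representatives.\<close>

definition velocities :: "'v set \<Rightarrow> ('v + 'v \<Rightarrow> complex) set" where
  "velocities U = {u. (\<forall>x\<in>V. u (Inl (\<sigma> x)) = \<eta> * \<omega> * u (Inl x) \<and>
                            u (Inr (\<sigma> x)) = \<eta> * (\<omega> * \<omega>) * u (Inr x)) \<and>
                      (\<forall>x. x \<notin> U \<longrightarrow> u (Inl x) = 0 \<and> u (Inr x) = 0)}"

lemma subspace_velocities: "subspace_of_functions (velocities U)"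
  by (simp add: subspace_of_functions_def velocities_def algebra_simps)

lemma velocitiesD:
  assumes "u \<in> velocities U" "x \<in> V"
  shows "u (Inl (\<sigma> x)) = \<eta> * \<omega> * u (Inl x)" "u (Inr (\<sigma> x)) = \<eta> * (\<omega> * \<omega>) * u (Inr x)"
  using assms by (simp_all add: velocities_def)

lemma velocities_mono: "U \<subseteq> U' \<Longrightarrow> velocities U \<subseteq> velocities U'"
  by (auto simp: velocities_def)

lemma velocities_restrict:
  assumes "u \<in> velocities V" "invariant U"
  shows "(\<lambda>k. if k \<in> Inl ` U \<union> Inr ` U then u k else 0) \<in> velocities U"
  using assms invariant_iff[OF assms(2)] unfolding velocities_def by auto

lemma coordinates_velocities:
  assumes "invariant U"
  shows "coordinates_of (velocities U) (Inl ` (R \<inter> U) \<union> Inr ` (R \<inter> U))"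
  unfolding coordinates_of_def
proof (intro conjI allI ballI impI)
  have UV: "U \<subseteq> V" using assms by (simp add: invariant_def)
  show "finite (Inl ` (R \<inter> U) \<union> Inr ` (R \<inter> U))"
    using UV finV finite_subset by blast
  fix c :: "'v + 'v \<Rightarrow> complex"
  define u where "u k = (case k of Inl x \<Rightarrow> if x \<in> U then (\<eta> * \<omega>) ^ phase x * c (Inl (rep x)) else 0
      | Inr x \<Rightarrow> if x \<in> U then (\<eta> * (\<omega> * \<omega>)) ^ phase x * c (Inr (rep x)) else 0)" for k
  have "u \<in> velocities U"
    unfolding velocities_def mem_Collect_eq
  proof (intro conjI ballI allI impI)
    fix x assume x: "x \<in> V"
    show "u (Inl (\<sigma> x)) = \<eta> * \<omega> * u (Inl x)"
      by (simp add: u_def invariant_iff[OF assms x] rep_sigma[OF x] power_phase_sigma[OF x character_cubes(1)])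
    show "u (Inr (\<sigma> x)) = \<eta> * (\<omega> * \<omega>) * u (Inr x)"
      by (simp add: u_def invariant_iff[OF assms x] rep_sigma[OF x] power_phase_sigma[OF x character_cubes(2)])
  qed (simp_all add: u_def)
  moreover have "\<forall>k\<in>Inl ` (R \<inter> U) \<union> Inr ` (R \<inter> U). u k = c k"
    by (auto simp: u_def rep_rep phase_rep)
  ultimately show "\<exists>u\<in>velocities U. \<forall>k\<in>Inl ` (R \<inter> U) \<union> Inr ` (R \<inter> U). u k = c k" by (rule_tac x = u in bexI)
next
  fix u assume u: "u \<in> velocities U" and z: "\<forall>k\<in>Inl ` (R \<inter> U) \<union> Inr ` (R \<inter> U). u k = 0"
  have "u (Inl x) = 0 \<and> u (Inr x) = 0" for x
  proof (cases "x \<in> U")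
    case True
    then have xV: "x \<in> V" using assms by (auto simp: invariant_def)
    have rU: "rep x \<in> U"
      using invariant_orb[OF assms rep_V[OF xV] rep(2)[OF xV]] True by blast
    have "u (Inl (rep x)) = 0" "u (Inr (rep x)) = 0"
      using z rU rep(1)[OF xV] by auto
    then have "\<forall>y\<in>orb (rep x). u (Inl y) = 0 \<and> u (Inr y) = 0"
      using velocitiesD[OF u] rep_V[OF xV] sigma_in by (simp add: orb_def)
    then show ?thesis using rep(2)[OF xV] by blast
  qed (use u in \<open>simp add: velocities_def\<close>)
  then show "u = (\<lambda>_. 0)" by (intro ext) (metis sumE)
qed

lemma card_coordinates:
  assumes "invariant U"
  shows "3 * card (Inl ` (R \<inter> U) \<union> Inr ` (R \<inter> U) :: ('v + 'v) set) = 2 * card U"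
proof -
  have fin: "finite (R \<inter> U)" using assms finV finite_subset unfolding invariant_def by blast
  have "card (Inl ` (R \<inter> U) \<union> Inr ` (R \<inter> U) :: ('v + 'v) set) =
      card (Inl ` (R \<inter> U) :: ('v + 'v) set) + card (Inr ` (R \<inter> U) :: ('v + 'v) set)"
    by (rule card_Un_disjoint) (use fin in auto)
  then show ?thesis using card_invariant[OF assms] by (simp add: card_image)
qed

text \<open>The velocity at one vertex of an orbit can be prescribed; the character then dictates the other two.\<close>

lemma change_velocity_at_orbit:
  assumes "u \<in> velocities V" "v \<in> V"
  shows "\<exists>w\<in>velocities V. w (Inl v) = \<alpha> \<and> w (Inr v) = \<beta> \<and>
    (\<forall>x. x \<notin> orb v \<longrightarrow> w (Inl x) = u (Inl x) \<and> w (Inr x) = u (Inr x))"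
proof -
  define w where "w k = (case k of
      Inl x \<Rightarrow> if x = v then \<alpha> else if x = \<sigma> v then \<eta> * \<omega> * \<alpha> else
        if x = \<sigma> (\<sigma> v) then \<eta> * \<omega> * (\<eta> * \<omega> * \<alpha>) else u (Inl x)
    | Inr x \<Rightarrow> if x = v then \<beta> else if x = \<sigma> v then \<eta> * (\<omega> * \<omega>) * \<beta> else
        if x = \<sigma> (\<sigma> v) then \<eta> * (\<omega> * \<omega>) * (\<eta> * (\<omega> * \<omega>) * \<beta>) else u (Inr x))" for k
  have off: "w (Inl x) = u (Inl x) \<and> w (Inr x) = u (Inr x)" if "x \<notin> orb v" for x
    using that by (auto simp: w_def orb_def)
  have onv: "w (Inl v) = \<alpha>" "w (Inr v) = \<beta>" by (simp_all add: w_def)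
  have cube: "\<eta> * \<omega> * (\<eta> * \<omega> * (\<eta> * \<omega> * z)) = z"
    "\<eta> * (\<omega> * \<omega>) * (\<eta> * (\<omega> * \<omega>) * (\<eta> * (\<omega> * \<omega>) * z)) = z" for z
    using arg_cong[OF character_cubes(1), of "\<lambda>c. c * z"] arg_cong[OF character_cubes(2), of "\<lambda>c. c * z"]
    by (simp_all only: mult.assoc mult_1_left)
  have "w \<in> velocities V"
    unfolding velocities_def mem_Collect_eq
  proof (rule conjI, rule ballI)
    fix x assume x: "x \<in> V"
    note d = sigma_free[OF assms(2)] sigma_distinct[OF assms(2)]
    show "w (Inl (\<sigma> x)) = \<eta> * \<omega> * w (Inl x) \<and> w (Inr (\<sigma> x)) = \<eta> * (\<omega> * \<omega>) * w (Inr x)"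
    proof (cases "x \<in> orb v")
      case True
      then consider "x = v" | "x = \<sigma> v" | "x = \<sigma> (\<sigma> v)" by (auto simp: orb_def)
      then show ?thesis
      proof cases
        case 1
        then show ?thesis using d by (simp add: w_def)
      next
        case 2
        then show ?thesis using d by (simp add: w_def)
      next
        case 3
        then show ?thesis using d sigma3[OF assms(2)] by (simp add: w_def cube)
      qed
    next
      case False
      then have "\<sigma> x \<notin> orb v" using sigma_mem_orb[OF assms(2) x] by blast
      then show ?thesis using off False velocitiesD[OF assms(1) x] by simp
    qed
  next
    show "\<forall>x. x \<notin> V \<longrightarrow> w (Inl x) = 0 \<and> w (Inr x) = 0"
    proof (intro allI impI)
      fix x assume "x \<notin> V"
      moreover from this have "x \<notin> orb v" using orb_V[OF assms(2)] by blast
      ultimately show "w (Inl x) = 0 \<and> w (Inr x) = 0" using off assms(1) by (simp add: velocities_def)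
    qed
  qed
  then show ?thesis using onv off by (intro bexI[of _ w]) simp_all
qed


text \<open>For positions \<open>a\<close> in the complex plane and a velocity whose \<open>Inr\<close> half is the conjugate of its \<open>Inl\<close>
  half, this is the rate of change of the squared length of the edge.\<close>

definition stretch :: "('v \<Rightarrow> complex) \<Rightarrow> 'v \<times> 'v \<Rightarrow> ('v + 'v \<Rightarrow> complex) \<Rightarrow> complex" where
  "stretch a e u =
     cnj (a (fst e) - a (snd e)) * (u (Inl (fst e)) - u (Inl (snd e))) +
     (a (fst e) - a (snd e)) * (u (Inr (fst e)) - u (Inr (snd e)))"

definition configuration :: "('v \<Rightarrow> complex) \<Rightarrow> bool" where
  "configuration a \<longleftrightarrow> (\<forall>x\<in>V. a (\<sigma> x) = \<omega> * a x)"

definition pairs :: "('v \<times> 'v) set" where "pairs = {(x, y). x \<in> V \<and> y \<in> V \<and> x \<noteq> y}"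

abbreviation "motions a \<equiv> solutions (velocities V) (stretch a)"

abbreviation "indep a \<equiv> independent_on (velocities V) (stretch a)"

text \<open>An edge is recorded as an ordered pair. Reversing it or applying \<open>\<sigma>\<close> changes its stretch
  on the velocities of one character by a nonzero factor only, so parallel pairs are the same element of
  the matroid.\<close>

definition translate :: "nat \<Rightarrow> 'v \<times> 'v \<Rightarrow> 'v \<times> 'v" where
  "translate k e = ((\<sigma> ^^ k) (fst e), (\<sigma> ^^ k) (snd e))"

definition parallel :: "'v \<times> 'v \<Rightarrow> 'v \<times> 'v \<Rightarrow> bool" where
  "parallel e e' \<longleftrightarrow> (\<exists>k. e' = translate k e \<or> e' = prod.swap (translate k e))"

text \<open>Complexified infinitesimal rigid motions: two translations and a rotation with angular velocity
  \<open>-\<i> c\<close>.\<close>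

definition rigid_motion_on :: "('v \<Rightarrow> complex) \<Rightarrow> 'v set \<Rightarrow> ('v + 'v \<Rightarrow> complex) \<Rightarrow> bool" where
  "rigid_motion_on a Z u \<longleftrightarrow>
     (\<exists>c s t. \<forall>x\<in>Z. u (Inl x) = c * a x + s \<and> u (Inr x) = - c * cnj (a x) + t)"

definition noncollinear :: "('v \<Rightarrow> complex) \<Rightarrow> 'v \<Rightarrow> 'v \<Rightarrow> 'v \<Rightarrow> bool" where
  "noncollinear a x y z \<longleftrightarrow> cnj (a z - a x) * (a z - a y) \<noteq> (a z - a x) * cnj (a z - a y)"

lemma linear_stretch: "linear_functional (stretch a e)"
  by (simp add: linear_functional_def stretch_def algebra_simps)

lemma stretch_pair: "stretch a (x, y) u =
    cnj (a x - a y) * (u (Inl x) - u (Inl y)) + (a x - a y) * (u (Inr x) - u (Inr y))"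
  by (simp add: stretch_def)

lemma stretch_swap: "stretch a (prod.swap e) u = stretch a e u"
  by (simp add: stretch_def algebra_simps)

lemma motions_iff: "u \<in> motions a F \<longleftrightarrow> u \<in> velocities V \<and> (\<forall>e\<in>F. stretch a e u = 0)"
  by (simp add: solutions_def)

lemma configurationD: "configuration a \<Longrightarrow> x \<in> V \<Longrightarrow> a (\<sigma> x) = \<omega> * a x"
  by (simp add: configuration_def)

lemma stretch_sigma:
  assumes a: "configuration a" and u: "u \<in> velocities V" and "x \<in> V" "y \<in> V"
  shows "stretch a (\<sigma> x, \<sigma> y) u = \<eta> * stretch a (x, y) u"
proof -
  note e = configurationD[OF a] velocitiesD[OF u]
  have "stretch a (\<sigma> x, \<sigma> y) u = (\<omega> * \<omega> * \<omega>) * \<eta> * (cnj (a x - a y) * (u (Inl x) - u (Inl y))) +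
      (\<omega> * \<omega> * \<omega>) * \<eta> * ((a x - a y) * (u (Inr x) - u (Inr y)))"
    using assms(3,4) by (simp add: stretch_pair e cnj_omega algebra_simps)
  then show ?thesis
    unfolding omega3 stretch_pair[of a x y u] by (simp only: mult_1_left distrib_left)
qed

lemma sigma_power_in: "x \<in> V \<Longrightarrow> (\<sigma> ^^ k) x \<in> V"
  by (induction k) (auto intro: sigma_in)

lemma sigma_power_inj: "x \<in> V \<Longrightarrow> y \<in> V \<Longrightarrow> (\<sigma> ^^ k) x = (\<sigma> ^^ k) y \<longleftrightarrow> x = y"
  by (induction k) (simp_all add: sigma_inj sigma_power_in)

lemma sigma_power_3: "x \<in> V \<Longrightarrow> (\<sigma> ^^ (3 * k)) x = x"
  by (induction k) (simp_all add: funpow_add sigma3 numeral_3_eq_3)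

lemma translate_in: "e \<in> V \<times> V \<Longrightarrow> translate k e \<in> V \<times> V"
  by (auto simp: translate_def sigma_power_in)

lemma pairs_sub: "e \<in> pairs \<Longrightarrow> e \<in> V \<times> V"
  by (auto simp: pairs_def)

lemma translate_pairs: "e \<in> pairs \<Longrightarrow> translate k e \<in> pairs"
  by (auto simp: translate_def pairs_def sigma_power_in sigma_power_inj)

lemma translate_add: "translate k (translate l e) = translate (k + l) e"
  by (simp add: translate_def funpow_add)

lemma translate_swap: "translate k (prod.swap e) = prod.swap (translate k e)"
  by (simp add: translate_def)

lemma translate_3: "e \<in> V \<times> V \<Longrightarrow> translate (3 * k) e = e"
  by (auto simp: translate_def sigma_power_3)

lemma translate_0: "translate 0 e = e"
  by (simp add: translate_def)

lemma stretch_translate: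
  assumes "configuration a" "u \<in> velocities V" "e \<in> V \<times> V"
  shows "stretch a (translate k e) u = \<eta> ^ k * stretch a e u"
proof (induction k)
  case (Suc k)
  have "translate (Suc k) e = (\<sigma> (fst (translate k e)), \<sigma> (snd (translate k e)))"
    by (simp add: translate_def)
  then have "stretch a (translate (Suc k) e) u = \<eta> * stretch a (translate k e) u"
    using stretch_sigma[OF assms(1,2), of "fst (translate k e)" "snd (translate k e)"]
      translate_in[OF assms(3), of k] by (simp add: mem_Times_iff)
  then show ?case using Suc by simp
qed (simp add: translate_0)

lemma eta_nonzero: "\<eta> \<noteq> 0"
  using eta by auto

lemma stretch_parallel:
  assumes "configuration a" "parallel e e'" "e \<in> V \<times> V"
  shows "\<exists>c. c \<noteq> 0 \<and> (\<forall>u\<in>velocities V. stretch a e' u = c * stretch a e u)"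
proof -
  obtain k where "e' = translate k e \<or> e' = prod.swap (translate k e)"
    using assms(2) by (auto simp: parallel_def)
  then have "\<forall>u\<in>velocities V. stretch a e' u = \<eta> ^ k * stretch a e u"
    using stretch_translate[OF assms(1) _ assms(3)] stretch_swap by metis
  then show ?thesis using eta_nonzero by (intro exI[of _ "\<eta> ^ k"]) simp
qed

lemma parallel_refl: "parallel e e"
  unfolding parallel_def by (rule exI[of _ 0]) (simp add: translate_0)

lemma parallel_trans: "parallel e f \<Longrightarrow> parallel f g \<Longrightarrow> parallel e g"
  unfolding parallel_def by (metis swap_swap translate_add translate_swap)

lemma parallel_sym:
  assumes "parallel e f" "e \<in> V \<times> V" shows "parallel f e"
proof -
  obtain k where k: "f = translate k e \<or> f = prod.swap (translate k e)"
    using assms(1) by (auto simp: parallel_def)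
  have "translate (2 * k) (translate k e) = e"
    using translate_3[OF assms(2), of k] by (simp add: translate_add)
  then show ?thesis using k unfolding parallel_def
    by (metis swap_swap translate_swap)
qed

section \<open>Gluing rigid pieces\<close>

lemma rigid_motion_stretch:
  assumes "rigid_motion_on a Z u" "x \<in> Z" "y \<in> Z" shows "stretch a (x, y) u = 0"
proof -
  obtain c s t where r: "\<forall>x\<in>Z. u (Inl x) = c * a x + s \<and> u (Inr x) = - c * cnj (a x) + t"
    using assms(1) unfolding rigid_motion_on_def by blast
  show ?thesis
    by (simp add: stretch_pair bspec[OF r assms(2)] bspec[OF r assms(3)] algebra_simps)
qed

lemma rigid_motion_subset: "rigid_motion_on a Z u \<Longrightarrow> Z' \<subseteq> Z \<Longrightarrow> rigid_motion_on a Z' u"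
  unfolding rigid_motion_on_def by (meson subsetD)

lemma rigid_motion_pair:
  assumes "stretch a (x, y) u = 0" "a x \<noteq> a y" shows "rigid_motion_on a {x, y} u"
proof -
  define c where "c = (u (Inl x) - u (Inl y)) / (a x - a y)"
  have c: "c * (a x - a y) = u (Inl x) - u (Inl y)" using assms(2) by (simp add: c_def)
  have "(a x - a y) * (cnj (a x - a y) * c + (u (Inr x) - u (Inr y))) = 0"
    using assms(1) unfolding stretch_pair c[symmetric] by (simp add: algebra_simps)
  then have "cnj (a x - a y) * c + (u (Inr x) - u (Inr y)) = 0" using assms(2) by simp
  then have w: "u (Inr x) - u (Inr y) = - (cnj (a x - a y) * c)" by (rule eq_neg_iff_add_eq_0[THEN iffD2, OF trans[OF add.commute]])
  show ?thesis
    unfolding rigid_motion_on_def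
    by (rule exI[of _ c], rule exI[of _ "u (Inl x) - c * a x"], rule exI[of _ "u (Inr x) + c * cnj (a x)"])
      (use c w in \<open>simp add: algebra_simps\<close>)
qed

lemma rigid_motion_glue:
  assumes "rigid_motion_on a Z u" "rigid_motion_on a Z' u"
    and "{x, y} \<subseteq> Z \<inter> Z'" "a x \<noteq> a y"
  shows "rigid_motion_on a (Z \<union> Z') u"
proof -
  obtain c s t where 1: "\<forall>x\<in>Z. u (Inl x) = c * a x + s \<and> u (Inr x) = - c * cnj (a x) + t"
    using assms(1) unfolding rigid_motion_on_def by blast
  obtain c' s' t' where 2: "\<forall>x\<in>Z'. u (Inl x) = c' * a x + s' \<and> u (Inr x) = - c' * cnj (a x) + t'"
    using assms(2) unfolding rigid_motion_on_def by blast
  have x: "c * a x + s = c' * a x + s'" "- c * cnj (a x) + t = - c' * cnj (a x) + t'"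
    and y: "c * a y + s = c' * a y + s'"
    using 1 2 assms(3) by (metis Int_iff insert_subset)+
  have "(c - c') * (a x - a y) = (c * a x + s) - (c * a y + s) - ((c' * a x + s') - (c' * a y + s'))"
    by (simp add: algebra_simps)
  then have "(c - c') * (a x - a y) = 0" unfolding x(1) y by simp
  then have "c = c'" using assms(4) by simp
  moreover from this have "s = s'" "t = t'" using x by simp_all
  ultimately show ?thesis using 1 2 unfolding rigid_motion_on_def by blast
qed

lemma noncollinear_distinct:
  "noncollinear a x y z \<Longrightarrow> a x \<noteq> a y" "noncollinear a x y z \<Longrightarrow> a x \<noteq> a z" "noncollinear a x y z \<Longrightarrow> a y \<noteq> a z"
  by (auto simp: noncollinear_def)

text \<open>After subtracting the rigid motion determined by \<open>x\<close> and \<open>y\<close>, the velocity at \<open>z\<close> solves two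
  homogeneous equations whose determinant measures collinearity.\<close>

lemma rigid_motion_triangle:
  assumes nc: "noncollinear a x y z"
    and 0: "stretch a (x, y) u = 0" "stretch a (x, z) u = 0" "stretch a (y, z) u = 0"
  shows "rigid_motion_on a {x, y, z} u"
proof -
  obtain c s t where r: "\<forall>v\<in>{x, y}. u (Inl v) = c * a v + s \<and> u (Inr v) = - c * cnj (a v) + t"
    using rigid_motion_pair[OF 0(1) noncollinear_distinct(1)[OF nc]] unfolding rigid_motion_on_def by blast
  define \<alpha> where "\<alpha> = u (Inl z) - (c * a z + s)"
  define \<beta> where "\<beta> = u (Inr z) - (- c * cnj (a z) + t)"
  define p where "p = a z - a x"
  define q where "q = a z - a y"
  have u: "u (Inl x) = c * a x + s" "u (Inr x) = - c * cnj (a x) + t" "u (Inl y) = c * a y + s"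
    "u (Inr y) = - c * cnj (a y) + t" "u (Inl z) = \<alpha> + (c * a z + s)" "u (Inr z) = \<beta> + (- c * cnj (a z) + t)"
    using r by (simp_all add: \<alpha>_def \<beta>_def)
  have p: "cnj p * \<alpha> + p * \<beta> = 0"
    using 0(2) unfolding stretch_pair u p_def by (simp add: algebra_simps)
  have q: "cnj q * \<alpha> + q * \<beta> = 0"
    using 0(3) unfolding stretch_pair u q_def by (simp add: algebra_simps)
  have det: "cnj p * q - p * cnj q \<noteq> 0" using nc by (simp add: noncollinear_def p_def q_def)
  have "(cnj p * q - p * cnj q) * \<alpha> = q * (cnj p * \<alpha> + p * \<beta>) - p * (cnj q * \<alpha> + q * \<beta>)"
    "(cnj p * q - p * cnj q) * \<beta> = cnj p * (cnj q * \<alpha> + q * \<beta>) - cnj q * (cnj p * \<alpha> + p * \<beta>)"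
    by (simp_all add: algebra_simps)
  then have "\<alpha> = 0" "\<beta> = 0" unfolding p q using det by simp_all
  then show ?thesis
    unfolding rigid_motion_on_def
    by (intro exI[of _ c] exI[of _ s] exI[of _ t]) (simp add: u)
qed

lemma rigid_motion_translate:
  assumes a: "configuration a" and u: "u \<in> velocities V" and Z: "Z \<subseteq> V" and r: "rigid_motion_on a Z u"
  shows "rigid_motion_on a ((\<sigma> ^^ k) ` Z) u"
proof (induction k)
  case (Suc k)
  obtain c s t where
    r: "\<forall>x\<in>(\<sigma> ^^ k) ` Z. u (Inl x) = c * a x + s \<and> u (Inr x) = - c * cnj (a x) + t"
    using Suc unfolding rigid_motion_on_def by blast
  have "u (Inl (\<sigma> x)) = (\<eta> * c) * a (\<sigma> x) + \<eta> * \<omega> * s \<and>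
      u (Inr (\<sigma> x)) = - (\<eta> * c) * cnj (a (\<sigma> x)) + \<eta> * (\<omega> * \<omega>) * t" if "x \<in> (\<sigma> ^^ k) ` Z" for x
  proof -
    have "x \<in> V" using that Z sigma_power_in by blast
    then show ?thesis
      by (simp add: configurationD[OF a] velocitiesD[OF u] bspec[OF r that] cnj_omega algebra_simps)
  qed
  then have "\<forall>x\<in>(\<sigma> ^^ Suc k) ` Z. u (Inl x) = (\<eta> * c) * a x + \<eta> * \<omega> * s \<and>
      u (Inr x) = - (\<eta> * c) * cnj (a x) + \<eta> * (\<omega> * \<omega>) * t"
    by auto
  then show ?case unfolding rigid_motion_on_def by blast
qed (use r in simp)

section \<open>Adding a vertex orbit\<close>

text \<open>The numbers \<open>\<alpha>\<close> and \<open>\<beta>\<close> are the entries of the row of \<open>e\<close> in the two columns of \<open>v\<close>. They are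
  expressed by differences so that an edge to a further vertex and a loop, an edge between two vertices of
  the orbit, can be treated alike.\<close>

definition row_form :: "('v \<Rightarrow> complex) \<Rightarrow> 'v \<Rightarrow> 'v \<times> 'v \<Rightarrow> complex \<Rightarrow> complex \<Rightarrow> bool" where
  "row_form a v e \<alpha> \<beta> \<longleftrightarrow> (\<forall>u\<in>velocities V. \<forall>w\<in>velocities V.
     (\<forall>x. x \<notin> orb v \<longrightarrow> w (Inl x) = u (Inl x) \<and> w (Inr x) = u (Inr x)) \<longrightarrow>
     stretch a e w - stretch a e u = \<alpha> * (w (Inl v) - u (Inl v)) + \<beta> * (w (Inr v) - u (Inr v)))"

definition avoids :: "'v \<Rightarrow> ('v \<times> 'v) set \<Rightarrow> bool" where
  "avoids v F \<longleftrightarrow> (\<forall>e\<in>F. fst e \<notin> orb v \<and> snd e \<notin> orb v)"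

lemma row_form_scale:
  assumes "row_form a v e \<alpha> \<beta>" "\<forall>u\<in>velocities V. stretch a e' u = c * stretch a e u"
  shows "row_form a v e' (c * \<alpha>) (c * \<beta>)"
  unfolding row_form_def
proof (intro ballI impI)
  fix u w assume u: "u \<in> velocities V" and w: "w \<in> velocities V"
    and uw: "\<forall>x. x \<notin> orb v \<longrightarrow> w (Inl x) = u (Inl x) \<and> w (Inr x) = u (Inr x)"
  have 1: "stretch a e w - stretch a e u = \<alpha> * (w (Inl v) - u (Inl v)) + \<beta> * (w (Inr v) - u (Inr v))"
    using assms(1) u w uw unfolding row_form_def by blast
  have 2: "stretch a e' w - stretch a e' u = c * (stretch a e w - stretch a e u)"
    using assms(2) u w by (simp add: algebra_simps)
  show "stretch a e' w - stretch a e' u =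
      c * \<alpha> * (w (Inl v) - u (Inl v)) + c * \<beta> * (w (Inr v) - u (Inr v))"
    unfolding 2 1 by (simp only: distrib_left mult.assoc)
qed

lemma row_form_edge:
  assumes "x \<notin> orb v" shows "row_form a v (v, x) (cnj (a v - a x)) (a v - a x)"
  unfolding row_form_def using assms by (simp add: stretch_pair algebra_simps)

lemma row_form_loop:
  assumes a: "configuration a" and v: "v \<in> V"
  shows "row_form a v (v, \<sigma> v) ((1 - \<omega> * \<omega>) * (1 - \<eta> * \<omega>) * cnj (a v))
    ((1 - \<omega>) * (1 - \<eta> * (\<omega> * \<omega>)) * a v)"
proof -
  have L: "stretch a (v, \<sigma> v) u = (1 - \<omega> * \<omega>) * (1 - \<eta> * \<omega>) * cnj (a v) * u (Inl v) +
      (1 - \<omega>) * (1 - \<eta> * (\<omega> * \<omega>)) * a v * u (Inr v)" if "u \<in> velocities V" for u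
    using v by (simp add: stretch_pair configurationD[OF a] velocitiesD[OF that] cnj_omega algebra_simps)
  show ?thesis
    unfolding row_form_def
  proof (intro ballI impI)
    fix u w assume u: "u \<in> velocities V" and w: "w \<in> velocities V"
    show "stretch a (v, \<sigma> v) w - stretch a (v, \<sigma> v) u =
        (1 - \<omega> * \<omega>) * (1 - \<eta> * \<omega>) * cnj (a v) * (w (Inl v) - u (Inl v)) +
        (1 - \<omega>) * (1 - \<eta> * (\<omega> * \<omega>)) * a v * (w (Inr v) - u (Inr v))"
      unfolding L[OF u] L[OF w] by (simp only: right_diff_distrib) simp
  qed
qed

lemma zero_velocities: "(\<lambda>_. 0) \<in> velocities U"
  by (simp add: velocities_def)

lemma stretch_avoids:
  assumes "avoids v F" "e \<in> F"
    "\<forall>x. x \<notin> orb v \<longrightarrow> w (Inl x) = u (Inl x) \<and> w (Inr x) = u (Inr x)"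
  shows "stretch a e w = stretch a e u"
  using assms by (simp add: avoids_def stretch_def)

lemma motion_at_orbit:
  assumes v: "v \<in> V" and F: "avoids v F" and u: "u \<in> motions a F"
  obtains w where "w \<in> motions a F" "w (Inl v) = u (Inl v) + \<alpha>" "w (Inr v) = u (Inr v) + \<beta>"
    "\<And>x. x \<notin> orb v \<Longrightarrow> w (Inl x) = u (Inl x) \<and> w (Inr x) = u (Inr x)"
    "\<And>e c d. row_form a v e c d \<Longrightarrow> stretch a e w = stretch a e u + (c * \<alpha> + d * \<beta>)"
proof -
  have uV: "u \<in> velocities V" using u by (simp add: motions_iff)
  obtain w where w: "w \<in> velocities V" "w (Inl v) = u (Inl v) + \<alpha>" "w (Inr v) = u (Inr v) + \<beta>"
    and off: "\<forall>x. x \<notin> orb v \<longrightarrow> w (Inl x) = u (Inl x) \<and> w (Inr x) = u (Inr x)"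
    using change_velocity_at_orbit[OF uV v] by blast
  have "w \<in> motions a F"
    using u w(1) stretch_avoids[OF F _ off] by (simp add: motions_iff)
  moreover have "stretch a e w = stretch a e u + (c * \<alpha> + d * \<beta>)" if "row_form a v e c d" for e c d
  proof -
    have "stretch a e w - stretch a e u = c * (w (Inl v) - u (Inl v)) + d * (w (Inr v) - u (Inr v))"
      using that uV w(1) off unfolding row_form_def by blast
    then show ?thesis using w(2,3) by (simp add: algebra_simps)
  qed
  ultimately show ?thesis using that w off by metis
qed

lemma stretch_0: "stretch a e (\<lambda>_. 0) = 0"
  by (simp add: stretch_def)

lemma zero_motion: "(\<lambda>_. 0) \<in> motions a F"
  by (simp add: motions_iff zero_velocities stretch_0)

lemmas indep_insert = independent_on_insert[OF subspace_velocities linear_stretch]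

lemma extend_by_one_edge:
  assumes v: "v \<in> V" and F: "avoids v F" "indep a F" and e: "row_form a v e \<alpha> \<beta>" "\<alpha> \<noteq> 0 \<or> \<beta> \<noteq> 0"
  shows "indep a (insert e F)"
proof -
  define x y where "x = (if \<alpha> \<noteq> 0 then 1 else 0 :: complex)" and "y = (if \<alpha> \<noteq> 0 then 0 else 1 :: complex)"
  obtain w where w: "w \<in> motions a F" "\<And>e c d. row_form a v e c d \<Longrightarrow> stretch a e w = stretch a e (\<lambda>_. 0) + (c * x + d * y)"
    using motion_at_orbit[OF v F(1) zero_motion, of a x y] by metis
  have "stretch a e w \<noteq> 0" using w(2)[OF e(1)] e(2) by (auto simp: stretch_0 x_def y_def)
  then show ?thesis using indep_insert[OF F(2) w(1)] by blast
qed

lemma extend_by_two_edges: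
  assumes v: "v \<in> V" and F: "avoids v F" "indep a F"
    and e: "row_form a v e \<alpha> \<beta>" "row_form a v e' \<alpha>' \<beta>'" "\<alpha> * \<beta>' \<noteq> \<alpha>' * \<beta>"
  shows "indep a (insert e' (insert e F))"
proof -
  have "indep a (insert e F)"
    by (rule extend_by_one_edge[OF v F e(1)]) (use e(3) in auto)
  moreover obtain w where w: "w \<in> motions a F"
    "\<And>e c d. row_form a v e c d \<Longrightarrow> stretch a e w = stretch a e (\<lambda>_. 0) + (c * (- \<beta>) + d * \<alpha>)"
    using motion_at_orbit[OF v F(1) zero_motion, of a "- \<beta>" \<alpha>] by metis
  have "stretch a e w = 0" using w(2)[OF e(1)] by (simp add: stretch_0)
  then have "w \<in> motions a (insert e F)" using w(1) by (simp add: motions_iff)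
  moreover have "stretch a e' w \<noteq> 0" using w(2)[OF e(2)] e(3) by (auto simp: stretch_0 algebra_simps)
  ultimately show ?thesis by (rule indep_insert)
qed

text \<open>With \<open>v\<close> halfway between \<open>x\<close> and \<open>y\<close>, the rows of \<open>vx\<close> and \<open>vy\<close> add up to a multiple of the row
  of \<open>xy\<close>. Hence a motion that stretches \<open>xy\<close> cannot preserve both.\<close>

lemma extend_by_three_edges:
  assumes a: "configuration a" and v: "v \<in> V" and F: "avoids v F" "indep a F"
    and xy: "x \<notin> orb v" "y \<notin> orb v" "a x \<noteq> a y" and mid: "a v = (a x + a y) / 2"
    and u: "u \<in> motions a F" "stretch a (x, y) u \<noteq> 0"
    and e: "\<forall>u\<in>velocities V. stretch a e u = c * stretch a (v, x) u" "c \<noteq> 0"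
    and e': "\<forall>u\<in>velocities V. stretch a e' u = c' * stretch a (v, y) u" "c' \<noteq> 0"
    and f: "row_form a v f \<alpha> \<beta>" "cnj (a y - a x) * \<beta> \<noteq> \<alpha> * (a y - a x)"
  shows "indep a (insert e' (insert e (insert f F)))"
proof -
  define \<delta> where "\<delta> = a y - a x"
  have d: "a v - a x = \<delta> / 2" "a v - a y = - (\<delta> / 2)" by (simp_all add: mid \<delta>_def field_simps)
  have re: "row_form a v e (c * cnj (\<delta> / 2)) (c * (\<delta> / 2))"
    using row_form_scale[OF row_form_edge[OF xy(1)] e(1)] unfolding d .
  have det: "\<alpha> * (c * (\<delta> / 2)) - c * cnj (\<delta> / 2) * \<beta> \<noteq> 0" (is "?D \<noteq> 0")
  proof -
    have "\<alpha> * (c * (\<delta> / 2)) - c * cnj (\<delta> / 2) * \<beta> = - (c / 2) * (cnj \<delta> * \<beta> - \<alpha> * \<delta>)"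
      by (simp add: algebra_simps)
    then show ?thesis using f(2) e(2) by (simp add: \<delta>_def)
  qed
  have 2: "indep a (insert e (insert f F))"
    by (rule extend_by_two_edges[OF v F f(1) re]) (use det in \<open>simp add: algebra_simps\<close>)
  define p where "p = stretch a f u"
  define q where "q = stretch a e u"
  obtain w where w: "w \<in> motions a F"
    "\<And>x. x \<notin> orb v \<Longrightarrow> w (Inl x) = u (Inl x) \<and> w (Inr x) = u (Inr x)"
    "\<And>e' c' d. row_form a v e' c' d \<Longrightarrow> stretch a e' w = stretch a e' u +
      (c' * ((- p * (c * (\<delta> / 2)) + q * \<beta>) / ?D) + d * ((- q * \<alpha> + p * (c * cnj (\<delta> / 2))) / ?D))"
    using motion_at_orbit[OF v F(1) u(1), of "(- p * (c * (\<delta> / 2)) + q * \<beta>) / ?D" "(- q * \<alpha> + p * (c * cnj (\<delta> / 2))) / ?D"] by metis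
  have "stretch a f w = p + (- p * ?D) / ?D"
    unfolding w(3)[OF f(1)] p_def[symmetric] times_divide_eq_right add_divide_distrib[symmetric]
    by (simp add: algebra_simps)
  then have fw: "stretch a f w = 0" using det by simp
  have "stretch a e w = q + (- q * ?D) / ?D"
    unfolding w(3)[OF re] q_def[symmetric] times_divide_eq_right add_divide_distrib[symmetric]
    by (simp add: algebra_simps)
  then have ew: "stretch a e w = 0" using det by simp
  have wV: "w \<in> velocities V" using w(1) by (simp add: motions_iff)
  have "stretch a (v, x) w + stretch a (v, y) w = stretch a (x, y) w / 2"
  proof -
    have d': "a x - a y = - \<delta>" by (simp add: \<delta>_def)
    show ?thesis unfolding stretch_pair d d' by (simp add: field_simps)
  qed
  moreover have "stretch a (v, x) w = 0" using e ew wV by simp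
  moreover have "stretch a (x, y) w = stretch a (x, y) u"
    using w(2)[OF xy(1)] w(2)[OF xy(2)] by (simp add: stretch_pair)
  ultimately have "stretch a e' w \<noteq> 0" using e' wV u(2) by auto
  moreover have "w \<in> motions a (insert e (insert f F))"
    using w(1) fw ew by (simp add: motions_iff)
  ultimately show ?thesis using indep_insert[OF 2] by blast
qed


section \<open>Dimension count\<close>

text \<open>The velocities of one character supported on \<open>U\<close> have two coordinates for each vertex orbit.\<close>

lemma independent_card_le:
  fixes f :: "'i \<Rightarrow> ('v + 'v \<Rightarrow> complex) \<Rightarrow> complex"
  assumes U: "invariant U" and lin: "\<And>i. linear_functional (f i)"
    and loc: "\<And>i u w. i \<in> I \<Longrightarrow> (\<forall>x\<in>U. u (Inl x) = w (Inl x) \<and> u (Inr x) = w (Inr x)) \<Longrightarrow> f i u = f i w"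
    and I: "finite I" "independent_on (velocities V) f I"
  shows "3 * card I \<le> 2 * card U"
proof -
  have "independent_on (velocities U) f I"
    unfolding independent_on_def
  proof
    fix i assume i: "i \<in> I"
    then obtain u where u: "u \<in> solutions (velocities V) f (I - {i})" "f i u \<noteq> 0"
      using I(2) unfolding independent_on_def by blast
    define w where "w = (\<lambda>k. if k \<in> Inl ` U \<union> Inr ` U then u k else 0)"
    have "w \<in> velocities U"
      using velocities_restrict[OF _ U] u(1) by (simp add: w_def solutions_def)
    moreover have fw: "f j w = f j u" if "j \<in> I" for j
      by (rule loc[OF that]) (simp add: w_def)
    ultimately have "w \<in> solutions (velocities U) f (I - {i})"
      using u(1) by (simp add: solutions_def)
    moreover have "f i w \<noteq> 0" using fw[OF i] u(2) by simp
    ultimately show "\<exists>u\<in>solutions (velocities U) f (I - {i}). f i u \<noteq> 0" by (rule_tac bexI)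
  qed
  from independent_on_card_le[OF subspace_velocities coordinates_velocities[OF U] lin I(1) this]
  show ?thesis using card_coordinates[OF U] by linarith
qed

text \<open>Stretches and coordinates in one family, for adding normalizing equations to a framework.\<close>

definition tagged :: "('v \<Rightarrow> complex) \<Rightarrow> ('v \<times> 'v) + ('v + 'v) \<Rightarrow> ('v + 'v \<Rightarrow> complex) \<Rightarrow> complex" where
  "tagged a = case_sum (stretch a) (\<lambda>k u. u k)"

lemma linear_tagged: "linear_functional (tagged a i)"
  by (cases i) (simp_all add: tagged_def linear_stretch, simp add: linear_functional_def)

lemma solutions_tagged: "solutions (velocities V) (tagged a) (Inl ` F) = motions a F"
  by (simp add: solutions_def tagged_def)

lemma independent_tagged:
  assumes "indep a F" shows "independent_on (velocities V) (tagged a) (Inl ` F)"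
  unfolding independent_on_def
proof
  fix i :: "('v \<times> 'v) + ('v + 'v)"
  assume "i \<in> Inl ` F"
  then obtain e where e: "i = Inl e" "e \<in> F" by blast
  have "Inl ` F - {i} = Inl ` (F - {e})" using e by auto
  moreover obtain u where "u \<in> motions a (F - {e})" "stretch a e u \<noteq> 0"
    using assms e(2) unfolding independent_on_def by blast
  ultimately show "\<exists>u\<in>solutions (velocities V) (tagged a) (Inl ` F - {i}). tagged a i u \<noteq> 0"
    by (rule_tac x = u in bexI) (simp_all add: solutions_tagged, simp add: e tagged_def)
qed

text \<open>For each character the rigid velocities form a line; this coordinate does not vanish on it.\<close>

definition marked :: "'v \<Rightarrow> 'v + 'v" where
  "marked x = (if \<eta> = \<omega> then Inr x else Inl x)"

lemma eta_cases: "\<eta> = 1 \<or> \<eta> = \<omega> \<or> \<eta> = \<omega> * \<omega>"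
proof -
  have s: "1 + \<omega> + \<omega> * \<omega> = 0"
  proof -
    have "(\<omega> - 1) * (1 + \<omega> + \<omega> * \<omega>) = \<omega> * \<omega> * \<omega> - 1" by (simp add: algebra_simps)
    then show ?thesis using omega3 omega(2) by simp
  qed
  have "(\<eta> - 1) * ((\<eta> - \<omega>) * (\<eta> - \<omega> * \<omega>)) =
    \<eta> * \<eta> * \<eta> - (1 + \<omega> + \<omega> * \<omega>) * \<eta> * \<eta> + (\<omega> + \<omega> * \<omega> + \<omega> * \<omega> * \<omega>) * \<eta> - \<omega> * \<omega> * \<omega>"
    by (simp add: algebra_simps)
  also have "\<omega> + \<omega> * \<omega> + \<omega> * \<omega> * \<omega> = 0" using s omega3 by (simp add: algebra_simps)
  finally have "(\<eta> - 1) * ((\<eta> - \<omega>) * (\<eta> - \<omega> * \<omega>)) = 0" using s omega3 eta3 by simp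
  then show ?thesis by simp
qed

lemma rigid_velocity:
  assumes a: "configuration a" and nz: "\<And>x. x \<in> V \<Longrightarrow> a x \<noteq> 0"
  shows "\<exists>u\<in>velocities V. rigid_motion_on a V u \<and> (\<forall>x\<in>V. u (marked x) \<noteq> 0)"
proof -
  define u :: "complex \<Rightarrow> complex \<Rightarrow> complex \<Rightarrow> 'v + 'v \<Rightarrow> complex" where
    "u c s t k = (case k of Inl x \<Rightarrow> if x \<in> V then c * a x + s else 0
       | Inr x \<Rightarrow> if x \<in> V then - c * cnj (a x) + t else 0)" for c s t k
  have rigid: "rigid_motion_on a V (u c s t)" for c s t
    unfolding rigid_motion_on_def by (intro exI[of _ c] exI[of _ s] exI[of _ t]) (simp add: u_def)
  consider "\<eta> = 1" | "\<eta> = \<omega>" "\<eta> \<noteq> 1" | "\<eta> = \<omega> * \<omega>" "\<eta> \<noteq> \<omega>" using eta_cases by blast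
  then show ?thesis
  proof cases
    case 1
    have m: "\<eta> * z = z" for z using 1 by simp
    have "u 1 0 0 \<in> velocities V"
      by (simp add: velocities_def u_def sigma_in configurationD[OF a] cnj_omega m)
    moreover have "marked x = Inl x" for x unfolding marked_def using 1 omega(2) by simp
    then have "\<forall>x\<in>V. u 1 0 0 (marked x) \<noteq> 0" using nz by (simp add: u_def)
    ultimately show ?thesis using rigid by blast
  next
    case 2
    have m: "\<eta> * (\<omega> * \<omega>) = 1" using 2 omega3 by (simp add: mult.assoc)
    have "u 0 0 1 \<in> velocities V"
      by (simp add: velocities_def u_def sigma_in m)
    moreover have "marked x = Inr x" for x unfolding marked_def using 2 by simp
    then have "\<forall>x\<in>V. u 0 0 1 (marked x) \<noteq> 0" by (simp add: u_def)
    ultimately show ?thesis using rigid by blast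
  next
    case 3
    have m: "\<eta> * \<omega> = 1" using 3 omega3 by simp
    have "u 0 1 0 \<in> velocities V"
      by (simp add: velocities_def u_def sigma_in m)
    moreover have "marked x = Inl x" for x unfolding marked_def using 3 by simp
    then have "\<forall>x\<in>V. u 0 1 0 (marked x) \<noteq> 0" by (simp add: u_def)
    ultimately show ?thesis using rigid by blast
  qed
qed

text \<open>Comparing the velocities at \<open>x\<close> and \<open>\<sigma> x\<close> leaves one free parameter for each character: the angular
  velocity for the trivial one and one of the two complex translations for the others.\<close>

lemma rigid_velocity_zero:
  assumes a: "configuration a" and u: "u \<in> velocities V" and r: "rigid_motion_on a Z u"
    and x: "x \<in> V" "x \<in> Z" "\<sigma> x \<in> Z" and nz: "a x \<noteq> 0" and 0: "u (marked x) = 0" and y: "y \<in> Z"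
  shows "u (Inl y) = 0 \<and> u (Inr y) = 0"
proof -
  obtain c s t where r: "\<forall>x\<in>Z. u (Inl x) = c * a x + s \<and> u (Inr x) = - c * cnj (a x) + t"
    using assms(3) unfolding rigid_motion_on_def by blast
  have l: "c * (\<omega> * a x) + s = \<eta> * \<omega> * (c * a x + s)"
    and w: "- c * (\<omega> * \<omega> * cnj (a x)) + t = \<eta> * (\<omega> * \<omega>) * (- c * cnj (a x) + t)"
    using bspec[OF r x(2)] bspec[OF r x(3)] velocitiesD[OF u x(1)] configurationD[OF a x(1)]
    by (simp_all add: cnj_omega)
  have w2: "\<omega> * \<omega> \<noteq> 1" using omega3 omega(2) by force
  have "c = 0 \<and> s = 0 \<and> t = 0"
  proof -
    consider "\<eta> = 1" | "\<eta> = \<omega>" "\<eta> \<noteq> 1" | "\<eta> = \<omega> * \<omega>" "\<eta> \<noteq> \<omega>" "\<eta> \<noteq> 1" using eta_cases by blast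
    then show ?thesis
    proof cases
      case 1
      have "(\<omega> - 1) * s = 0" using l 1 by (simp add: algebra_simps)
      moreover have "(\<omega> * \<omega> - 1) * t = 0" using w 1 by (simp add: algebra_simps)
      ultimately have st: "s = 0" "t = 0" using omega(2) w2 by simp_all
      have "marked x = Inl x" unfolding marked_def using 1 omega(2) by simp
      then have "c * a x = 0" using 0 bspec[OF r x(2)] st by simp
      then show ?thesis using st nz by simp
    next
      case 2
      have "\<eta> * (\<omega> * \<omega>) = 1" using 2 omega3 by (simp add: mult.assoc)
      then have "- c * (\<omega> * \<omega> * cnj (a x)) = - c * cnj (a x)" using w by simp
      then have "(\<omega> * \<omega> - 1) * (c * cnj (a x)) = 0" by (simp add: algebra_simps)
      then have c: "c = 0" using w2 nz by simp
      have "marked x = Inr x" unfolding marked_def using 2 by simp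
      then have "t = 0" using 0 bspec[OF r x(2)] c by simp
      moreover have "(1 - \<omega> * \<omega>) * s = 0" using l 2 c by (simp add: algebra_simps)
      then have "s = 0" using w2 by simp
      ultimately show ?thesis using c by simp
    next
      case 3
      have 4: "\<eta> * \<omega> = 1" using 3 omega3 by simp
      then have "c * (\<omega> * a x) = c * a x" using l by simp
      then have "(\<omega> - 1) * (c * a x) = 0" by (simp add: algebra_simps)
      then have c: "c = 0" using omega(2) nz by simp
      have "marked x = Inl x" unfolding marked_def using 3 by simp
      then have s: "s = 0" using 0 bspec[OF r x(2)] c by simp
      have 5: "\<eta> * (\<omega> * \<omega>) = \<omega>" using 4 by (simp add: mult.assoc[symmetric])
      have "t = \<omega> * t" using w unfolding 5 c by simp
      then have "(1 - \<omega>) * t = 0" by (simp add: left_diff_distrib)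
      then show ?thesis using c s omega(2) by simp
    qed
  qed
  then show ?thesis using bspec[OF r y] by simp
qed

definition touched :: "('v \<times> 'v) set \<Rightarrow> 'v set" where
  "touched F = (\<Union>e\<in>F. orb (fst e) \<union> orb (snd e))"

lemma touched_mono: "F \<subseteq> G \<Longrightarrow> touched F \<subseteq> touched G"
  by (auto simp: touched_def)

lemma touched_V: "F \<subseteq> pairs \<Longrightarrow> touched F \<subseteq> V"
  using orb_V by (fastforce simp: touched_def pairs_def)

lemma orb_sub_invariant: "invariant (orb x)" if "x \<in> V"
  using that orb_V sigma_mem_orb unfolding invariant_def by blast

lemma invariant_touched:
  assumes "F \<subseteq> pairs" shows "invariant (touched F)"
  unfolding invariant_def
proof (intro conjI ballI)
  show "touched F \<subseteq> V" using assms by (rule touched_V)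
  fix x assume "x \<in> touched F"
  then obtain e where e: "e \<in> F" "x \<in> orb (fst e) \<union> orb (snd e)" by (auto simp: touched_def)
  have "fst e \<in> V" "snd e \<in> V" using e(1) assms by (auto simp: pairs_def)
  then have "\<sigma> x \<in> orb (fst e) \<union> orb (snd e)"
    using e(2) orb_sub_invariant unfolding invariant_def by blast
  then show "\<sigma> x \<in> touched F" using e(1) by (auto simp: touched_def)
qed

lemma mem_touched: "e \<in> F \<Longrightarrow> fst e \<in> touched F \<and> snd e \<in> touched F"
  using mem_orb by (force simp: touched_def)

lemma finite_pairs: "finite pairs"
  by (rule finite_subset[of _ "V \<times> V"]) (auto simp: pairs_def finV)

lemma finite_sub_pairs: "F \<subseteq> pairs \<Longrightarrow> finite F"
  using finite_pairs finite_subset by blast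

lemma indep_insert_marked:
  assumes a: "configuration a" and nz: "\<And>x. x \<in> V \<Longrightarrow> a x \<noteq> 0"
    and F: "F \<subseteq> V \<times> V" "indep a F" and x: "x \<in> V"
  shows "independent_on (velocities V) (tagged a) (insert (Inr (marked x)) (Inl ` F))"
proof -
  obtain u where u: "u \<in> velocities V" "rigid_motion_on a V u" "\<forall>x\<in>V. u (marked x) \<noteq> 0"
    using rigid_velocity[OF a nz] by blast
  have "stretch a e u = 0" if "e \<in> F" for e
    using rigid_motion_stretch[OF u(2), of "fst e" "snd e"] that F(1) by auto
  then have "u \<in> solutions (velocities V) (tagged a) (Inl ` F)"
    unfolding solutions_tagged motions_iff using u(1) by simp
  moreover have "tagged a (Inr (marked x)) u \<noteq> 0" using u(3) x by (simp add: tagged_def)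
  ultimately show ?thesis
    by (rule independent_on_insert[OF subspace_velocities linear_tagged independent_tagged[OF F(2)]])
qed

lemma tagged_local:
  assumes "F \<subseteq> U \<times> U" "i \<in> Inl ` F \<union> Inr ` (Inl ` U \<union> Inr ` U)"
    "\<forall>x\<in>U. u (Inl x) = w (Inl x) \<and> u (Inr x) = w (Inr x)"
  shows "tagged a i u = tagged a i w"
proof -
  consider x y where "i = Inl (x, y)" "x \<in> U" "y \<in> U" | x where "x \<in> U" "i = Inr (Inl x) \<or> i = Inr (Inr x)"
    using assms(1,2) by blast
  then show ?thesis using assms(3) by cases (auto simp: tagged_def stretch_pair)
qed

lemma indep_card:
  assumes a: "configuration a" and nz: "\<And>x. x \<in> V \<Longrightarrow> a x \<noteq> 0"
    and U: "invariant U" "x \<in> U" and F: "F \<subseteq> U \<times> U" "finite F" "indep a F"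
  shows "3 * card F + 3 \<le> 2 * card U"
proof -
  have UV: "U \<subseteq> V" using U by (simp add: invariant_def)
  let ?I = "insert (Inr (marked x)) (Inl ` F) :: (('v \<times> 'v) + ('v + 'v)) set"
  have "independent_on (velocities V) (tagged a) ?I"
    by (rule indep_insert_marked[OF a nz _ F(3)]) (use F UV U in auto)
  then have "3 * card ?I \<le> 2 * card U"
  proof (rule independent_card_le[OF U(1) linear_tagged, rotated 2])
    show "tagged a i u = tagged a i w"
      if "i \<in> ?I" "\<forall>x\<in>U. u (Inl x) = w (Inl x) \<and> u (Inr x) = w (Inr x)" for i u w
      by (rule tagged_local[OF F(1) _ that(2)]) (use that(1) U(2) in \<open>auto simp: marked_def\<close>)
  qed (use F in simp)
  moreover have "card ?I = card F + 1"
    using F(2) by (subst card_insert_disjoint) (auto simp: card_image)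
  ultimately show ?thesis by simp
qed

text \<open>An independent set of this size leaves only a line of motions, which the rigid ones fill.\<close>

lemma full_rank_rigid:
  assumes a: "configuration a" and nz: "\<And>x. x \<in> V \<Longrightarrow> a x \<noteq> 0"
    and U: "invariant U" and F: "F \<subseteq> U \<times> U" "finite F" "indep a F" and full: "2 * card U \<le> 3 * card F + 3"
    and u: "u \<in> motions a F"
  shows "rigid_motion_on a U u"
proof (cases "U = {}")
  case True
  then show ?thesis by (simp add: rigid_motion_on_def)
next
  case False
  then obtain x where x: "x \<in> U" by blast
  have UV: "U \<subseteq> V" using U by (simp add: invariant_def)
  obtain r where r: "r \<in> velocities V" "rigid_motion_on a V r" "\<forall>x\<in>V. r (marked x) \<noteq> 0"
    using rigid_velocity[OF a nz] by blast
  obtain c s t where rr: "\<forall>x\<in>V. r (Inl x) = c * a x + s \<and> r (Inr x) = - c * cnj (a x) + t"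
    using r(2) unfolding rigid_motion_on_def by blast
  define q where "q = u (marked x) / r (marked x)"
  define w where "w = (\<lambda>k. u k + (- q) * r k)"
  have wV: "w \<in> velocities V"
    unfolding w_def by (rule subspace_of_functionsD[OF subspace_velocities])
      (use u r(1) in \<open>simp_all add: motions_iff\<close>)
  have "stretch a e w = 0" if "e \<in> F" for e
  proof -
    have "stretch a e r = 0"
      using rigid_motion_stretch[OF r(2), of "fst e" "snd e"] subsetD[OF F(1) that] UV
      by (auto simp: subset_iff)
    moreover have "stretch a e u = 0" using u that by (simp add: motions_iff)
    ultimately show ?thesis unfolding w_def linear_functionalD[OF linear_stretch] by simp
  qed
  then have wF: "w \<in> motions a F" using wV by (simp add: motions_iff)
  have wx: "w (marked x) = 0" using r(3) x UV by (auto simp: w_def q_def)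
  have w0: "w (Inl y) = 0 \<and> w (Inr y) = 0" if y: "y \<in> U" for y
  proof (rule ccontr)
    assume "\<not> ?thesis"
    then obtain k where k: "k = Inl y \<or> k = Inr y" "w k \<noteq> 0" by blast
    let ?J = "insert (Inr (marked x)) (Inl ` F) :: (('v \<times> 'v) + ('v + 'v)) set"
    let ?I = "insert (Inr k) ?J"
    have J: "independent_on (velocities V) (tagged a) ?J"
      by (rule indep_insert_marked[OF a nz _ F(3)]) (use F UV x in auto)
    have "w \<in> solutions (velocities V) (tagged a) ?J"
      unfolding solutions_insert solutions_tagged using wF wx by (simp add: tagged_def)
    moreover have "tagged a (Inr k) w \<noteq> 0" using k(2) by (simp add: tagged_def)
    ultimately have "independent_on (velocities V) (tagged a) ?I"
      by (rule independent_on_insert[OF subspace_velocities linear_tagged J])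
    then have "3 * card ?I \<le> 2 * card U"
    proof (rule independent_card_le[OF U linear_tagged, rotated 2])
      show "tagged a i u = tagged a i w"
        if "i \<in> ?I" "\<forall>x\<in>U. u (Inl x) = w (Inl x) \<and> u (Inr x) = w (Inr x)" for i u w
        by (rule tagged_local[OF F(1) _ that(2)]) (use that(1) x y k(1) in \<open>auto simp: marked_def\<close>)
    qed (use F in simp)
    moreover have "k \<noteq> marked x" using k(2) wx by auto
    then have "card ?I = card F + 2"
      using F(2) by (subst card_insert_disjoint, simp, force, subst card_insert_disjoint) (auto simp: card_image)
    ultimately show False using full by simp
  qed
  have uw: "u k = w k + q * r k" for k by (simp add: w_def)
  show ?thesis
    unfolding rigid_motion_on_def
  proof (rule exI[of _ "q * c"], rule exI[of _ "q * s"], rule exI[of _ "q * t"], rule ballI)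
    fix y assume y: "y \<in> U"
    then have yV: "y \<in> V" using UV by blast
    show "u (Inl y) = q * c * a y + q * s \<and> u (Inr y) = - (q * c) * cnj (a y) + q * t"
      by (simp add: uw w0[OF y] bspec[OF rr yV] algebra_simps)
  qed
qed


definition meeting :: "'v \<Rightarrow> ('v \<times> 'v) set \<Rightarrow> ('v \<times> 'v) set" where
  "meeting v F = {e \<in> F. fst e \<in> orb v \<or> snd e \<in> orb v}"

lemma avoids_Diff_meeting: "avoids v (F - meeting v F)"
  by (auto simp: avoids_def meeting_def)

lemma orb_power: "y \<in> orb x \<Longrightarrow> \<exists>k. y = (\<sigma> ^^ k) x"
proof -
  assume "y \<in> orb x"
  then consider "y = (\<sigma> ^^ 0) x" | "y = (\<sigma> ^^ 1) x" | "y = (\<sigma> ^^ 2) x"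
    by (auto simp: orb_def numeral_2_eq_2)
  then show ?thesis by cases blast+
qed

lemma power_mem_orb: "x \<in> V \<Longrightarrow> (\<sigma> ^^ k) x \<in> orb x"
  by (induction k) (simp_all add: mem_orb sigma_mem_orb sigma_power_in)

lemma parallel_swap: "parallel e (prod.swap e)"
  unfolding parallel_def by (rule exI[of _ 0]) (simp add: translate_0)

lemma parallel_loop:
  assumes v: "v \<in> V" and e: "e \<in> pairs" "fst e \<in> orb v" "snd e \<in> orb v"
  shows "parallel e (v, \<sigma> v)"
proof -
  obtain x y where xy: "e = (x, y)" by fastforce
  have "x \<noteq> y" "x \<in> orb v" "y \<in> orb v" using e by (auto simp: xy pairs_def)
  then have "\<exists>k\<in>{0, 1, 2}. e = translate k (v, \<sigma> v) \<or> e = prod.swap (translate k (v, \<sigma> v))"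
    using v by (auto simp: xy orb_def translate_def numeral_2_eq_2 sigma3)
  then have "parallel (v, \<sigma> v) e" unfolding parallel_def by blast
  from parallel_sym[OF this] show ?thesis using v sigma_in by simp
qed

lemma parallel_edge:
  assumes v: "v \<in> V" and e: "e \<in> pairs" "e \<in> meeting v F" "\<not> (fst e \<in> orb v \<and> snd e \<in> orb v)"
  obtains x where "x \<in> V" "x \<notin> orb v" "parallel e (v, x)" "x \<in> orb (fst e) \<union> orb (snd e)"
proof -
  have *: "\<exists>x. x \<in> V \<and> x \<notin> orb v \<and> parallel e (v, x) \<and> x \<in> orb (snd e)"
    if "e \<in> pairs" "fst e \<in> orb v" "snd e \<notin> orb v" for e
  proof -
    have V: "fst e \<in> V" "snd e \<in> V" using that(1) by (auto simp: pairs_def)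
    have "v \<in> orb (fst e)" using mem_orb_sym[OF v V(1)] that(2) by blast
    then obtain k where k: "v = (\<sigma> ^^ k) (fst e)" using orb_power by blast
    let ?x = "(\<sigma> ^^ k) (snd e)"
    have x: "?x \<in> V" "?x \<in> orb (snd e)" using V sigma_power_in power_mem_orb by blast+
    moreover have "?x \<notin> orb v"
    proof
      assume "?x \<in> orb v"
      then have "orb ?x = orb v" using orb_eq v by blast
      moreover have "orb ?x = orb (snd e)" using orb_eq x(2) V by blast
      ultimately show False using that(3) mem_orb by blast
    qed
    moreover have "parallel e (v, ?x)"
      unfolding parallel_def by (rule exI[of _ k]) (simp add: translate_def k)
    ultimately show ?thesis by blast
  qed
  show ?thesis
  proof (cases "fst e \<in> orb v")
    case True
    then show ?thesis using *[of e] e that by blast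
  next
    case False
    then have "snd e \<in> orb v" using e(2) by (auto simp: meeting_def)
    moreover have "prod.swap e \<in> pairs" using e(1) by (auto simp: pairs_def)
    ultimately obtain x where x: "x \<in> V" "x \<notin> orb v" "parallel (prod.swap e) (v, x)" "x \<in> orb (fst e)"
      using *[of "prod.swap e"] False by auto
    then show ?thesis using that parallel_trans[OF parallel_swap x(3)] by blast
  qed
qed

lemma indep_cong: "(\<And>e. e \<in> F \<Longrightarrow> stretch b e = stretch a e) \<Longrightarrow> indep b F \<longleftrightarrow> indep a F"
  unfolding independent_on_def solutions_def by simp

lemma move_orbit:
  assumes a: "configuration a" and v: "v \<in> V"
  obtains b where "configuration b" "b v = z" "\<And>x. x \<notin> orb v \<Longrightarrow> b x = a x"
    "\<And>F. avoids v F \<Longrightarrow> indep b F \<longleftrightarrow> indep a F"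
    "\<And>F. avoids v F \<Longrightarrow> motions b F = motions a F"
proof -
  define b where "b x = (if x = v then z else if x = \<sigma> v then \<omega> * z
    else if x = \<sigma> (\<sigma> v) then \<omega> * (\<omega> * z) else a x)" for x
  have off: "b x = a x" if "x \<notin> orb v" for x using that by (auto simp: b_def orb_def)
  note d = sigma_free[OF v] sigma_distinct[OF v]
  have 3: "\<omega> * (\<omega> * (\<omega> * z)) = z" using omega3 by (simp add: mult.assoc[symmetric])
  have "configuration b"
    unfolding configuration_def
  proof
    fix x assume x: "x \<in> V"
    show "b (\<sigma> x) = \<omega> * b x"
    proof (cases "x \<in> orb v")
      case True
      then consider "x = v" | "x = \<sigma> v" | "x = \<sigma> (\<sigma> v)" by (auto simp: orb_def)
      then show ?thesis using d by cases (simp_all add: b_def sigma3[OF v] 3)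
    next
      case False
      then show ?thesis using off sigma_mem_orb[OF v x] configurationD[OF a x] by simp
    qed
  qed
  moreover have "stretch b e = stretch a e" if "avoids v F" "e \<in> F" for F e
    using that off unfolding stretch_def avoids_def by auto
  then have "indep b F \<longleftrightarrow> indep a F" "motions b F = motions a F" if "avoids v F" for F
    using that indep_cong[of F b a] by (blast, simp add: solutions_def)
  moreover have "b v = z" by (simp add: b_def)
  ultimately show ?thesis using off that by blast
qed

definition inside :: "('v \<times> 'v) set \<Rightarrow> 'v set \<Rightarrow> ('v \<times> 'v) set" where
  "inside F Z = {e \<in> F. \<exists>k. translate k e \<in> Z \<times> Z}"

lemma inside_mono: "Z \<subseteq> Z' \<Longrightarrow> inside F Z \<subseteq> inside F Z'"
  by (auto simp: inside_def mem_Times_iff)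

lemma inside_translate:
  assumes "Z \<subseteq> V" shows "inside F Z \<subseteq> inside F ((\<sigma> ^^ k) ` Z)"
proof
  fix e assume "e \<in> inside F Z"
  then obtain l where "e \<in> F" "translate l e \<in> Z \<times> Z" by (auto simp: inside_def mem_Times_iff)
  moreover from this have "translate (k + l) e \<in> (\<sigma> ^^ k) ` Z \<times> (\<sigma> ^^ k) ` Z"
    by (auto simp: translate_def funpow_add)
  ultimately show "e \<in> inside F ((\<sigma> ^^ k) ` Z)"
    unfolding inside_def by (intro CollectI conjI exI[of _ "k + l"])
qed

end

section \<open>Circuits of generic configurations\<close>

text \<open>Genericity enters in two ways only: the edge sets that are independent somewhere are independent
  here, and no three points are collinear.\<close>

locale generic_threefold = threefold_action V \<sigma> R \<omega> \<eta>
  for V :: "'v set" and \<sigma> :: "'v \<Rightarrow> 'v" and R :: "'v set" and \<omega> \<eta> :: complex +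
  fixes a :: "'v \<Rightarrow> complex"
  assumes conf: "configuration a"
    and generic: "F \<subseteq> pairs \<Longrightarrow> configuration b \<Longrightarrow> indep b F \<Longrightarrow> indep a F"
    and general_position: "{x, y, z} \<subseteq> V \<Longrightarrow> x \<noteq> y \<Longrightarrow> x \<noteq> z \<Longrightarrow> y \<noteq> z \<Longrightarrow> noncollinear a x y z"
begin

lemma a_nonzero: "x \<in> V \<Longrightarrow> a x \<noteq> 0"
proof
  assume x: "x \<in> V" and 0: "a x = 0"
  have "noncollinear a x (\<sigma> x) (\<sigma> (\<sigma> x))"
    using x sigma_in sigma_free[OF x] sigma_distinct[OF x] by (intro general_position) auto
  from noncollinear_distinct(1)[OF this] show False using 0 configurationD[OF conf x] by simp
qed

lemma a_inj: "x \<in> V \<Longrightarrow> y \<in> V \<Longrightarrow> x \<noteq> y \<Longrightarrow> a x \<noteq> a y"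
proof -
  assume x: "x \<in> V" "y \<in> V" "x \<noteq> y"
  obtain z where z: "z \<in> V" "z \<noteq> x" "z \<noteq> y"
    using x sigma_in sigma_free[OF x(1)] sigma_distinct[OF x(1)] by metis
  show ?thesis
    by (rule noncollinear_distinct(1)[OF general_position[of x y z]]) (use x z in auto)
qed

text \<open>Up to the position of the vertex, \<open>A\<close> and \<open>B\<close> are the entries of the row of a loop. The second
  inequality says that this row is independent of the row of an edge to \<open>x\<close> if the vertex lies at
  \<open>\<i>\<close> times the position of \<open>x\<close>. It is a computation for each of the three characters: \<open>A = B\<close> for the
  trivial one, and just one of \<open>A\<close> and \<open>B\<close> vanishes for the other two.\<close>

lemma loop_coefficients:
  fixes A B :: complex
  assumes A: "A = (1 - \<omega> * \<omega>) * (1 - \<eta> * \<omega>)" and B: "B = (1 - \<omega>) * (1 - \<eta> * (\<omega> * \<omega>))"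
  shows "A \<noteq> 0 \<or> B \<noteq> 0" "A * (\<i> - 1) * cnj \<i> \<noteq> B * \<i> * cnj (\<i> - 1)"
proof -
  have w2: "\<omega> * \<omega> \<noteq> 1" using omega3 omega(2) by force
  have "A * (\<i> - 1) * cnj \<i> \<noteq> B * \<i> * cnj (\<i> - 1)"
  proof -
    consider "\<eta> = 1" | "\<eta> = \<omega>" | "\<eta> = \<omega> * \<omega>" using eta_cases by blast
    then show ?thesis
    proof cases
      case 1
      then have AB: "A = B" "A \<noteq> 0" using A B w2 omega(2) by simp_all
      moreover have "(\<i> - 1) * cnj \<i> \<noteq> \<i> * cnj (\<i> - 1)" by (simp add: complex_eq_iff)
      ultimately have "A * ((\<i> - 1) * cnj \<i>) \<noteq> A * (\<i> * cnj (\<i> - 1))" by (simp only: mult_cancel_left) simp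
      then show ?thesis unfolding AB(1) by (simp only: mult.assoc not_False_eq_True)
    next
      case 2
      have "\<eta> * (\<omega> * \<omega>) = 1" using 2 omega3 by (simp add: mult.assoc)
      then have B0: "B = 0" using B by simp
      have "A \<noteq> 0" using A w2 2 by simp
      moreover have "\<i> \<noteq> 1" by (simp add: complex_eq_iff)
      ultimately show ?thesis using B0 by simp
    next
      case 3
      have 4: "\<eta> * \<omega> = 1" using 3 omega3 by simp
      then have A0: "A = 0" using A by simp
      have 5: "\<eta> * (\<omega> * \<omega>) = \<omega>" using 4 by (simp add: mult.assoc[symmetric])
      have "B \<noteq> 0" unfolding B 5 using omega(2) by simp
      moreover have "- \<i> \<noteq> 1" by (simp add: complex_eq_iff)
      ultimately show ?thesis using A0 by simp
    qed
  qed
  then show "A * (\<i> - 1) * cnj \<i> \<noteq> B * \<i> * cnj (\<i> - 1)" "A \<noteq> 0 \<or> B \<noteq> 0" by auto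
qed

lemma row_of_edge:
  assumes b: "configuration b" and e: "e \<in> pairs" "parallel e (v, x)" and x: "x \<notin> orb v" "v \<in> V" "x \<in> V"
  obtains c where "c \<noteq> 0" "row_form b v e (c * cnj (b v - b x)) (c * (b v - b x))"
    "\<forall>u\<in>velocities V. stretch b e u = c * stretch b (v, x) u"
proof -
  have "parallel (v, x) e" using parallel_sym[OF e(2)] e(1) pairs_sub by blast
  then obtain c where c: "c \<noteq> 0" "\<forall>u\<in>velocities V. stretch b e u = c * stretch b (v, x) u"
    using stretch_parallel[OF b, of "(v, x)" e] x by auto
  then show ?thesis using that row_form_scale[OF row_form_edge[OF x(1)] c(2)] by blast
qed

lemma row_of_loop:
  assumes b: "configuration b" and e: "e \<in> pairs" "parallel e (v, \<sigma> v)" and v: "v \<in> V"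
  obtains c where "c \<noteq> 0" "row_form b v e (c * ((1 - \<omega> * \<omega>) * (1 - \<eta> * \<omega>) * cnj (b v)))
    (c * ((1 - \<omega>) * (1 - \<eta> * (\<omega> * \<omega>)) * b v))"
proof -
  have "parallel (v, \<sigma> v) e" using parallel_sym[OF e(2)] e(1) pairs_sub by blast
  then obtain c where c: "c \<noteq> 0" "\<forall>u\<in>velocities V. stretch b e u = c * stretch b (v, \<sigma> v) u"
    using stretch_parallel[OF b, of "(v, \<sigma> v)" e] v sigma_in by auto
  then show ?thesis using that row_form_scale[OF row_form_loop[OF b v] c(2)] by blast
qed

text \<open>The midpoint and right-angle positions used below are special, but independence at a special position
  implies independence at a generic one.\<close>

lemma extend_edge_and_loop:
  assumes v: "v \<in> V" and F: "F \<subseteq> pairs" "avoids v F" "indep a F"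
    and e: "e \<in> pairs" "parallel e (v, \<sigma> v)" and f: "f \<in> pairs" "parallel f (v, x)" "x \<in> V" "x \<notin> orb v"
  shows "indep a (insert f (insert e F))"
proof -
  obtain b where b: "configuration b" "b v = \<i> * a x" "\<And>x. x \<notin> orb v \<Longrightarrow> b x = a x"
    "\<And>F. avoids v F \<Longrightarrow> indep b F \<longleftrightarrow> indep a F"
    using move_orbit[OF conf v, of "\<i> * a x"] by metis
  obtain c where c: "c \<noteq> 0" "row_form b v e (c * ((1 - \<omega> * \<omega>) * (1 - \<eta> * \<omega>) * cnj (b v)))
    (c * ((1 - \<omega>) * (1 - \<eta> * (\<omega> * \<omega>)) * b v))"
    by (rule row_of_loop[OF b(1) e v])
  obtain d where d: "d \<noteq> 0" "row_form b v f (d * cnj (b v - b x)) (d * (b v - b x))"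
    by (rule row_of_edge[OF b(1) f(1,2,4) v f(3)])
  define A where "A = (1 - \<omega> * \<omega>) * (1 - \<eta> * \<omega>)"
  define B where "B = (1 - \<omega>) * (1 - \<eta> * (\<omega> * \<omega>))"
  have bv: "b v = \<i> * a x" "b v - b x = (\<i> - 1) * a x" using b(2) b(3)[OF f(4)] by (simp_all add: algebra_simps)
  have D: "c * (A * cnj (b v)) * (d * (b v - b x)) - d * cnj (b v - b x) * (c * (B * b v)) =
      c * d * (a x * cnj (a x)) * (A * (\<i> - 1) * cnj \<i> - B * \<i> * cnj (\<i> - 1))"
    unfolding bv(2) unfolding bv(1) by (simp add: algebra_simps)
  have E: "A * (\<i> - 1) * cnj \<i> - B * \<i> * cnj (\<i> - 1) \<noteq> 0"
    using loop_coefficients(2)[OF A_def B_def] unfolding right_minus_eq .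
  have "c * (A * cnj (b v)) * (d * (b v - b x)) \<noteq> d * cnj (b v - b x) * (c * (B * b v))"
  proof
    assume "c * (A * cnj (b v)) * (d * (b v - b x)) = d * cnj (b v - b x) * (c * (B * b v))"
    then have "c * d * (a x * cnj (a x)) * (A * (\<i> - 1) * cnj \<i> - B * \<i> * cnj (\<i> - 1)) = 0"
      unfolding D[symmetric] right_minus_eq .
    then show False using E c(1) d(1) a_nonzero[OF f(3)] unfolding mult_eq_0_iff complex_cnj_zero_iff by blast
  qed
  then have "indep b (insert f (insert e F))"
    unfolding A_def B_def using b(4)[OF F(2)] F(3)
    by (intro extend_by_two_edges[OF v F(2) _ c(2) d(2)]) simp_all
  from generic[OF _ b(1) this] show ?thesis using F e f by auto
qed

text \<open>For a suitable position of a vertex orbit, one or two nonparallel edges at it are independent in the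
  two columns of this orbit, so that they cannot take part in a linear dependence; by genericity the same
  holds at the given position.\<close>

lemma circuit_meets_orbit_thrice:
  assumes K: "K \<subseteq> pairs" "\<not> indep a K" "\<And>e. e \<in> K \<Longrightarrow> indep a (K - {e})"
    and simple: "\<And>e f. e \<in> K \<Longrightarrow> f \<in> K \<Longrightarrow> parallel e f \<Longrightarrow> e = f"
    and v: "v \<in> V" and ne: "meeting v K \<noteq> {}"
  shows "3 \<le> card (meeting v K)"
proof (rule ccontr)
  assume "\<not> ?thesis"
  define T where "T = meeting v K"
  define F where "F = K - T"
  have finT: "finite T" using finite_sub_pairs[OF K(1)] by (simp add: T_def meeting_def)
  have TK: "T \<subseteq> K" by (auto simp: T_def meeting_def)
  have F: "F \<subseteq> pairs" "avoids v F" using K(1) avoids_Diff_meeting by (auto simp: F_def T_def)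
  obtain e0 where "e0 \<in> T" using ne by (auto simp: T_def)
  then have "indep a (K - {e0})" "F \<subseteq> K - {e0}" using K(3)[of e0] TK by (blast, auto simp: F_def)
  then have indF: "indep a F" by (rule independent_on_subset)
  have KF: "K = T \<union> F" using TK by (auto simp: F_def)
  have "card T = 1 \<or> card T = 2"
  proof -
    have "card T \<noteq> 0" using ne finT by (simp add: T_def)
    then show ?thesis using \<open>\<not> 3 \<le> card (meeting v K)\<close> by (auto simp: T_def)
  qed
  moreover have False if one: "card T = 1"
  proof -
    obtain e where e: "T = {e}" using one by (rule card_1_singletonE)
    then have eK: "e \<in> K" "e \<in> pairs" using TK K(1) by auto
    have "indep a (insert e F)"
    proof (cases "fst e \<in> orb v \<and> snd e \<in> orb v")
      case True
      then have "parallel e (v, \<sigma> v)" using parallel_loop[OF v eK(2)] by blast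
      then obtain c where c: "c \<noteq> 0" "row_form a v e (c * ((1 - \<omega> * \<omega>) * (1 - \<eta> * \<omega>) * cnj (a v)))
          (c * ((1 - \<omega>) * (1 - \<eta> * (\<omega> * \<omega>)) * a v))"
        using row_of_loop[OF conf eK(2) _ v] by blast
      show ?thesis
        by (rule extend_by_one_edge[OF v F(2) indF c(2)])
          (use c(1) a_nonzero[OF v] loop_coefficients(1)[OF refl refl] in auto)
    next
      case False
      have "e \<in> meeting v K" using e by (simp add: T_def[symmetric])
      then obtain x where x: "x \<in> V" "x \<notin> orb v" "parallel e (v, x)"
        using parallel_edge[OF v eK(2) _ False] by blast
      then obtain c where c: "c \<noteq> 0" "row_form a v e (c * cnj (a v - a x)) (c * (a v - a x))"
        using row_of_edge[OF conf eK(2) x(3,2) v x(1)] by blast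
      have "x \<noteq> v" using x(2) mem_orb by blast
      show ?thesis
        by (rule extend_by_one_edge[OF v F(2) indF c(2)])
          (use c(1) a_inj[OF v x(1)] \<open>x \<noteq> v\<close> in auto)
    qed
    then show False using K(2) KF e by simp
  qed
  moreover have False if two: "card T = 2"
  proof -
    obtain e f where ef: "T = {e, f}" "e \<noteq> f" using two card_2_iff by metis
    then have eK: "e \<in> K" "e \<in> pairs" "f \<in> K" "f \<in> pairs" using TK K(1) by auto
    have m: "e \<in> meeting v K" "f \<in> meeting v K" using ef by (simp_all add: T_def[symmetric])
    have no: "\<not> parallel e f" using simple eK ef(2) by blast
    have swap: "insert f (insert e F) = K" "insert e (insert f F) = K" using KF ef(1) by auto
    consider "fst e \<in> orb v \<and> snd e \<in> orb v" "fst f \<in> orb v \<and> snd f \<in> orb v"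
      | "fst e \<in> orb v \<and> snd e \<in> orb v" "\<not> (fst f \<in> orb v \<and> snd f \<in> orb v)"
      | "\<not> (fst e \<in> orb v \<and> snd e \<in> orb v)" "fst f \<in> orb v \<and> snd f \<in> orb v"
      | "\<not> (fst e \<in> orb v \<and> snd e \<in> orb v)" "\<not> (fst f \<in> orb v \<and> snd f \<in> orb v)" by blast
    then show False
    proof cases
      case 1
      then have "parallel e (v, \<sigma> v)" "parallel f (v, \<sigma> v)" using parallel_loop[OF v] eK by blast+
      then have "parallel e f" using parallel_trans parallel_sym eK(4) pairs_sub by blast
      then show False using no by blast
    next
      case 2
      obtain x where "x \<in> V" "x \<notin> orb v" "parallel f (v, x)" using parallel_edge[OF v eK(4) m(2) 2(2)] by blast
      moreover have "parallel e (v, \<sigma> v)" using parallel_loop[OF v] eK 2 by blast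
      ultimately have "indep a (insert f (insert e F))"
        using extend_edge_and_loop[OF v F indF] eK by blast
      then show False using swap K(2) by simp
    next
      case 3
      obtain x where "x \<in> V" "x \<notin> orb v" "parallel e (v, x)" using parallel_edge[OF v eK(2) m(1) 3(1)] by blast
      moreover have "parallel f (v, \<sigma> v)" using parallel_loop[OF v] eK 3 by blast
      ultimately have "indep a (insert e (insert f F))"
        using extend_edge_and_loop[OF v F indF] eK by blast
      then show False using swap K(2) by simp
    next
      case 4
      obtain x where x: "x \<in> V" "x \<notin> orb v" "parallel e (v, x)" using parallel_edge[OF v eK(2) m(1) 4(1)] by blast
      obtain y where y: "y \<in> V" "y \<notin> orb v" "parallel f (v, y)" using parallel_edge[OF v eK(4) m(2) 4(2)] by blast
      have "x \<noteq> y"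
      proof
        assume "x = y"
        then have "parallel e f" using x(3) y(3) parallel_trans parallel_sym eK(4) pairs_sub by blast
        then show False using no by blast
      qed
      moreover have "x \<noteq> v" "y \<noteq> v" using x(2) y(2) mem_orb by blast+
      ultimately have nc: "noncollinear a x y v" using x(1) y(1) v by (intro general_position) auto
      obtain c where c: "c \<noteq> 0" "row_form a v e (c * cnj (a v - a x)) (c * (a v - a x))"
        using row_of_edge[OF conf eK(2) x(3,2) v x(1)] by blast
      obtain d where d: "d \<noteq> 0" "row_form a v f (d * cnj (a v - a y)) (d * (a v - a y))"
        using row_of_edge[OF conf eK(4) y(3,2) v y(1)] by blast
      have "c * d * (cnj (a v - a x) * (a v - a y) - (a v - a x) * cnj (a v - a y)) \<noteq> 0"
        using nc c(1) d(1) by (simp add: noncollinear_def)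
      then have "c * cnj (a v - a x) * (d * (a v - a y)) \<noteq> d * cnj (a v - a y) * (c * (a v - a x))"
        by (simp add: algebra_simps)
      then have "indep a (insert f (insert e F))"
        by (rule extend_by_two_edges[OF v F(2) indF c(2) d(2)])
      then show False using swap K(2) by simp
    qed
  qed
  ultimately show False by blast
qed

lemma extend_three_generic:
  assumes v: "v \<in> V" and F: "F \<subseteq> pairs" "avoids v F" "indep a F"
    and e: "e \<in> pairs" "parallel e (v, x)" and x: "x \<in> V" "x \<notin> orb v"
    and f: "f \<in> pairs" "parallel f (v, y)" and y: "y \<in> V" "y \<notin> orb v"
    and g: "g \<in> pairs" "parallel g (v, z)" and z: "z \<in> V" "z \<notin> orb v"
    and d: "x \<noteq> y" "x \<noteq> z" "y \<noteq> z"
    and u: "u \<in> motions a F" "stretch a (x, y) u \<noteq> 0"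
  shows "indep a (insert f (insert e (insert g F)))"
proof -
  obtain b where b: "configuration b" "b v = (a x + a y) / 2" "\<And>x. x \<notin> orb v \<Longrightarrow> b x = a x"
    "\<And>F. avoids v F \<Longrightarrow> indep b F \<longleftrightarrow> indep a F" "\<And>F. avoids v F \<Longrightarrow> motions b F = motions a F"
    using move_orbit[OF conf v, of "(a x + a y) / 2"] by metis
  note bx = b(3)[OF x(2)] b(3)[OF y(2)] b(3)[OF z(2)]
  obtain c where c: "c \<noteq> 0" "\<forall>u\<in>velocities V. stretch b e u = c * stretch b (v, x) u"
    by (rule row_of_edge[OF b(1) e x(2) v x(1)])
  obtain c' where c': "c' \<noteq> 0" "\<forall>u\<in>velocities V. stretch b f u = c' * stretch b (v, y) u"
    by (rule row_of_edge[OF b(1) f y(2) v y(1)])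
  obtain h where h: "h \<noteq> 0" "row_form b v g (h * cnj (b v - b z)) (h * (b v - b z))"
    by (rule row_of_edge[OF b(1) g z(2) v z(1)])
  have nc: "noncollinear a x y z" using x(1) y(1) z(1) d by (intro general_position) auto
  have "indep b (insert f (insert e (insert g F)))"
  proof (rule extend_by_three_edges[OF b(1) v F(2) _ x(2) y(2) _ _ _ _ c(2,1) c'(2,1) h(2)])
    show "indep b F" using b(4)[OF F(2)] F(3) by simp
    show "b x \<noteq> b y" using bx a_inj x(1) y(1) d(1) by simp
    show "b v = (b x + b y) / 2" using b(2) bx by simp
    show "u \<in> motions b F" using u(1) b(5)[OF F(2)] by simp
    show "stretch b (x, y) u \<noteq> 0" using u(2) bx by (simp add: stretch_pair)
    define p q where "p = a z - a x" and "q = a z - a y"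
    have pq: "b v - b z = - (p + q) / 2" "b y - b x = p - q"
      using b(2) bx by (simp_all add: p_def q_def field_simps)
    have D: "cnj (b y - b x) * (h * (b v - b z)) - h * cnj (b v - b z) * (b y - b x) =
        - h * (cnj p * q - p * cnj q)"
      unfolding pq by (simp add: field_simps)
    have E: "cnj p * q - p * cnj q \<noteq> 0" using nc by (simp add: noncollinear_def p_def q_def)
    show "cnj (b y - b x) * (h * (b v - b z)) \<noteq> h * cnj (b v - b z) * (b y - b x)"
    proof
      assume "cnj (b y - b x) * (h * (b v - b z)) = h * cnj (b v - b z) * (b y - b x)"
      then have "- h * (cnj p * q - p * cnj q) = 0" unfolding D[symmetric] right_minus_eq .
      then show False using E h(1) by simp
    qed
  qed
  from generic[OF _ b(1) this] show ?thesis using F e f g by auto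
qed


lemma insideI: "e \<in> F \<Longrightarrow> translate k e \<in> Z \<times> Z \<Longrightarrow> e \<in> inside F Z"
  unfolding inside_def by (intro CollectI conjI exI)

definition rigid_in :: "('v \<times> 'v) set \<Rightarrow> 'v set \<Rightarrow> bool" where
  "rigid_in F Z \<longleftrightarrow> (\<forall>u\<in>motions a F. rigid_motion_on a Z u)"

lemma rigid_in_mono: "rigid_in F Z \<Longrightarrow> F \<subseteq> G \<Longrightarrow> rigid_in G Z"
  unfolding rigid_in_def using solutions_antimono by blast

lemma triangle_rigid:
  assumes "{x, y, z} \<subseteq> V" "x \<noteq> y" "x \<noteq> z" "y \<noteq> z"
    "stretch a (x, y) u = 0" "stretch a (x, z) u = 0" "stretch a (y, z) u = 0"
  shows "rigid_motion_on a {x, y, z} u"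
  by (rule rigid_motion_triangle[OF general_position]) (use assms in auto)

lemma glue_rigid:
  assumes "rigid_motion_on a Z u" "rigid_motion_on a Z' u" "{x, y} \<subseteq> Z \<inter> Z'" "{x, y} \<subseteq> V" "x \<noteq> y"
  shows "rigid_motion_on a (Z \<union> Z') u"
  by (rule rigid_motion_glue[OF assms(1-3)]) (use a_inj assms in blast)

text \<open>Double counting: each end of an edge is seen by the three vertices of its orbit, so the average
  degree is below four.\<close>

lemma exists_orbit_of_low_degree:
  assumes K: "K \<subseteq> pairs" and small: "3 * card K < 2 * card (touched K)"
  shows "\<exists>v\<in>touched K. card {e \<in> K. fst e \<in> orb v} + card {e \<in> K. snd e \<in> orb v} \<le> 3"
proof (rule ccontr)
  let ?U = "touched K"
  let ?d = "\<lambda>v. card {e \<in> K. fst e \<in> orb v} + card {e \<in> K. snd e \<in> orb v}"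
  assume "\<not> ?thesis"
  then have "4 \<le> ?d v" if "v \<in> ?U" for v using that by force
  then have "(\<Sum>v\<in>?U. 4) \<le> (\<Sum>v\<in>?U. ?d v)" by (rule sum_mono)
  moreover have finK: "finite K" using K by (rule finite_sub_pairs)
  have UV: "?U \<subseteq> V" using K by (rule touched_V)
  then have finU: "finite ?U" using finV finite_subset by blast
  have count: "(\<Sum>v\<in>?U. card {e \<in> K. h e \<in> orb v}) = 3 * card K"
    if h: "\<And>e. e \<in> K \<Longrightarrow> h e \<in> V \<and> orb (h e) \<subseteq> ?U" for h :: "'v \<times> 'v \<Rightarrow> 'v"
  proof -
    have "(\<Sum>v\<in>?U. card {e \<in> K. h e \<in> orb v}) = (\<Sum>v\<in>?U. \<Sum>e\<in>{e \<in> K. h e \<in> orb v}. 1)" by simp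
    also have "\<dots> = (\<Sum>e\<in>K. \<Sum>v\<in>{v \<in> ?U. h e \<in> orb v}. 1)"
      by (rule sum.swap_restrict[OF finU finK])
    also have "\<dots> = (\<Sum>e\<in>K. 3)"
    proof (rule sum.cong)
      fix e assume e: "e \<in> K"
      have "{v \<in> ?U. h e \<in> orb v} = orb (h e)"
        using h[OF e] mem_orb_sym UV by blast
      then show "(\<Sum>v\<in>{v \<in> ?U. h e \<in> orb v}. 1) = (3::nat)" using card_orb h[OF e] by simp
    qed simp
    finally show ?thesis by simp
  qed
  have "(\<Sum>v\<in>?U. ?d v) = 3 * card K + 3 * card K"
    unfolding sum.distrib
    by (subst count, use K in \<open>force simp: pairs_def touched_def\<close>,
        subst count, use K in \<open>force simp: pairs_def touched_def\<close>, rule refl)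
  ultimately show False using small by simp
qed

text \<open>This is what makes the plane special: a pair that keeps its distance does so inside a vertex set
  that is rigid through its own edges alone. The induction is on the vertex orbits of a circuit through
  the pair. If the circuit is not already of full rank on all its orbits, it has an orbit of degree three;
  by the midpoint extension the three neighbours keep their mutual distances without it, which by
  induction is due to three rigid sets. These and the removed orbit form a rigid, dependent set of edges of the circuit,
  so this is the whole circuit.\<close>

lemma local_rigidity:
  assumes "F \<subseteq> pairs" "(x, y) \<in> pairs" "\<And>u. u \<in> motions a F \<Longrightarrow> stretch a (x, y) u = 0"
  shows "\<exists>Z\<subseteq>V. x \<in> Z \<and> y \<in> Z \<and> rigid_in (inside F Z) Z"
  using assms
proof (induction "card (touched (insert (x, y) F))" arbitrary: F x y rule: less_induct)
  case (less F x y)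
  let ?e = "(x, y)"
  have xyV: "x \<in> V" "y \<in> V" "x \<noteq> y" using less.prems(2) by (auto simp: pairs_def)
  have finF: "finite F" using less.prems(1) by (rule finite_sub_pairs)
  have single: ?case if f: "f \<in> F" "parallel ?e f" for f
  proof -
    have pf: "parallel f ?e" using parallel_sym[OF f(2)] xyV by simp
    have "f \<in> V \<times> V" using f(1) less.prems(1) pairs_sub by blast
    then obtain c where c: "\<forall>u\<in>velocities V. stretch a ?e u = c * stretch a f u"
      using stretch_parallel[OF conf pf] by blast
    have "f \<in> inside F {x, y}"
      using pf f(1) unfolding inside_def parallel_def by (auto simp: prod.swap_def mem_Times_iff)
    then have "rigid_in (inside F {x, y}) {x, y}"
      unfolding rigid_in_def
      using c a_inj[OF xyV] by (intro ballI rigid_motion_pair) (simp_all add: motions_iff)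
    then show ?thesis using xyV by (intro exI[of _ "{x, y}"]) simp
  qed
  show ?case
  proof (cases "\<exists>f\<in>F. parallel ?e f")
    case True
    then show ?thesis using single by blast
  next
    case nopar: False
    then have eF: "?e \<notin> F" using parallel_refl by blast
    obtain J where J: "J \<subseteq> F" "\<forall>u\<in>motions a J. stretch a ?e u = 0" "indep a J"
      "\<forall>i\<in>J. indep a (insert ?e J - {i})"
      using exists_circuit[where f = "stretch a" and I = F and e = ?e, OF subspace_velocities linear_stretch finF less.prems(3) eF]
      by blast
    define K where "K = insert ?e J"
    define U where "U = touched K"
    have JP: "J \<subseteq> pairs" using J(1) less.prems(1) by blast
    have KP: "K \<subseteq> pairs" using JP less.prems(2) by (simp add: K_def)
    have finK: "finite K" using KP by (rule finite_sub_pairs)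
    have finJ: "finite J" using JP by (rule finite_sub_pairs)
    have eJ: "?e \<notin> J" using J(1) eF by blast
    have invU: "invariant U" unfolding U_def using KP by (rule invariant_touched)
    have UV: "U \<subseteq> V" using invU by (simp add: invariant_def)
    have finU: "finite U" using UV finV finite_subset by blast
    have JU: "J \<subseteq> U \<times> U" and eU: "x \<in> U" "y \<in> U"
      using mem_touched[of _ K] by (force simp: U_def K_def)+
    have UF: "card U \<le> card (touched (insert ?e F))"
    proof (rule card_mono)
      have "insert ?e F \<subseteq> pairs" using less.prems by simp
      then show "finite (touched (insert ?e F))" using touched_V finV finite_subset by blast
      show "U \<subseteq> touched (insert ?e F)" unfolding U_def K_def using J(1) by (intro touched_mono) blast
    qed
    have MK: "motions a K = motions a J"
      using J(2) by (auto simp: motions_iff K_def)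
    have depK: "\<not> indep a K"
    proof
      assume "indep a K"
      then obtain u where "u \<in> motions a (K - {?e})" "stretch a ?e u \<noteq> 0"
        unfolding independent_on_def K_def by blast
      moreover have "K - {?e} = J" using eJ by (simp add: K_def)
      ultimately show False using J(2) by simp
    qed
    have indK: "indep a (K - {i})" if "i \<in> K" for i
    proof (cases "i = ?e")
      case True
      then have "K - {i} = J" using eJ by (simp add: K_def)
      then show ?thesis using J(3) by simp
    next
      case False
      then show ?thesis using J(4) that by (simp add: K_def)
    qed
    show ?thesis
    proof (cases "2 * card U \<le> 3 * card J + 3")
      case True
      have JF: "J \<subseteq> inside F U"
      proof
        fix e assume e: "e \<in> J"
        then have "translate 0 e \<in> U \<times> U" unfolding translate_0 using JU by blast
        from insideI[OF subsetD[OF J(1) e] this] show "e \<in> inside F U" .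
      qed
      have "rigid_in J U"
        unfolding rigid_in_def
      proof
        fix u assume u: "u \<in> motions a J"
        show "rigid_motion_on a U u"
          using conf a_nonzero invU JU finJ J(3) True u by (rule full_rank_rigid)
      qed
      from rigid_in_mono[OF this JF] have "U \<subseteq> V \<and> x \<in> U \<and> y \<in> U \<and> rigid_in (inside F U) U"
        using eU UV by simp
      then show ?thesis by (rule exI[where x = U])
    next
      case False
      have "card K = card J + 1" using eJ finJ by (simp add: K_def)
      then have "3 * card K < 2 * card (touched K)" using False by (simp add: U_def)
      then obtain v where v: "v \<in> U"
        and deg: "card {e \<in> K. fst e \<in> orb v} + card {e \<in> K. snd e \<in> orb v} \<le> 3"
        using exists_orbit_of_low_degree[OF KP] unfolding U_def by blast
      have vV: "v \<in> V" using v UV by blast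
      have simple: "e = f" if ef: "e \<in> K" "f \<in> K" "parallel e f" for e f
      proof (rule ccontr)
        assume ne: "e \<noteq> f"
        have V2: "e \<in> V \<times> V" "f \<in> V \<times> V" using ef KP pairs_sub by blast+
        have pf: "parallel f e" by (rule parallel_sym[OF ef(3) V2(1)])
        show False
        proof (cases "e = ?e \<or> f = ?e")
          case True
          then show False using nopar J(1) ne ef(1,2) pf ef(3) unfolding K_def by blast
        next
          case False
          then have "e \<in> J" "f \<in> J" using ef by (auto simp: K_def)
          then obtain u where u: "u \<in> motions a (J - {f})" "stretch a f u \<noteq> 0"
            using J(3) unfolding independent_on_def by blast
          moreover obtain c where "\<forall>u\<in>velocities V. stretch a f u = c * stretch a e u"
            using stretch_parallel[OF conf ef(3) V2(1)] by blast
          moreover have "stretch a e u = 0" using u(1) \<open>e \<in> J\<close> ne by (simp add: motions_iff)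
          ultimately show False by (simp add: motions_iff)
        qed
      qed
      define T where "T = meeting v K"
      define F0 where "F0 = K - T"
      have TK: "T \<subseteq> K" by (auto simp: T_def meeting_def)
      have finT: "finite T" using TK finK finite_subset by blast
      have Tne: "T \<noteq> {}"
      proof -
        obtain e where e: "e \<in> K" "v \<in> orb (fst e) \<union> orb (snd e)"
          using v by (auto simp: U_def touched_def)
        then have "fst e \<in> V" "snd e \<in> V" using KP by (auto simp: pairs_def)
        then have "e \<in> meeting v K" using e mem_orb_sym vV unfolding meeting_def by blast
        then show ?thesis by (auto simp: T_def)
      qed
      have "3 \<le> card T"
        unfolding T_def by (rule circuit_meets_orbit_thrice[OF KP depK indK simple vV]) (use Tne in \<open>auto simp: T_def\<close>)
      moreover
      let ?A = "{e \<in> K. fst e \<in> orb v}" and ?B = "{e \<in> K. snd e \<in> orb v}"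
      have TAB: "T = ?A \<union> ?B" by (auto simp: T_def meeting_def)
      have "card (?A \<union> ?B) + card (?A \<inter> ?B) = card ?A + card ?B"
        using finK by (intro card_Un_Int[symmetric]) auto
      moreover have "card T = card (?A \<union> ?B)" using TAB by simp
      ultimately have "card T = 3" "card (?A \<inter> ?B) = 0" using deg by linarith+
      then have no_loop: "\<not> (fst e \<in> orb v \<and> snd e \<in> orb v)" if "e \<in> T" for e
        using that TK finK by (auto simp: card_eq_0_iff)
      obtain e1 e2 e3 where T: "T = {e1, e2, e3}" "e1 \<noteq> e2" "e1 \<noteq> e3" "e2 \<noteq> e3"
        using \<open>card T = 3\<close> card_3_iff by metis
      have eP: "e1 \<in> pairs" "e2 \<in> pairs" "e3 \<in> pairs" and eK: "e1 \<in> K" "e2 \<in> K" "e3 \<in> K"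
        using T(1) TK KP by auto
      have nbr: "\<exists>z. z \<in> V \<and> z \<notin> orb v \<and> parallel e (v, z) \<and> z \<in> U" if e: "e \<in> T" for e
      proof -
        have "e \<in> pairs" using e TK KP by blast
        then obtain z where "z \<in> V" "z \<notin> orb v" "parallel e (v, z)" "z \<in> orb (fst e) \<union> orb (snd e)"
          using parallel_edge[OF vV _ _ no_loop[OF e]] e unfolding T_def by metis
        moreover from this have "z \<in> U" using e TK unfolding U_def touched_def by blast
        ultimately show ?thesis by blast
      qed
      obtain x1 where x1: "x1 \<in> V" "x1 \<notin> orb v" "parallel e1 (v, x1)" "x1 \<in> U" using nbr[of e1] T(1) by blast
      obtain x2 where x2: "x2 \<in> V" "x2 \<notin> orb v" "parallel e2 (v, x2)" "x2 \<in> U" using nbr[of e2] T(1) by blast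
      obtain x3 where x3: "x3 \<in> V" "x3 \<notin> orb v" "parallel e3 (v, x3)" "x3 \<in> U" using nbr[of e3] T(1) by blast
      have same: "e = f" if "parallel e (v, z)" "parallel f (v, z)" "e \<in> K" "f \<in> K" for e f z
        using that simple parallel_trans parallel_sym KP pairs_sub by (meson subsetD)
      have d: "x1 \<noteq> x2" "x1 \<noteq> x3" "x2 \<noteq> x3"
        using same[OF x1(3) _ eK(1,2)] same[OF x1(3) _ eK(1,3)] same[OF x2(3) _ eK(2,3)] x2(3) x3(3) T by metis+
      have vx: "v \<noteq> x1" "v \<noteq> x2" "v \<noteq> x3" using x1(2) x2(2) x3(2) mem_orb by blast+
      have F0: "F0 \<subseteq> pairs" "avoids v F0"
        using KP avoids_Diff_meeting by (auto simp: F0_def T_def)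
      have indF0: "indep a F0"
        by (rule independent_on_subset[OF indK[OF eK(1)]]) (use T(1) in \<open>auto simp: F0_def\<close>)
      have KT: "K = T \<union> F0" using TK by (auto simp: F0_def)
      have nb: "stretch a (p, q) u = 0"
        if u: "u \<in> motions a F0" and perm: "T = {e, f, g}"
          and e: "e \<in> pairs" "parallel e (v, p)" "p \<in> V" "p \<notin> orb v"
          and f: "f \<in> pairs" "parallel f (v, q)" "q \<in> V" "q \<notin> orb v"
          and g: "g \<in> pairs" "parallel g (v, r)" "r \<in> V" "r \<notin> orb v"
          and pqr: "p \<noteq> q" "p \<noteq> r" "q \<noteq> r" for u e f g p q r
      proof (rule ccontr)
        assume "stretch a (p, q) u \<noteq> 0"
        then have "indep a (insert f (insert e (insert g F0)))"
          by (rule extend_three_generic[OF vV F0 indF0 e f g pqr u])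
        moreover have "insert f (insert e (insert g F0)) = K" using KT perm by auto
        ultimately show False using depK by simp
      qed
      have nb12: "stretch a (x1, x2) u = 0" if "u \<in> motions a F0" for u
        by (rule nb[OF that T(1) eP(1) x1(3,1,2) eP(2) x2(3,1,2) eP(3) x3(3,1,2) d])
      have nb13: "stretch a (x1, x3) u = 0" if "u \<in> motions a F0" for u
        by (rule nb[OF that _ eP(1) x1(3,1,2) eP(3) x3(3,1,2) eP(2) x2(3,1,2) d(2,1) d(3)[symmetric]])
          (use T(1) in auto)
      have nb23: "stretch a (x2, x3) u = 0" if "u \<in> motions a F0" for u
        by (rule nb[OF that _ eP(2) x2(3,1,2) eP(3) x3(3,1,2) eP(1) x1(3,1,2) d(3) d(1)[symmetric] d(2)[symmetric]])
          (use T(1) in auto)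
      have step: "\<exists>Z\<subseteq>V. p \<in> Z \<and> q \<in> Z \<and> rigid_in (inside F0 Z) Z"
        if pq: "p \<in> V" "q \<in> V" "p \<in> U" "q \<in> U" "p \<notin> orb v" "q \<notin> orb v" "p \<noteq> q"
          and s: "\<And>u. u \<in> motions a F0 \<Longrightarrow> stretch a (p, q) u = 0" for p q
      proof (rule less.hyps[OF _ F0(1) _ s])
        have sub: "insert (p, q) F0 \<subseteq> pairs" using F0 pq by (simp add: pairs_def)
        have "touched (insert (p, q) F0) \<subseteq> U"
        proof -
          have "touched F0 \<subseteq> U" unfolding U_def F0_def by (rule touched_mono) blast
          moreover have "orb p \<subseteq> U" "orb q \<subseteq> U" using invariant_orb[OF invU] pq by blast+
          ultimately show ?thesis by (simp add: touched_def)
        qed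
        moreover have "v \<notin> touched (insert (p, q) F0)"
        proof
          assume "v \<in> touched (insert (p, q) F0)"
          then obtain e where e: "e \<in> insert (p, q) F0" "v \<in> orb (fst e) \<union> orb (snd e)"
            unfolding touched_def by blast
          then have "fst e \<in> V" "snd e \<in> V" using sub by (auto simp: pairs_def)
          then have "fst e \<in> orb v \<or> snd e \<in> orb v" using e(2) mem_orb_sym vV by blast
          then show False using e(1) F0(2) pq unfolding avoids_def by auto
        qed
        ultimately have "touched (insert (p, q) F0) \<subset> U" using v by blast
        then have "card (touched (insert (p, q) F0)) < card U" using finU by (rule psubset_card_mono[rotated])
        then show "card (touched (insert (p, q) F0)) < card (touched (insert ?e F))" using UF by linarith
        show "(p, q) \<in> pairs" using pq by (simp add: pairs_def)
      qed
      obtain Z3 where Z3: "Z3 \<subseteq> V" "x1 \<in> Z3" "x2 \<in> Z3" "rigid_in (inside F0 Z3) Z3"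
        using step[OF x1(1) x2(1) x1(4) x2(4) x1(2) x2(2) d(1) nb12] by blast
      obtain Z2 where Z2: "Z2 \<subseteq> V" "x1 \<in> Z2" "x3 \<in> Z2" "rigid_in (inside F0 Z2) Z2"
        using step[OF x1(1) x3(1) x1(4) x3(4) x1(2) x3(2) d(2) nb13] by blast
      obtain Z1 where Z1: "Z1 \<subseteq> V" "x2 \<in> Z1" "x3 \<in> Z1" "rigid_in (inside F0 Z1) Z1"
        using step[OF x2(1) x3(1) x2(4) x3(4) x2(2) x3(2) d(3) nb23] by blast
      define Z where "Z = Z1 \<union> Z2 \<union> Z3 \<union> {v, x1, x2, x3}"
      have ZV: "Z \<subseteq> V" using Z1(1) Z2(1) Z3(1) vV x1(1) x2(1) x3(1) by (auto simp: Z_def)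
      define G where "G = inside F0 Z1 \<union> inside F0 Z2 \<union> inside F0 Z3 \<union> {e1, e2}"
      have rigidG: "rigid_motion_on a Z u" if u: "u \<in> motions a G" for u
      proof -
        have uV: "u \<in> velocities V" using u by (simp add: motions_iff)
        have r: "rigid_motion_on a Z1 u" "rigid_motion_on a Z2 u" "rigid_motion_on a Z3 u"
        proof -
          have "u \<in> motions a (inside F0 Z1)" "u \<in> motions a (inside F0 Z2)"
            "u \<in> motions a (inside F0 Z3)"
            using u by (simp_all add: motions_iff G_def)
          then show "rigid_motion_on a Z1 u" "rigid_motion_on a Z2 u" "rigid_motion_on a Z3 u"
            using Z1(4) Z2(4) Z3(4) unfolding rigid_in_def by simp_all
        qed
        have s: "stretch a (x1, x2) u = 0" "stretch a (x1, x3) u = 0" "stretch a (x2, x3) u = 0"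
          using rigid_motion_stretch r Z1 Z2 Z3 by blast+
        have e0: "stretch a (v, z) u = 0" if ez: "parallel e (v, z)" "e \<in> {e1, e2}" for e z
        proof -
          have "e \<in> V \<times> V" using ez(2) eP pairs_sub by blast
          then obtain c where "\<forall>u\<in>velocities V. stretch a (v, z) u = c * stretch a e u"
            using stretch_parallel[OF conf ez(1)] by blast
          moreover have "stretch a e u = 0" using u ez(2) by (auto simp: motions_iff G_def)
          ultimately show ?thesis using uV by simp
        qed
        have tri: "rigid_motion_on a {x1, x2, x3} u"
          by (rule triangle_rigid) (use x1 x2 x3 d s in auto)
        have tv: "rigid_motion_on a {v, x1, x2} u"
          by (rule triangle_rigid) (use x1(1) x2(1) vV d vx s e0[OF x1(3)] e0[OF x2(3)] in auto)
        have "rigid_motion_on a ({x1, x2, x3} \<union> {v, x1, x2}) u"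
          by (rule glue_rigid[OF tri tv, of x1 x2]) (use x1 x2 d in auto)
        then have "rigid_motion_on a (({x1, x2, x3} \<union> {v, x1, x2}) \<union> Z1) u"
          by (rule glue_rigid[OF _ r(1), of _ x2 x3]) (use x2 x3 d Z1 in auto)
        then have "rigid_motion_on a ((({x1, x2, x3} \<union> {v, x1, x2}) \<union> Z1) \<union> Z2) u"
          by (rule glue_rigid[OF _ r(2), of _ x1 x3]) (use x1 x3 d Z2 in auto)
        then have "rigid_motion_on a (((({x1, x2, x3} \<union> {v, x1, x2}) \<union> Z1) \<union> Z2) \<union> Z3) u"
          by (rule glue_rigid[OF _ r(3), of _ x1 x2]) (use x1 x2 d Z3 in auto)
        then show ?thesis by (rule rigid_motion_subset) (auto simp: Z_def)
      qed
      have e3G: "e3 \<notin> G"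
        using T by (auto simp: G_def inside_def F0_def)
      have "insert e3 G = K"
      proof (rule ccontr)
        assume ne: "insert e3 G \<noteq> K"
        have "insert e3 G \<subseteq> K" using eK by (auto simp: G_def inside_def F0_def)
        then obtain g where "g \<in> K" "insert e3 G \<subseteq> K - {g}" using ne by blast
        then have "indep a (insert e3 G)" using indK independent_on_subset by blast
        then obtain u where u: "u \<in> motions a (insert e3 G - {e3})" "stretch a e3 u \<noteq> 0"
          unfolding independent_on_def by blast
        have "insert e3 G - {e3} = G" using e3G by simp
        then have uG: "u \<in> motions a G" using u(1) by simp
        then have "stretch a (v, x3) u = 0"
          using rigid_motion_stretch[OF rigidG] by (simp add: Z_def)
        moreover have "parallel (v, x3) e3" using parallel_sym[OF x3(3)] eP(3) pairs_sub by blast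
        then obtain c where "\<forall>u\<in>velocities V. stretch a e3 u = c * stretch a (v, x3) u"
          using stretch_parallel[OF conf, of "(v, x3)" e3] vV x3(1) by auto
        ultimately show False using u(2) uG by (simp add: motions_iff)
      qed
      then have KG: "K = insert e3 G" by simp
      have inZ: "\<exists>k. translate k e \<in> Z \<times> Z" if "e \<in> K" for e
      proof -
        have i: "\<exists>k. translate k e \<in> Z \<times> Z" if "e \<in> inside F0 Z'" "Z' \<subseteq> Z" for Z'
          using that unfolding inside_def by (auto simp: mem_Times_iff)
        have p: "\<exists>k. translate k e \<in> Z \<times> Z" if pe: "parallel e (v, z)" and z: "z \<in> Z" for z
        proof -
          obtain k where k: "(v, z) = translate k e \<or> (v, z) = prod.swap (translate k e)"
            using pe unfolding parallel_def by blast
          then have "translate k e = (v, z) \<or> translate k e = (z, v)" by (cases "translate k e") auto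
          moreover have "v \<in> Z" by (simp add: Z_def)
          ultimately show ?thesis using z by (intro exI[of _ k]) auto
        qed
        have sub: "Z1 \<subseteq> Z" "Z2 \<subseteq> Z" "Z3 \<subseteq> Z" "x1 \<in> Z" "x2 \<in> Z" "x3 \<in> Z" by (auto simp: Z_def)
        have "e \<in> inside F0 Z1 \<or> e \<in> inside F0 Z2 \<or> e \<in> inside F0 Z3 \<or> e = e1 \<or> e = e2 \<or> e = e3"
          using that unfolding KG G_def by blast
        then show ?thesis
        proof (elim disjE)
          assume "e \<in> inside F0 Z1" then show ?thesis by (rule i[OF _ sub(1)])
        next
          assume "e \<in> inside F0 Z2" then show ?thesis by (rule i[OF _ sub(2)])
        next
          assume "e \<in> inside F0 Z3" then show ?thesis by (rule i[OF _ sub(3)])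
        next
          assume "e = e1" then show ?thesis using p[OF _ sub(4)] x1(3) by simp
        next
          assume "e = e2" then show ?thesis using p[OF _ sub(5)] x2(3) by simp
        next
          assume "e = e3" then show ?thesis using p[OF _ sub(6)] x3(3) by simp
        qed
      qed
      have JZ: "J \<subseteq> inside F Z" using inZ J(1) unfolding inside_def K_def by blast
      have rZ: "rigid_motion_on a Z u" if "u \<in> motions a (inside F Z)" for u
      proof (rule rigidG)
        have "u \<in> motions a J" using that JZ solutions_antimono by blast
        then have "u \<in> motions a K" using MK by simp
        then show "u \<in> motions a G" using KG by (simp add: motions_iff)
      qed
      have "\<exists>k. translate k ?e \<in> Z \<times> Z" by (rule inZ) (simp add: K_def)
      then obtain k where k: "translate k ?e \<in> Z \<times> Z" by (rule exE)
      let ?Z = "(\<sigma> ^^ (2 * k)) ` Z"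
      have turn: "(\<sigma> ^^ (2 * k)) ((\<sigma> ^^ k) p) = p" if "p \<in> V" for p
      proof -
        have "(\<sigma> ^^ (2 * k)) ((\<sigma> ^^ k) p) = (\<sigma> ^^ (2 * k + k)) p" by (simp only: funpow_add comp_apply)
        also have "2 * k + k = 3 * k" by simp
        finally show ?thesis using sigma_power_3[OF that] by simp
      qed
      have "(\<sigma> ^^ k) x \<in> Z" "(\<sigma> ^^ k) y \<in> Z" using k by (auto simp: translate_def)
      then have "x \<in> ?Z" "y \<in> ?Z" using turn xyV by (metis image_eqI)+
      moreover have "?Z \<subseteq> V" using ZV sigma_power_in by blast
      moreover have "rigid_in (inside F ?Z) ?Z"
        unfolding rigid_in_def
      proof
        fix u assume u: "u \<in> motions a (inside F ?Z)"
        then have "u \<in> motions a (inside F Z)"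
          using inside_translate[OF ZV, of F "2 * k"] solutions_antimono by blast
        then have "rigid_motion_on a Z u" by (rule rZ)
        then show "rigid_motion_on a ?Z u"
          using u by (intro rigid_motion_translate[OF conf _ ZV]) (simp_all add: motions_iff)
      qed
      ultimately show ?thesis by blast
    qed
  qed
qed


section \<open>Blocks and the rank count\<close>

lemma two_elements: "2 \<le> card Z \<Longrightarrow> \<exists>x\<in>Z. \<exists>y\<in>Z. x \<noteq> y"
proof (rule ccontr)
  assume Z: "2 \<le> card Z" and no: "\<not> (\<exists>x\<in>Z. \<exists>y\<in>Z. x \<noteq> y)"
  have "finite Z" using Z card.infinite by force
  then have "card Z \<le> Suc 0" using no card_le_Suc0_iff_eq by blast
  then show False using Z by simp
qed

lemma pairwise_rigid:
  assumes Z: "Z \<subseteq> V" "2 \<le> card Z"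
    and 0: "\<And>p q. p \<in> Z \<Longrightarrow> q \<in> Z \<Longrightarrow> p \<noteq> q \<Longrightarrow> stretch a (p, q) u = 0"
  shows "rigid_motion_on a Z u"
proof -
  obtain p q where pq: "p \<in> Z" "q \<in> Z" "p \<noteq> q" using two_elements[OF Z(2)] by blast
  have "finite Z" using Z(1) finV finite_subset by blast
  moreover have "rigid_motion_on a ({p, q} \<union> Y) u" if "finite Y" "Y \<subseteq> Z" for Y
    using that
  proof (induction Y rule: finite_induct)
    case empty
    have "rigid_motion_on a {p, q} u"
      by (rule rigid_motion_pair[OF 0 a_inj]) (use pq Z(1) in auto)
    then show ?case by simp
  next
    case (insert z Y)
    then have IH: "rigid_motion_on a ({p, q} \<union> Y) u" "z \<in> Z" by auto
    show ?case
    proof (cases "z = p \<or> z = q")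
      case True
      then have "{p, q} \<union> insert z Y = {p, q} \<union> Y" by blast
      then show ?thesis using IH(1) by simp
    next
      case False
      have "rigid_motion_on a {p, q, z} u"
        by (rule triangle_rigid) (use pq IH(2) False 0 Z(1) in auto)
      then have "rigid_motion_on a (({p, q} \<union> Y) \<union> {p, q, z}) u"
        by (rule glue_rigid[OF IH(1), of _ p q]) (use pq Z(1) in auto)
      moreover have "({p, q} \<union> Y) \<union> {p, q, z} = {p, q} \<union> insert z Y" by blast
      ultimately show ?thesis by simp
    qed
  qed
  ultimately have "rigid_motion_on a ({p, q} \<union> Z) u" by blast
  then show ?thesis by (rule rigid_motion_subset) blast
qed

lemma indep_parallel:
  assumes F: "F \<subseteq> pairs" "indep a F" and ef: "e \<in> F" "f \<in> F" "parallel e f"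
  shows "e = f"
proof (rule ccontr)
  assume ne: "e \<noteq> f"
  obtain u where u: "u \<in> motions a (F - {f})" "stretch a f u \<noteq> 0"
    using F(2) ef(2) unfolding independent_on_def by blast
  have "e \<in> V \<times> V" using ef(1) F(1) pairs_sub by blast
  then obtain c where "\<forall>u\<in>velocities V. stretch a f u = c * stretch a e u"
    using stretch_parallel[OF conf ef(3)] by blast
  moreover have "stretch a e u = 0" using u(1) ef(1) ne by (simp add: motions_iff)
  ultimately show False using u by (simp add: motions_iff)
qed

text \<open>The edges of the whole graph that belong to a set of edges of the quotient.\<close>

definition translates :: "('v \<times> 'v) set \<Rightarrow> ('v \<times> 'v) set" where
  "translates F = (\<lambda>(k, e). translate k e) ` ({0, 1, 2} \<times> F)"

lemma translatesE: "e \<in> translates F \<Longrightarrow> \<exists>k f. k \<in> {0, 1, 2} \<and> f \<in> F \<and> e = translate k f"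
proof -
  assume "e \<in> translates F"
  then obtain g where g: "e = (\<lambda>(k, e). translate k e) g" "g \<in> {0, 1, 2} \<times> F"
    unfolding translates_def by (rule imageE)
  then have "fst g \<in> {0, 1, 2} \<and> snd g \<in> F \<and> e = translate (fst g) (snd g)"
    by (simp add: case_prod_beta mem_Times_iff)
  then show ?thesis by (intro exI)
qed

lemma translatesI: "k \<in> {0, 1, 2} \<Longrightarrow> f \<in> F \<Longrightarrow> translate k f \<in> translates F"
  unfolding translates_def by (rule image_eqI[of _ _ "(k, f)"]) simp_all

lemma translate_mem_translates:
  assumes "e \<in> F" "F \<subseteq> V \<times> V" shows "translate k e \<in> translates F"
proof -
  have eV: "e \<in> V \<times> V" using assms by blast
  have "translate k e = translate (k mod 3 + 3 * (k div 3)) e" by simp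
  also have "\<dots> = translate (k mod 3) (translate (3 * (k div 3)) e)" by (simp only: translate_add)
  also have "translate (3 * (k div 3)) e = e" using eV by (rule translate_3)
  finally have "translate k e = translate (k mod 3) e" .
  moreover have "k mod 3 \<in> {0, 1, 2}" by auto
  ultimately show ?thesis using assms(1) by (simp only: translatesI)
qed

lemma card_translates_le: "finite F \<Longrightarrow> card (translates F) \<le> 3 * card F"
proof -
  assume "finite F"
  then have "card (translates F) \<le> card ({0::nat, 1, 2} \<times> F)"
    unfolding translates_def by (intro card_image_le) simp
  then show ?thesis by (simp add: card_cartesian_product)
qed

lemma card_translates:
  assumes F: "F \<subseteq> pairs" "indep a F" shows "card (translates F) = 3 * card F"
proof -
  have "inj_on (\<lambda>(k, e). translate k e) ({0, 1, 2} \<times> F)"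
  proof (rule inj_onI)
    fix g h :: "nat \<times> 'v \<times> 'v"
    assume g: "g \<in> {0, 1, 2} \<times> F" and h: "h \<in> {0, 1, 2} \<times> F"
      and gh: "(\<lambda>(k, e). translate k e) g = (\<lambda>(k, e). translate k e) h"
    obtain k p q where g': "g = (k, p, q)" by (cases g) auto
    obtain l p' q' where h': "h = (l, p', q')" by (cases h) auto
    have kl: "k \<in> {0, 1, 2}" "l \<in> {0, 1, 2}" and e: "(p, q) \<in> F" and f: "(p', q') \<in> F"
      and eq: "translate k (p, q) = translate l (p', q')"
      using g h gh by (auto simp: g' h')
    have pV: "p \<in> V" using e F by (auto simp: pairs_def)
    have fV: "(p', q') \<in> V \<times> V" using f F(1) pairs_sub by blast
    have "parallel (p, q) (translate k (p, q))" "parallel (p', q') (translate l (p', q'))"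
      unfolding parallel_def by blast+
    then have "parallel (p, q) (p', q')"
      using eq parallel_trans parallel_sym[OF _ fV] by metis
    then have ef: "(p, q) = (p', q')" by (rule indep_parallel[OF F e f])
    then have "(\<sigma> ^^ k) p = (\<sigma> ^^ l) p" using eq by (simp add: translate_def)
    then have "k = l"
      using kl sigma_free[OF pV] sigma_distinct[OF pV] by (auto simp: numeral_2_eq_2)
    then show "g = h" using ef by (simp add: g' h')
  qed
  then have "card (translates F) = card ({0::nat, 1, 2} \<times> F)"
    unfolding translates_def by (rule card_image)
  then show ?thesis by (simp add: card_cartesian_product)
qed

text \<open>Two blocks share at most one vertex because two rigid sets with two common vertices have a rigid
  union. For the same reason a block that contains a vertex and its image contains the whole orbit and
  is invariant.\<close>

definition block :: "('v \<times> 'v) set \<Rightarrow> 'v set \<Rightarrow> bool" where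
  "block F Z \<longleftrightarrow> Z \<subseteq> V \<and> 2 \<le> card Z \<and> rigid_in F Z \<and>
     (\<forall>Y. Z \<subseteq> Y \<longrightarrow> Y \<subseteq> V \<longrightarrow> rigid_in F Y \<longrightarrow> Y = Z)"

lemma exists_block:
  assumes "Z \<subseteq> V" "2 \<le> card Z" "rigid_in F Z" shows "\<exists>Y. block F Y \<and> Z \<subseteq> Y"
proof -
  let ?P = "\<lambda>Y. Z \<subseteq> Y \<and> Y \<subseteq> V \<and> rigid_in F Y"
  have "?P Z" using assms by simp
  moreover have "\<forall>Y. ?P Y \<longrightarrow> card Y < card V + 1"
    using finV by (simp add: card_mono less_Suc_eq_le)
  ultimately obtain Y where Y: "?P Y" "\<And>Y'. ?P Y' \<Longrightarrow> card Y' \<le> card Y"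
    using ex_has_greatest_nat[of ?P Z card "card V + 1"] by blast
  have finY: "finite Y" using Y(1) finV finite_subset by blast
  have "Y' = Y" if "Y \<subseteq> Y'" "Y' \<subseteq> V" "rigid_in F Y'" for Y'
  proof -
    have "card Y' \<le> card Y" using Y that by (meson order_trans)
    moreover have "finite Y'" using that finV finite_subset by blast
    ultimately show ?thesis using that(1) card_seteq by blast
  qed
  moreover have "2 \<le> card Y" using assms(2) Y(1) finY card_mono order_trans by blast
  ultimately have "block F Y" using Y(1) unfolding block_def by blast
  then show ?thesis using Y(1) by blast
qed

lemma block_absorbs:
  assumes Z: "block F Z" and Y: "Y \<subseteq> V" "rigid_in F Y" and xy: "{x, y} \<subseteq> Z \<inter> Y" "x \<noteq> y"
  shows "Y \<subseteq> Z"
proof -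
  have "rigid_in F (Z \<union> Y)"
    unfolding rigid_in_def
  proof
    fix u assume u: "u \<in> motions a F"
    have "rigid_motion_on a Z u" "rigid_motion_on a Y u"
      using Z Y(2) u unfolding block_def rigid_in_def by blast+
    then show "rigid_motion_on a (Z \<union> Y) u"
      by (rule glue_rigid[OF _ _ xy(1) _ xy(2)]) (use xy(1) Y(1) in blast)
  qed
  then have "Z \<union> Y = Z" using Z Y(1) unfolding block_def by blast
  then show ?thesis by blast
qed

lemma rigid_in_translate:
  assumes "Z \<subseteq> V" "rigid_in F Z" shows "rigid_in F ((\<sigma> ^^ k) ` Z)"
  unfolding rigid_in_def
proof
  fix u assume u: "u \<in> motions a F"
  then have "u \<in> velocities V" "rigid_motion_on a Z u"
    using assms(2) by (simp_all add: motions_iff rigid_in_def)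
  then show "rigid_motion_on a ((\<sigma> ^^ k) ` Z) u"
    using assms(1) by (intro rigid_motion_translate[OF conf])
qed

lemma rigid_pair:
  assumes "x \<in> V" "y \<in> V" "x \<noteq> y" "\<And>u. u \<in> motions a F \<Longrightarrow> stretch a (x, y) u = 0"
  shows "rigid_in F {x, y}"
  unfolding rigid_in_def using rigid_motion_pair[OF assms(4) a_inj[OF assms(1-3)]] by blast

lemma block_invariant:
  assumes Z: "block F Z" and x: "x \<in> Z" "\<sigma> x \<in> Z" shows "invariant Z"
proof -
  have ZV: "Z \<subseteq> V" and r: "rigid_in F Z" using Z by (auto simp: block_def)
  have xV: "x \<in> V" using x ZV by blast
  have "rigid_in F ((\<sigma> ^^ 1) ` Z)" by (rule rigid_in_translate[OF ZV r])
  moreover have "rigid_in F (orb x)"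
    unfolding rigid_in_def
  proof
    fix u assume u: "u \<in> motions a F"
    then have uV: "u \<in> velocities V" by (simp add: motions_iff)
    have 1: "stretch a (x, \<sigma> x) u = 0"
      using rigid_motion_stretch r u x unfolding rigid_in_def by blast
    then have 2: "stretch a (\<sigma> x, \<sigma> (\<sigma> x)) u = 0"
      using stretch_sigma[OF conf uV xV sigma_in[OF xV]] by simp
    then have "stretch a (\<sigma> (\<sigma> x), \<sigma> (\<sigma> (\<sigma> x))) u = 0"
      using stretch_sigma[OF conf uV sigma_in[OF xV] sigma_in[OF sigma_in[OF xV]]] by simp
    then have "stretch a (prod.swap (x, \<sigma> (\<sigma> x))) u = 0" using sigma3[OF xV] by simp
    then have 3: "stretch a (x, \<sigma> (\<sigma> x)) u = 0" unfolding stretch_swap .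
    show "rigid_motion_on a (orb x) u"
      unfolding orb_def
      by (rule triangle_rigid[OF _ _ _ _ 1 3 2])
        (use xV sigma_in sigma_free[OF xV] sigma_distinct[OF xV] in auto)
  qed
  then have "orb x \<subseteq> Z"
    by (rule block_absorbs[OF Z orb_V[OF xV], of x "\<sigma> x"]) (use x sigma_free[OF xV] in \<open>auto simp: orb_def\<close>)
  then have "\<sigma> (\<sigma> x) \<in> Z" by (simp add: orb_def)
  ultimately have "(\<sigma> ^^ 1) ` Z \<subseteq> Z"
    by (intro block_absorbs[OF Z, of _ "\<sigma> x" "\<sigma> (\<sigma> x)"])
      (use x ZV sigma_in sigma_distinct[OF xV] in auto)
  then show ?thesis unfolding invariant_def using ZV by auto
qed

text \<open>Each pair in the block is fixed by some rigid set through its own edges, and by maximality this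
  set lies in the block.\<close>

lemma block_inside:
  assumes F: "F \<subseteq> pairs" and Z: "block F Z" shows "rigid_in (inside F Z) Z"
  unfolding rigid_in_def
proof
  fix u assume u: "u \<in> motions a (inside F Z)"
  have ZV: "Z \<subseteq> V" "2 \<le> card Z" and r: "rigid_in F Z" using Z by (auto simp: block_def)
  show "rigid_motion_on a Z u"
  proof (rule pairwise_rigid[OF ZV])
    fix p q assume pq: "p \<in> Z" "q \<in> Z" "p \<noteq> q"
    have "stretch a (p, q) w = 0" if "w \<in> motions a F" for w
      using rigid_motion_stretch r that pq unfolding rigid_in_def by blast
    moreover have "(p, q) \<in> pairs" using pq ZV by (auto simp: pairs_def)
    ultimately obtain Y where Y: "Y \<subseteq> V" "p \<in> Y" "q \<in> Y" "rigid_in (inside F Y) Y"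
      using local_rigidity[OF F, of p q] by blast
    have "rigid_in F Y" by (rule rigid_in_mono[OF Y(4)]) (auto simp: inside_def)
    then have "Y \<subseteq> Z" by (rule block_absorbs[OF Z Y(1), of p q]) (use pq Y in auto)
    then have "u \<in> motions a (inside F Y)"
      using u inside_mono[of Y Z F] solutions_antimono by blast
    then show "stretch a (p, q) u = 0"
      using Y rigid_motion_stretch unfolding rigid_in_def by blast
  qed
qed

text \<open>A block needs as many edges as a rigid framework on its vertices without symmetry. If it is disjoint
  from its rotated copies, the velocities of a character restrict to arbitrary velocities on it; if it is
  invariant, the count for one character is a third of the one without symmetry.\<close>

lemma block_edges:
  assumes F: "F \<subseteq> pairs" "indep a F" and Z: "block F Z"
  shows "2 * card Z \<le> card (translates F \<inter> Z \<times> Z) + 3"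
proof (rule ccontr)
  assume contra: "\<not> ?thesis"
  have ZV: "Z \<subseteq> V" and Z2: "2 \<le> card Z" using Z by (auto simp: block_def)
  have finZ: "finite Z" using ZV finV finite_subset by blast
  have FV: "F \<subseteq> V \<times> V" using F(1) pairs_sub by blast
  have finF: "finite F" using F(1) by (rule finite_sub_pairs)
  have finT: "finite (translates F)" using finF by (simp add: translates_def)
  have rig: "rigid_in (inside F Z) Z" by (rule block_inside[OF F(1) Z])
  have mot: "u \<in> motions a (inside F Z)"
    if u: "u \<in> velocities V" "\<forall>e\<in>translates F \<inter> Z \<times> Z. stretch a e u = 0" for u
    unfolding motions_iff
  proof (intro conjI ballI)
    show "u \<in> velocities V" by (rule u(1))
    fix e assume e: "e \<in> inside F Z"
    then obtain k where k: "e \<in> F" "translate k e \<in> Z \<times> Z" by (auto simp: inside_def mem_Times_iff)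
    have "translate k e \<in> translates F" by (rule translate_mem_translates[OF k(1) FV])
    then have "stretch a (translate k e) u = 0"
      by (intro bspec[OF u(2)] IntI k(2))
    then show "stretch a e u = 0"
      using stretch_translate[OF conf u(1), of e k] k(1) FV eta_nonzero by auto
  qed
  have lin: "linear_functional (tagged a i)" for i by (rule linear_tagged)
  show False
  proof (cases "invariant Z")
    case True
    have "Z \<noteq> {}" using Z2 by auto
    then obtain x where x: "x \<in> Z" by blast
    have xV: "x \<in> V" using x ZV by blast
    define B where "B = F \<inter> Z \<times> Z"
    have finB: "finite B" using finF by (simp add: B_def)
    have pw: "(\<sigma> ^^ k) y \<in> Z" if "y \<in> Z" for k y
    proof (induction k)
      case (Suc k)
      then have "\<sigma> ((\<sigma> ^^ k) y) \<in> Z" using True unfolding invariant_def by blast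
      then show ?case by simp
    qed (simp add: that)
    have tr: "translate k e \<in> Z \<times> Z" if "e \<in> Z \<times> Z" for k e
      using pw[of "fst e" k] pw[of "snd e" k] that unfolding translate_def mem_Times_iff by simp
    have "translates B \<subseteq> translates F \<inter> Z \<times> Z"
    proof
      fix e assume "e \<in> translates B"
      then obtain k f where f: "k \<in> {0, 1, 2}" "f \<in> B" "e = translate k f"
        using translatesE by blast
      have "f \<in> F" using f(2) by (simp add: B_def)
      then have "e \<in> translates F" unfolding f(3) by (rule translatesI[OF f(1)])
      moreover have "e \<in> Z \<times> Z" using f(2) unfolding f(3) B_def by (intro tr) blast
      ultimately show "e \<in> translates F \<inter> Z \<times> Z" by (rule IntI)
    qed
    then have "card (translates B) \<le> card (translates F \<inter> Z \<times> Z)"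
      using finT by (intro card_mono) auto
    moreover have "card (translates B) = 3 * card B"
      by (rule card_translates) (use F in \<open>auto simp: B_def intro: independent_on_subset\<close>)
    ultimately have small: "3 * (card B + 1) < 2 * card Z" using contra by simp
    let ?I = "insert (Inr (marked x)) (Inl ` B) :: (('v \<times> 'v) + ('v + 'v)) set"
    have "card ?I \<le> card B + 1"
      using finB by (simp add: card_insert_if card_image)
    note I1 = this
    have "i < c" if "i \<le> b + 1" "3 * (b + 1) < 2 * z" "3 * c = 2 * z" for i b c z :: nat
      using that by presburger
    from this[OF I1 small card_coordinates[OF True]]
    have "card ?I < card (Inl ` (R \<inter> Z) \<union> Inr ` (R \<inter> Z) :: ('v + 'v) set)" .
    note small' = this
    have "finite ?I" using finB by simp
    from solutions_nonzero[where f = "tagged a", OF subspace_velocities coordinates_velocities[OF True] lin this small']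
    obtain u where u: "u \<in> solutions (velocities Z) (tagged a) ?I" "u \<noteq> (\<lambda>_. 0)" by (rule bexE)
    have uZ: "u \<in> velocities Z" using u(1) by (simp add: solutions_def)
    then have uV: "u \<in> velocities V" using velocities_mono[OF ZV] by blast
    have 0: "u (marked x) = 0" "\<forall>e\<in>B. stretch a e u = 0"
      using u(1) by (simp_all add: solutions_def tagged_def)
    have "stretch a e u = 0" if e: "e \<in> translates F \<inter> Z \<times> Z" for e
    proof -
      have "e \<in> translates F" using e by (rule IntD1)
      then obtain k f where f: "f \<in> F" "e = translate k f" using translatesE by blast
      obtain p q where pq: "f = (p, q)" by fastforce
      have fV: "p \<in> V" "q \<in> V" using f(1) FV pq by auto
      have iff: "(\<sigma> ^^ k) y \<in> Z \<longleftrightarrow> y \<in> Z" if "y \<in> V" for y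
        using that by (induction k) (simp_all add: invariant_iff[OF True] sigma_power_in)
      have "f \<in> B" using e f fV iff by (auto simp: B_def pq translate_def)
      then show ?thesis using 0(2) stretch_translate[OF conf uV, of f k] f FV by auto
    qed
    then have "u \<in> motions a (inside F Z)" by (intro mot[OF uV]) blast
    then have "rigid_motion_on a Z u" using rig unfolding rigid_in_def by blast
    then have "u (Inl y) = 0 \<and> u (Inr y) = 0" if "y \<in> Z" for y
      using rigid_velocity_zero[OF conf uV _ xV x _ a_nonzero[OF xV] 0(1) that] x True
      unfolding invariant_def by blast
    moreover have "u (Inl y) = 0 \<and> u (Inr y) = 0" if "y \<notin> Z" for y
      using uZ that by (simp add: velocities_def)
    ultimately have "u k = 0" for k by (cases k) blast+
    then have "u = (\<lambda>_. 0)" by (rule ext)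
    then show False using u(2) by simp
  next
    case False
    have no: "\<sigma> x \<notin> Z" if "x \<in> Z" for x using block_invariant[OF Z that] False by blast
    have no2: "\<sigma> (\<sigma> x) \<notin> Z" if "x \<in> Z" for x
      using no[of "\<sigma> (\<sigma> x)"] that sigma3 ZV by auto
    obtain x y where xy: "x \<in> Z" "y \<in> Z" "x \<noteq> y" using two_elements[OF Z2] by blast
    define U where "U = (\<Union>x\<in>Z. orb x)"
    have invU: "invariant U"
      unfolding invariant_def
    proof (intro conjI ballI)
      show "U \<subseteq> V" using orb_V ZV by (auto simp: U_def)
      fix z assume "z \<in> U"
      then obtain x where "x \<in> Z" "z \<in> orb x" by (auto simp: U_def)
      then have "\<sigma> z \<in> orb x" using orb_sub_invariant ZV unfolding invariant_def by blast
      then show "\<sigma> z \<in> U" using \<open>x \<in> Z\<close> by (auto simp: U_def)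
    qed
    have "card U = (\<Sum>x\<in>Z. card (orb x))"
      unfolding U_def
    proof (rule card_UN_disjoint[OF finZ])
      show "\<forall>x\<in>Z. finite (orb x)" by (simp add: orb_def)
      show "\<forall>p\<in>Z. \<forall>q\<in>Z. p \<noteq> q \<longrightarrow> orb p \<inter> orb q = {}"
      proof (intro ballI impI, rule ccontr)
        fix p q assume pq: "p \<in> Z" "q \<in> Z" "p \<noteq> q" "orb p \<inter> orb q \<noteq> {}"
        then have "orb p = orb q" using orb_eq ZV by blast
        then have "q \<in> orb p" using mem_orb by simp
        then show False using pq no no2 by (auto simp: orb_def)
      qed
    qed
    also have "\<dots> = (\<Sum>x\<in>Z. 3)" by (rule sum.cong) (use card_orb ZV in auto)
    finally have cU: "card U = 3 * card Z" by simp
    let ?T = "translates F \<inter> Z \<times> Z"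
    let ?I = "Inl ` ?T \<union> {Inr (Inl x), Inr (Inr x), Inr (Inl y)} :: (('v \<times> 'v) + ('v + 'v)) set"
    have finI: "finite ?I" using finT by simp
    have "card ?I \<le> card (Inl ` ?T :: (('v \<times> 'v) + ('v + 'v)) set) +
        card {Inr (Inl x), Inr (Inr x), Inr (Inl y) :: ('v \<times> 'v) + ('v + 'v)}"
      by (rule card_Un_le)
    also have "\<dots> \<le> card ?T + 3"
      by (intro add_mono card_image_le card_insert_le_m1) (use finT in \<open>auto simp: card_insert_if\<close>)
    finally have I3: "card ?I \<le> card ?T + 3" .
    have "i < c" if "i \<le> b + 3" "\<not> 2 * z \<le> b + 3" "3 * c = 2 * w" "w = 3 * z" for i b c w z :: nat
      using that by presburger
    from this[OF I3 contra card_coordinates[OF invU] cU]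
    have "card ?I < card (Inl ` (R \<inter> U) \<union> Inr ` (R \<inter> U) :: ('v + 'v) set)" .
    from solutions_nonzero[where f = "tagged a", OF subspace_velocities coordinates_velocities[OF invU] lin finI this]
    obtain u where u: "u \<in> solutions (velocities U) (tagged a) ?I" "u \<noteq> (\<lambda>_. 0)" by (rule bexE)
    have uU: "u \<in> velocities U" using u(1) by (simp add: solutions_def)
    then have uV: "u \<in> velocities V" using velocities_mono invU unfolding invariant_def by blast
    have 0: "u (Inl x) = 0" "u (Inr x) = 0" "u (Inl y) = 0" "\<forall>e\<in>?T. stretch a e u = 0"
      using u(1) by (simp_all add: solutions_def tagged_def)
    have "u \<in> motions a (inside F Z)" by (rule mot[OF uV 0(4)])
    then have "rigid_motion_on a Z u" using rig unfolding rigid_in_def by blast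
    then obtain c s t where r: "\<forall>x\<in>Z. u (Inl x) = c * a x + s \<and> u (Inr x) = - c * cnj (a x) + t"
      unfolding rigid_motion_on_def by blast
    have e: "c * a x + s = 0" "- c * cnj (a x) + t = 0" "c * a y + s = 0"
      using bspec[OF r xy(1)] bspec[OF r xy(2)] 0(1-3) by simp_all
    have "c * (a x - a y) = (c * a x + s) - (c * a y + s)" by (simp add: algebra_simps)
    then have "c * (a x - a y) = 0" unfolding e by simp
    moreover have "a x \<noteq> a y" using a_inj[of x y] xy ZV by blast
    ultimately have c0: "c = 0" by simp
    then have "s = 0" "t = 0" using e by simp_all
    note c0 = c0 this
    then have uZ: "u (Inl z) = 0 \<and> u (Inr z) = 0" if "z \<in> Z" for z using bspec[OF r that] c0 by simp
    have "u (Inl z) = 0 \<and> u (Inr z) = 0" for z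
    proof (cases "z \<in> U")
      case True
      then obtain w where w: "w \<in> Z" "z \<in> orb w" by (auto simp: U_def)
      then have "w \<in> V" using ZV by blast
      then show ?thesis using w(2) uZ[OF w(1)] velocitiesD[OF uV] sigma_in by (auto simp: orb_def)
    next
      case False
      then show ?thesis using uU by (simp add: velocities_def)
    qed
    then have "u k = 0" for k by (cases k) blast+
    then have "u = (\<lambda>_. 0)" by (rule ext)
    then show False using u(2) by simp
  qed
qed

text \<open>An independent \<open>F\<close> with the same motions as the graph has at most \<open>2 n - 1\<close> elements, where \<open>n\<close> is
  the number of vertex orbits, because the rigid velocities of one character form a line. Its translates
  number three times as many, and each of them lies in exactly one block. The blocks need too many edges
  for this by the count for mixed-connected graphs, unless the whole vertex set is a block.\<close>

theorem mixed_connected_imp_rigid: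
  assumes G: "finite_simple_graph V E" and conn: "mixed_connected 6 V E"
  shows "rigid_in {e \<in> pairs. {fst e, snd e} \<in> E} V"
proof (cases "V = {}")
  case True
  have "rigid_motion_on a Z u" if "Z = {}" for Z u
    using that by (simp add: rigid_motion_on_def)
  then show ?thesis unfolding rigid_in_def using True by blast
next
  case False
  then obtain v where v: "v \<in> V" by blast
  define P where "P = {e \<in> pairs. {fst e, snd e} \<in> E}"
  have PP: "P \<subseteq> pairs" by (auto simp: P_def)
  obtain F where F: "F \<subseteq> P" "indep a F" "motions a F = motions a P"
    using exists_independent_basis[where f = "stretch a", OF subspace_velocities[of V] linear_stretch finite_sub_pairs[OF PP]]
    by (elim exE conjE) (rule that)
  have FP: "F \<subseteq> pairs" using F(1) PP by blast
  have FV: "F \<subseteq> V \<times> V" using FP pairs_sub by blast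
  have finF: "finite F" using FP by (rule finite_sub_pairs)
  show ?thesis
  proof (rule ccontr)
    assume "\<not> ?thesis"
    then have nV: "\<not> rigid_in F V" using F(3) by (simp add: rigid_in_def P_def)
    define \<B> where "\<B> = {Z. block F Z}"
    have subV: "Z \<subset> V \<and> 2 \<le> card Z" if "Z \<in> \<B>" for Z
      using that nV unfolding \<B>_def block_def by auto
    have finB: "finite \<B>" by (rule finite_subset[of _ "Pow V"]) (use subV finV in auto)
    have meet: "Z = Y" if "Z \<in> \<B>" "Y \<in> \<B>" "{x, y} \<subseteq> Z \<inter> Y" "x \<noteq> y" for Z Y x y
    proof
      show "Y \<subseteq> Z" by (rule block_absorbs[of F Z Y x y]) (use that in \<open>auto simp: \<B>_def block_def\<close>)
      show "Z \<subseteq> Y" by (rule block_absorbs[of F Y Z x y]) (use that in \<open>auto simp: \<B>_def block_def\<close>)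
    qed
    have in_block: "\<exists>Z\<in>\<B>. {x, y} \<subseteq> Z"
      if "(x, y) \<in> pairs" "\<And>u. u \<in> motions a F \<Longrightarrow> stretch a (x, y) u = 0" for x y
    proof -
      have xy: "x \<in> V" "y \<in> V" "x \<noteq> y" using that(1) by (auto simp: pairs_def)
      have "rigid_in F {x, y}" by (rule rigid_pair[OF xy that(2)])
      then show ?thesis using exists_block[of "{x, y}" F] xy by (auto simp: \<B>_def)
    qed
    have cov: "\<exists>Z\<in>\<B>. e \<subseteq> Z" if e: "e \<in> E" for e
    proof -
      obtain x y where xy: "x \<in> V" "y \<in> V" "x \<noteq> y" "e = {x, y}"
        using G e unfolding finite_simple_graph_def by blast
      then have "(x, y) \<in> P" using e by (simp add: P_def pairs_def)
      then have "stretch a (x, y) u = 0" if "u \<in> motions a F" for u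
        using that F(3) by (simp add: motions_iff)
      then show ?thesis using in_block[of x y] xy by (simp add: pairs_def)
    qed
    have "2 \<le> card V"
    proof -
      have "card {v, \<sigma> v} \<le> card V" using v sigma_in finV by (intro card_mono) auto
      then show ?thesis using sigma_free[OF v] by simp
    qed
    then have 1: "2 * card V + 3 * card \<B> \<le> 2 * (\<Sum>Z\<in>\<B>. card Z)"
      by (rule mixed_connected_cover[OF G conn _ subV meet cov])
    let ?T = "translates F"
    have finT: "finite ?T" using finF by (simp add: translates_def)
    have "?T = (\<Union>Z\<in>\<B>. ?T \<inter> Z \<times> Z)"
    proof
      show "?T \<subseteq> (\<Union>Z\<in>\<B>. ?T \<inter> Z \<times> Z)"
      proof
        fix e assume e: "e \<in> ?T"
        then obtain k f where f: "f \<in> F" "e = translate k f" using translatesE by blast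
        obtain x y where xy: "e = (x, y)" by fastforce
        have "e \<in> pairs" using translate_pairs[of f k] f FP by blast
        moreover have "stretch a e u = 0" if "u \<in> motions a F" for u
          using that f stretch_translate[OF conf, of u f k] FV by (auto simp: motions_iff)
        ultimately obtain Z where "Z \<in> \<B>" "{x, y} \<subseteq> Z" using in_block[of x y] xy by blast
        then show "e \<in> (\<Union>Z\<in>\<B>. ?T \<inter> Z \<times> Z)" using e xy by blast
      qed
    qed blast
    then have "card ?T = card (\<Union>Z\<in>\<B>. ?T \<inter> Z \<times> Z)" by simp
    also have "\<dots> = (\<Sum>Z\<in>\<B>. card (?T \<inter> Z \<times> Z))"
    proof (rule card_UN_disjoint[OF finB])
      show "\<forall>Z\<in>\<B>. finite (?T \<inter> Z \<times> Z)" using finT by simp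
      show "\<forall>Z\<in>\<B>. \<forall>Y\<in>\<B>. Z \<noteq> Y \<longrightarrow> ?T \<inter> Z \<times> Z \<inter> (?T \<inter> Y \<times> Y) = {}"
      proof (intro ballI impI, rule ccontr)
        fix Z Y assume ZY: "Z \<in> \<B>" "Y \<in> \<B>" "Z \<noteq> Y" "?T \<inter> Z \<times> Z \<inter> (?T \<inter> Y \<times> Y) \<noteq> {}"
        then obtain x y where xy: "(x, y) \<in> ?T" "{x, y} \<subseteq> Z \<inter> Y" by blast
        obtain k f where "f \<in> F" "(x, y) = translate k f" using translatesE[OF xy(1)] by blast
        then have "(x, y) \<in> pairs" using translate_pairs[of f k] FP by auto
        then have "x \<noteq> y" by (simp add: pairs_def)
        then show False using meet[OF ZY(1,2) xy(2)] ZY(3) by blast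
      qed
    qed
    finally have cT: "card ?T = (\<Sum>Z\<in>\<B>. card (?T \<inter> Z \<times> Z))" .
    have "(\<Sum>Z\<in>\<B>. 2 * card Z) \<le> (\<Sum>Z\<in>\<B>. card (?T \<inter> Z \<times> Z) + 3)"
      by (rule sum_mono) (use block_edges[OF FP F(2)] in \<open>simp add: \<B>_def\<close>)
    then have "2 * (\<Sum>Z\<in>\<B>. card Z) \<le> card ?T + 3 * card \<B>"
      unfolding cT by (simp add: sum_distrib_left sum.distrib)
    moreover have "card ?T \<le> 3 * card F" using finF by (rule card_translates_le)
    moreover have "3 * card F + 3 \<le> 2 * card V"
      by (rule indep_card[OF conf a_nonzero invariant_V v FV finF F(2)])
    ultimately show False using 1 by linarith
  qed
qed

end

section \<open>Generic configurations\<close>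

context threefold_action
begin

text \<open>Real coordinates at the representatives determine a symmetric configuration.\<close>

definition placed :: "('v \<times> 2 \<Rightarrow> real) \<Rightarrow> 'v \<Rightarrow> complex" where
  "placed x v = \<omega> ^ phase v * Complex (x (rep v, 1)) (x (rep v, 2))"

lemma configuration_placed: "configuration (placed x)"
  unfolding configuration_def placed_def
  using power_phase_sigma[OF _ omega3] rep_sigma by simp

lemma configuration_phase:
  assumes b: "configuration b" and v: "v \<in> V" shows "b v = \<omega> ^ phase v * b (rep v)"
proof -
  have "b ((\<sigma> ^^ k) r) = \<omega> ^ k * b r" if "r \<in> V" for k r
    using that by (induction k) (simp_all add: configurationD[OF b] sigma_power_in)
  from this[OF rep_V[OF v], of "phase v"] show ?thesis using rep_phase[OF v] by simp
qed

lemma velocities_phase: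
  assumes u: "u \<in> velocities U" and v: "v \<in> V"
  shows "u (Inl v) = (\<eta> * \<omega>) ^ phase v * u (Inl (rep v))"
    "u (Inr v) = (\<eta> * (\<omega> * \<omega>)) ^ phase v * u (Inr (rep v))"
proof -
  have "u (Inl ((\<sigma> ^^ k) r)) = (\<eta> * \<omega>) ^ k * u (Inl r)"
    "u (Inr ((\<sigma> ^^ k) r)) = (\<eta> * (\<omega> * \<omega>)) ^ k * u (Inr r)" if "r \<in> V" for k r
    using that by (induction k) (simp_all add: velocitiesD[OF u] sigma_power_in)
  from this[OF rep_V[OF v], of "phase v"]
  show "u (Inl v) = (\<eta> * \<omega>) ^ phase v * u (Inl (rep v))"
    "u (Inr v) = (\<eta> * (\<omega> * \<omega>)) ^ phase v * u (Inr (rep v))"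
    using rep_phase[OF v] by simp_all
qed

lemma omega_powers_distinct:
  assumes "\<omega> ^ k = \<omega> ^ l" "k < 3" "l < 3" shows "k = l"
proof -
  have w2: "\<omega> * \<omega> \<noteq> 1" using omega3 omega(2) by force
  have "\<omega> \<noteq> 0" using omega(1) by auto
  then have w3: "\<omega> * \<omega> \<noteq> \<omega>" using omega(2) by simp
  have "k \<in> {0, 1, 2}" "l \<in> {0, 1, 2}" using assms by auto
  then show ?thesis using assms(1) omega(2) w2 w3 w2[symmetric] w3[symmetric] omega(2)[symmetric]
    by (auto simp: power2_eq_square)
qed

text \<open>Unit vectors with distinct cubes at the representatives give a configuration of distinct points of
  the unit circle, no three of which are collinear.\<close>

lemma exists_circle_configuration:
  "\<exists>b. configuration b \<and> inj_on b V \<and> (\<forall>v\<in>V. cmod (b v) = 1)"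
proof -
  have finR: "finite R" using RV finV finite_subset by blast
  obtain n :: "'v \<Rightarrow> nat" where n: "inj_on n R" using finite_imp_inj_to_nat_seg[OF finR] by blast
  define t where "t r = 1 / (real (n r) + 1)" for r
  have t: "0 < t r" "t r \<le> 1" for r by (simp_all add: t_def field_simps)
  define b where "b v = \<omega> ^ phase v * cis (t (rep v))" for v
  have "configuration b"
    unfolding configuration_def b_def
    using power_phase_sigma[OF _ omega3] rep_sigma by simp
  moreover have "cmod (b v) = 1" for v by (simp add: b_def norm_mult norm_power cmod_omega)
  moreover have "inj_on b V"
  proof (rule inj_onI)
    fix v w assume v: "v \<in> V" and w: "w \<in> V" and vw: "b v = b w"
    have cube: "b v ^ 3 = cis (3 * t (rep v))" for v
    proof -
      have "(\<omega> ^ phase v) ^ 3 = (\<omega> ^ 3) ^ phase v" by (simp only: power_mult[symmetric] mult.commute)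
      then show ?thesis unfolding b_def power_mult_distrib using omega(1) Complex.DeMoivre[of "t (rep v)" 3] by simp
    qed
    have "cis (3 * t (rep v)) = cis (3 * t (rep w))" using vw cube by metis
    then have "cos (3 * t (rep v)) = cos (3 * t (rep w))" by (metis cis.simps(1))
    moreover have "0 \<le> 3 * t (rep v)" "3 * t (rep v) \<le> pi" "0 \<le> 3 * t (rep w)" "3 * t (rep w) \<le> pi"
      using t[of "rep v"] t[of "rep w"] pi_gt3 by simp_all
    ultimately have "3 * t (rep v) = 3 * t (rep w)" by (rule_tac cos_inj_pi)
    then have "n (rep v) = n (rep w)" by (simp add: t_def)
    then have r: "rep v = rep w" using n rep(1)[OF v] rep(1)[OF w] by (simp add: inj_on_def)
    then have "\<omega> ^ phase v = \<omega> ^ phase w" using vw by (simp add: b_def)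
    then have "phase v = phase w" by (rule omega_powers_distinct) (simp_all add: phase_def)
    then show "v = w" using rep_phase[OF v] rep_phase[OF w] r by metis
  qed
  ultimately show ?thesis by blast
qed

definition entries_in :: "real set \<Rightarrow> complex \<Rightarrow> bool" where
  "entries_in K z \<longleftrightarrow> Re z \<in> K \<and> Im z \<in> K"

lemma entries_in_mult:
  assumes K: "real_subring K" and zw: "entries_in K z" "entries_in K w" shows "entries_in K (z * w)"
proof -
  have "x + - 1 * y \<in> K" if "x \<in> K" "y \<in> K" for x y using K that unfolding real_subring_def by blast
  then have "x - y \<in> K" if "x \<in> K" "y \<in> K" for x y using that by simp
  then show ?thesis using K zw unfolding real_subring_def entries_in_def by simp
qed

lemma entries_in_power:
  assumes K: "real_subring K" and z: "entries_in K z" shows "entries_in K (z ^ k)"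
proof (induction k)
  case 0
  then show ?case using K by (simp add: entries_in_def real_subring_def)
next
  case (Suc k)
  then show ?case using entries_in_mult[OF K z] by simp
qed

text \<open>The rows of the stretches in the dual basis of the velocities are polynomial in the coordinates, with
  coefficients from the field that contains the entries of the rotations. So elimination at any
  configuration provides a polynomial that certifies independence, and the collinearity determinant
  is polynomial as well.\<close>

lemma generic_threefoldI:
  assumes K: "real_subring K" "entries_in K \<omega>" "entries_in K \<eta>"
    and alg: "algebraically_independent_over K (R \<times> UNIV) x"
    and a: "\<And>v. v \<in> V \<Longrightarrow> a v = placed x v"
  shows "generic_threefold V \<sigma> R \<omega> \<eta> a"
proof
  let ?A = "complex_polys K (R \<times> (UNIV :: 2 set))"
  note m = complex_polys_mult[OF K(1)] complex_polys_add[OF K(1)] complex_polys_diff[OF K(1)] complex_polys_cnj[OF K(1)]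
  have const: "(\<lambda>x. z) \<in> ?A" if "entries_in K z" for z
    using that unfolding entries_in_def by (intro complex_polys_const) auto
  have poly: "(\<lambda>x. placed x v) \<in> ?A" if v: "v \<in> V" for v
  proof -
    have "(\<lambda>x. Complex (x (rep v, 1)) (x (rep v, 2))) \<in> ?A"
      by (rule complex_polysI[OF real_polys_var real_polys_var])
        (use K(1) rep(1)[OF v] in \<open>simp_all add: real_subring_def\<close>)
    then show ?thesis unfolding placed_def by (intro m const entries_in_power K(1,2))
  qed
  show conf: "configuration a"
    unfolding configuration_def
    using a sigma_in configurationD[OF configuration_placed] by simp
  define coords where "coords b = (\<lambda>(r, k :: 2). if k = 1 then Re (b r) else Im (b r))" for b :: "'v \<Rightarrow> complex"
  have two: "(2 :: 2) \<noteq> 1" by simp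
  have coords: "placed (coords b) v = b v" if "configuration b" "v \<in> V" for b v
    using configuration_phase[OF that] two by (simp add: placed_def coords_def)
  have cong: "indep b F \<longleftrightarrow> indep c F"
    if "F \<subseteq> pairs" "\<And>v. v \<in> V \<Longrightarrow> b v = c v" for b c F
  proof (rule indep_cong)
    fix e assume "e \<in> F"
    then have "fst e \<in> V" "snd e \<in> V" using that(1) by (auto simp: pairs_def)
    then show "stretch b e = stretch c e" using that(2) by (simp add: stretch_def fun_eq_iff)
  qed
  show "indep a F" if F: "F \<subseteq> pairs" and b: "configuration b" "indep b F" for F b
  proof -
    let ?C = "Inl ` (R \<inter> V) \<union> Inr ` (R \<inter> V) :: ('v + 'v) set"
    have C: "coordinates_of (velocities V) ?C" by (rule coordinates_velocities[OF invariant_V])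
    then have finC: "finite ?C" unfolding coordinates_of_def by blast
    obtain B where B: "\<forall>c\<in>?C. B c \<in> velocities V" "\<forall>c\<in>?C. \<forall>d\<in>?C. B c d = (if d = c then 1 else 0)"
      "\<forall>u\<in>velocities V. u = (\<lambda>k. \<Sum>c\<in>?C. u c * B c k)"
      using coordinate_basis[OF subspace_velocities C] by (elim exE conjE) (rule that)
    have finF: "finite F" using F by (rule finite_sub_pairs)
    have rows: "indep (placed y) F \<longleftrightarrow>
        (\<forall>l. (\<forall>c\<in>?C. (\<Sum>e\<in>F. l e * stretch (placed y) e (B c)) = 0) \<longrightarrow> (\<forall>e\<in>F. l e = 0))" for y
      using subspace_velocities linear_stretch finF finC B(1,3)[rule_format] by (rule independent_on_iff_rows)
    have entry: "entries_in K (B c (Inl v))" "entries_in K (B c (Inr v))" if c: "c \<in> ?C" and v: "v \<in> V" for c v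
    proof -
      have "Inl (rep v) \<in> ?C" "Inr (rep v) \<in> ?C" using rep(1)[OF v] RV by auto
      then have "B c (Inl (rep v)) = (if Inl (rep v) = c then 1 else 0)"
        "B c (Inr (rep v)) = (if Inr (rep v) = c then 1 else 0)"
        using B(2) c by blast+
      then have "entries_in K (B c (Inl (rep v)))" "entries_in K (B c (Inr (rep v)))"
        using K(1) by (simp_all add: entries_in_def real_subring_def)
      moreover have "B c \<in> velocities V" using B(1) c by blast
      ultimately show "entries_in K (B c (Inl v))" "entries_in K (B c (Inr v))"
        unfolding velocities_phase[OF \<open>B c \<in> velocities V\<close> v]
        by (simp_all add: entries_in_mult[OF K(1)] entries_in_power[OF K(1)] K(2,3))
    qed
    have "(\<lambda>x. stretch (placed x) e (B c)) \<in> ?A" if e: "e \<in> F" and c: "c \<in> ?C" for e c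
    proof -
      have V: "fst e \<in> V" "snd e \<in> V" using e F by (auto simp: pairs_def)
      show ?thesis unfolding stretch_def by (intro m poly V const entry[OF c])
    qed
    moreover have "indep (placed (coords b)) F"
      using cong[OF F coords[OF b(1)]] b(2) by simp
    then have "\<forall>e\<in>F. l e = 0" if "\<forall>c\<in>?C. (\<Sum>e\<in>F. l e * stretch (placed (coords b)) e (B c)) = 0" for l
      using that unfolding rows by blast
    moreover have "(\<lambda>_. 1) \<in> ?A" by (rule const) (use K(1) in \<open>simp add: entries_in_def real_subring_def\<close>)
    ultimately have "\<exists>f\<in>?A. f (coords b) \<noteq> 0 \<and> (\<forall>x. f x \<noteq> 0 \<longrightarrow>
        (\<forall>l. (\<forall>c\<in>?C. (\<Sum>e\<in>F. l e * stretch (placed x) e (B c)) = 0) \<longrightarrow> (\<forall>e\<in>F. l e = 0)))"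
      by (intro independent_rows_open[OF finF _ complex_polys_mult[OF K(1)] complex_polys_diff[OF K(1)]])
    then obtain f where f: "f \<in> ?A" "f (coords b) \<noteq> 0" "\<forall>x. f x \<noteq> 0 \<longrightarrow>
        (\<forall>l. (\<forall>c\<in>?C. (\<Sum>e\<in>F. l e * stretch (placed x) e (B c)) = 0) \<longrightarrow> (\<forall>e\<in>F. l e = 0))"
      by (elim bexE conjE) (rule that)
    have "f x \<noteq> 0" by (rule complex_polys_generic[OF alg f(1,2)])
    from mp[OF spec[OF f(3), of x] this] have "indep (placed x) F" unfolding rows .
    then show ?thesis using cong[OF F a] by simp
  qed
  show "noncollinear a p q r" if V: "{p, q, r} \<subseteq> V" and d: "p \<noteq> q" "p \<noteq> r" "q \<noteq> r" for p q r
  proof -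
    let ?f = "\<lambda>x. cnj (placed x r - placed x p) * (placed x r - placed x q) -
      (placed x r - placed x p) * cnj (placed x r - placed x q)"
    have pqr: "p \<in> V" "q \<in> V" "r \<in> V" using V by auto
    have "?f \<in> ?A" by (intro m poly pqr)
    obtain b where b: "configuration b" "inj_on b V" "\<forall>v\<in>V. cmod (b v) = 1"
      using exists_circle_configuration by blast
    have "b p \<noteq> b q" "b p \<noteq> b r" "b q \<noteq> b r" using b(2) pqr d by (auto simp: inj_on_def)
    then have "cnj (b r - b p) * (b r - b q) \<noteq> (b r - b p) * cnj (b r - b q)"
      using b(3) pqr by (intro unit_circle_general_position) auto
    then have "?f (coords b) \<noteq> 0" unfolding coords[OF b(1) pqr(1)] coords[OF b(1) pqr(2)] coords[OF b(1) pqr(3)] right_minus_eq .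
    then have "?f x \<noteq> 0" by (rule complex_polys_generic[OF alg \<open>?f \<in> ?A\<close>])
    then show ?thesis unfolding noncollinear_def a[OF pqr(1)] a[OF pqr(2)] a[OF pqr(3)] right_minus_eq .
  qed
qed

end

text \<open>Averaging a motion over the group with the weights of a character projects it to the velocities of
  that character. The stretch of an edge under the projection is a combination of the stretches of its
  translates under the motion, and these vanish.\<close>

lemma (in generic_threefold) component_rigid:
  assumes sym: "\<And>x y. x \<in> V \<Longrightarrow> y \<in> V \<Longrightarrow> {x, y} \<in> E \<Longrightarrow> {\<sigma> x, \<sigma> y} \<in> E"
    and mot: "\<And>x y. x \<in> V \<Longrightarrow> y \<in> V \<Longrightarrow> {x, y} \<in> E \<Longrightarrow>
      cnj (a x - a y) * (f x - f y) + (a x - a y) * (g x - g y) = 0"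
    and rigid: "rigid_in {e \<in> pairs. {fst e, snd e} \<in> E} V"
  shows "\<exists>c s t. \<forall>v\<in>V.
    f v + (\<eta> * \<omega>) * (\<eta> * \<omega>) * f (\<sigma> v) + \<eta> * \<omega> * f (\<sigma> (\<sigma> v)) = c * a v + s \<and>
    g v + (\<eta> * (\<omega> * \<omega>)) * (\<eta> * (\<omega> * \<omega>)) * g (\<sigma> v) + \<eta> * (\<omega> * \<omega>) * g (\<sigma> (\<sigma> v)) = - c * cnj (a v) + t"
proof -
  define h :: "complex \<Rightarrow> ('v \<Rightarrow> complex) \<Rightarrow> 'v \<Rightarrow> complex" where
    "h z f v = (if v \<in> V then f v + z * z * f (\<sigma> v) + z * f (\<sigma> (\<sigma> v)) else 0)" for z f v
  define u where "u = case_sum (h (\<eta> * \<omega>) f) (h (\<eta> * (\<omega> * \<omega>)) g)"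
  have hs: "h z f (\<sigma> v) = z * h z f v" if "v \<in> V" "z * z * z = 1" for z f v
  proof -
    have "z * h z f v = z * f v + (z * z * z) * f (\<sigma> v) + z * z * f (\<sigma> (\<sigma> v))"
      using that(1) by (simp add: h_def algebra_simps)
    then show ?thesis using that by (simp add: h_def sigma_in sigma3)
  qed
  have uV: "u \<in> velocities V"
    unfolding velocities_def mem_Collect_eq
  proof (intro conjI ballI allI impI)
    fix v assume v: "v \<in> V"
    show "u (Inl (\<sigma> v)) = \<eta> * \<omega> * u (Inl v)" using hs[OF v character_cubes(1)] by (simp add: u_def)
    show "u (Inr (\<sigma> v)) = \<eta> * (\<omega> * \<omega>) * u (Inr v)" using hs[OF v character_cubes(2)] by (simp add: u_def)
  qed (simp_all add: u_def h_def)
  have "stretch a e u = 0" if e: "e \<in> pairs" "{fst e, snd e} \<in> E" for e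
  proof -
    obtain x y where xy: "e = (x, y)" by fastforce
    have V: "x \<in> V" "y \<in> V" and E: "{x, y} \<in> E" using e by (auto simp: xy pairs_def)
    let ?D = "\<lambda>x y. cnj (a x - a y) * (f x - f y) + (a x - a y) * (g x - g y)"
    have E1: "{\<sigma> x, \<sigma> y} \<in> E" by (rule sym[OF V E])
    have E2: "{\<sigma> (\<sigma> x), \<sigma> (\<sigma> y)} \<in> E" by (rule sym[OF sigma_in[OF V(1)] sigma_in[OF V(2)] E1])
    have D0: "?D x y = 0" by (rule mot[OF V E])
    have D1: "?D (\<sigma> x) (\<sigma> y) = 0" by (rule mot[OF sigma_in[OF V(1)] sigma_in[OF V(2)] E1])
    have D2: "?D (\<sigma> (\<sigma> x)) (\<sigma> (\<sigma> y)) = 0"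
      by (rule mot[OF sigma_in[OF sigma_in[OF V(1)]] sigma_in[OF sigma_in[OF V(2)]] E2])
    define d where "d = a x - a y"
    have d1: "a (\<sigma> x) - a (\<sigma> y) = \<omega> * d" "a (\<sigma> (\<sigma> x)) - a (\<sigma> (\<sigma> y)) = \<omega> * (\<omega> * d)"
      using V by (simp_all add: configurationD[OF conf] sigma_in d_def algebra_simps)
    have 4: "\<omega> * (\<omega> * (\<omega> * z)) = z" for z using omega3 by (simp add: mult.assoc[symmetric])
    define f1 f2 g1 g2 where "f1 = f (\<sigma> x) - f (\<sigma> y)" and "f2 = f (\<sigma> (\<sigma> x)) - f (\<sigma> (\<sigma> y))"
      and "g1 = g (\<sigma> x) - g (\<sigma> y)" and "g2 = g (\<sigma> (\<sigma> x)) - g (\<sigma> (\<sigma> y))"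
    have D1': "\<omega> * (\<omega> * (cnj d * f1)) + \<omega> * (d * g1) = 0"
      using D1 unfolding d1 f1_def[symmetric] g1_def[symmetric] by (simp add: cnj_omega mult.assoc)
    have D2': "\<omega> * (cnj d * f2) + \<omega> * (\<omega> * (d * g2)) = 0"
      using D2 unfolding d1 f2_def[symmetric] g2_def[symmetric] by (simp add: cnj_omega mult.assoc 4)
    have "stretch a e u = (cnj d * (f x - f y) + d * (g x - g y)) +
        \<eta> * \<eta> * (\<omega> * (\<omega> * (cnj d * f1)) + \<omega> * (\<omega> * (\<omega> * (\<omega> * (d * g1))))) +
        \<eta> * (\<omega> * (cnj d * f2) + \<omega> * (\<omega> * (d * g2)))"
      unfolding xy stretch_pair d_def[symmetric] using V
      by (simp add: u_def h_def f1_def f2_def g1_def g2_def algebra_simps)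
    also have "\<dots> = 0" unfolding 4 D1' D2' using D0 by (simp add: d_def)
    finally show ?thesis .
  qed
  then have "u \<in> motions a {e \<in> pairs. {fst e, snd e} \<in> E}" using uV by (simp add: motions_iff)
  then have "rigid_motion_on a V u" using rigid unfolding rigid_in_def by blast
  then obtain c s t where r: "\<forall>v\<in>V. u (Inl v) = c * a v + s \<and> u (Inr v) = - c * cnj (a v) + t"
    unfolding rigid_motion_on_def by blast
  show ?thesis
    by (rule exI[of _ c], rule exI[of _ s], rule exI[of _ t], rule ballI)
      (use r in \<open>simp add: u_def h_def\<close>)
qed

section \<open>The threefold rotation\<close>

abbreviation complex_of :: "real^2 \<Rightarrow> complex" where
  "complex_of x \<equiv> Complex (x $ 1) (x $ 2)"

abbreviation rot3 :: "real^2^2" where "rot3 \<equiv> rotation2 (2 * pi / 3)"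

definition zeta3 :: complex where "zeta3 = cis (2 * pi / 3)"

lemma complex_of_inj: "complex_of x = complex_of y \<Longrightarrow> x = y"
  by (simp add: vec_eq_iff forall_2)

lemma complex_of_rotation: "complex_of (rotation2 t *v x) = cis t * complex_of x"
  by (simp add: complex_eq_iff rotation2_def matrix_vector_mult_def sum_2)

lemma zeta3_cube: "zeta3 ^ 3 = 1"
proof -
  have "zeta3 ^ 3 = cis (2 * pi)" using Complex.DeMoivre[of "2 * pi / 3" 3] by (simp add: zeta3_def)
  then show ?thesis by simp
qed

lemma zeta3_neq_1: "zeta3 \<noteq> 1"
proof
  assume "zeta3 = 1"
  then have "sin (2 * pi / 3) = 0" by (simp add: zeta3_def complex_eq_iff)
  moreover have "0 < sin (2 * pi / 3)" using pi_gt_zero by (intro sin_gt_zero) simp_all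
  ultimately show False by simp
qed

lemma C3_power:
  assumes "A \<in> C3" shows "\<exists>k. \<forall>x. complex_of (A *v x) = zeta3 ^ k * complex_of x"
  using assms unfolding C3_def
proof (induction rule: generate.induct)
  case one
  show ?case by (rule exI[of _ 0]) (simp add: orthogonal_group_def)
next
  case (incl h)
  then show ?case by (intro exI[of _ 1]) (simp add: complex_of_rotation zeta3_def)
next
  case (inv h)
  then have h: "h = rot3" by simp
  have "orthogonal_matrix rot3"
    unfolding orthogonal_matrix
    by (simp add: vec_eq_iff forall_2 rotation2_def matrix_matrix_mult_def transpose_def mat_def sum_2
        power2_eq_square[symmetric])
  then have hc: "rot3 \<in> carrier orthogonal_group" by (simp add: orthogonal_group_def)
  let ?i = "inv\<^bsub>orthogonal_group\<^esub> rot3"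
  have "?i ** rot3 = mat 1"
    using group.l_inv[OF group_orthogonal_group hc] by (simp add: orthogonal_group_def)
  have "complex_of (?i *v x) = zeta3 ^ 2 * complex_of x" for x
  proof -
    \<comment> \<open>The inverse of the rotation is its square.\<close>
    let ?y = "rot3 *v (rot3 *v x)"
    have "complex_of (rot3 *v ?y) = zeta3 ^ 3 * complex_of x"
      by (simp only: complex_of_rotation zeta3_def power3_eq_cube mult.assoc)
    then have "rot3 *v ?y = x" by (intro complex_of_inj) (simp add: zeta3_cube)
    then have "?i *v x = ?i *v (rot3 *v ?y)" by simp
    also have "\<dots> = (?i ** rot3) *v ?y" by (rule matrix_vector_mul_assoc)
    also have "\<dots> = ?y" unfolding \<open>?i ** rot3 = mat 1\<close> by simp
    finally have e: "?i *v x = ?y" .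
    show ?thesis unfolding e by (simp only: complex_of_rotation zeta3_def power2_eq_square mult.assoc)
  qed
  then show ?case unfolding h by blast
next
  case (eng h1 h2)
  then obtain k l where k: "\<And>x. complex_of (h1 *v x) = zeta3 ^ k * complex_of x"
    and l: "\<And>x. complex_of (h2 *v x) = zeta3 ^ l * complex_of x" by blast
  have "complex_of ((h1 ** h2) *v x) = zeta3 ^ (k + l) * complex_of x" for x
    using k[of "h2 *v x"] l[of x] by (simp add: matrix_vector_mul_assoc[symmetric] power_add)
  then show ?case by (intro exI[of _ "k + l"]) (simp add: orthogonal_group_def)
qed

lemma real_subring_matrix_field: "real_subring (matrix_field M)"
proof -
  note g = generate_field.intros[where R = "ring_of_type_algebra :: real ring" and H = "\<rat> \<union> {A $ k $ l | A k l. A \<in> M}"]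
  have q: "x \<in> matrix_field M" if "x \<in> \<rat>" for x
    unfolding matrix_field_def by (rule g(2)) (use that in blast)
  moreover have "x + y \<in> matrix_field M" "x * y \<in> matrix_field M" if "x \<in> matrix_field M" "y \<in> matrix_field M" for x y
    using g(5,6)[of x y] that unfolding matrix_field_def by (simp_all add: ring_of_type_algebra_def)
  ultimately show ?thesis unfolding real_subring_def by simp
qed

lemma matrix_field_entry: "A \<in> M \<Longrightarrow> A $ k $ l \<in> matrix_field M"
  unfolding matrix_field_def by (rule generate_field.incl) blast

text \<open>Adding the three hypotheses leaves three times \<open>f\<close> and \<open>g\<close>, since the sum of the third roots of
  unity, and of their squares, is zero.\<close>

lemma sum_of_components:
  fixes w :: complex
  assumes w: "w * w * w = 1" "w \<noteq> 1"
    and "\<And>h. h \<in> {1, w, w * w} \<Longrightarrow> \<exists>c s t. \<forall>v\<in>V.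
      f v + (h * w) * (h * w) * f1 v + h * w * f2 v = c * a v + s \<and>
      g v + (h * (w * w)) * (h * (w * w)) * g1 v + h * (w * w) * g2 v = - c * b v + t"
  shows "\<exists>c s t. \<forall>v\<in>V. f v = c * a v + s \<and> g v = - c * b v + t"
proof -
  have "(w - 1) * (1 + w + w * w) = w * w * w - 1" by (simp add: algebra_simps)
  then have s: "1 + w + w * w = 0" using w by simp
  have w4: "w * (w * (w * z)) = z" for z using w(1) by (simp add: mult.assoc[symmetric])
  obtain c1 s1 t1 where 1: "\<forall>v\<in>V. f v + (1 * w) * (1 * w) * f1 v + 1 * w * f2 v = c1 * a v + s1 \<and>
      g v + (1 * (w * w)) * (1 * (w * w)) * g1 v + 1 * (w * w) * g2 v = - c1 * b v + t1"
    using assms(3)[of 1] by auto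
  obtain c2 s2 t2 where 2: "\<forall>v\<in>V. f v + (w * w) * (w * w) * f1 v + w * w * f2 v = c2 * a v + s2 \<and>
      g v + (w * (w * w)) * (w * (w * w)) * g1 v + w * (w * w) * g2 v = - c2 * b v + t2"
    using assms(3)[of w] by auto
  obtain c3 s3 t3 where 3: "\<forall>v\<in>V. f v + (w * w * w) * (w * w * w) * f1 v + w * w * w * f2 v = c3 * a v + s3 \<and>
      g v + (w * w * (w * w)) * (w * w * (w * w)) * g1 v + w * w * (w * w) * g2 v = - c3 * b v + t3"
    using assms(3)[of "w * w"] by auto
  have "f v = (c1 + c2 + c3) / 3 * a v + (s1 + s2 + s3) / 3 \<and>
      g v = - ((c1 + c2 + c3) / 3) * b v + (t1 + t2 + t3) / 3" if v: "v \<in> V" for v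
  proof -
    note e1 = conjunct1[OF bspec[OF 1 v]] conjunct1[OF bspec[OF 2 v]] conjunct1[OF bspec[OF 3 v]]
    note e2 = conjunct2[OF bspec[OF 1 v]] conjunct2[OF bspec[OF 2 v]] conjunct2[OF bspec[OF 3 v]]
    have "(c1 + c2 + c3) * a v + (s1 + s2 + s3) = (c1 * a v + s1) + (c2 * a v + s2) + (c3 * a v + s3)"
      by (simp add: algebra_simps)
    also have "\<dots> = 3 * f v + (1 + w + w * w) * f1 v + (1 + w + w * w) * f2 v"
      unfolding e1[symmetric] by (simp add: algebra_simps w4)
    finally have 4: "3 * f v = (c1 + c2 + c3) * a v + (s1 + s2 + s3)" unfolding s by simp
    have "- (c1 + c2 + c3) * b v + (t1 + t2 + t3) = (- c1 * b v + t1) + (- c2 * b v + t2) + (- c3 * b v + t3)"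
      by (simp add: algebra_simps)
    also have "\<dots> = 3 * g v + (1 + w + w * w) * g1 v + (1 + w + w * w) * g2 v"
      unfolding e2[symmetric] by (simp add: algebra_simps w4)
    finally have 5: "3 * g v = - (c1 + c2 + c3) * b v + (t1 + t2 + t3)" unfolding s by simp
    have "f v = ((c1 + c2 + c3) * a v + (s1 + s2 + s3)) / 3" using 4 by (simp add: field_simps)
    moreover have "g v = (- (c1 + c2 + c3) * b v + (t1 + t2 + t3)) / 3" using 5 by (simp add: field_simps)
    ultimately show ?thesis by (simp add: field_simps)
  qed
  then show ?thesis by blast
qed

text \<open>Injectivity of the placement forces every element of the group to act as the power of the generator
  with the same image under the representation, so the orbits are those of the generator.\<close>

theorem corollary3p3:
  fixes V :: "'v set" and E :: "'v set set"
    and \<Gamma> :: "'g monoid"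
    and \<theta> :: "'g \<Rightarrow> 'v \<Rightarrow> 'v"
    and \<tau> :: "'g \<Rightarrow> real^2^2"
    and p :: "'v \<Rightarrow> real^2"
  assumes "finite_simple_graph V E"
    and "group \<Gamma>"
    and "\<theta> \<in> hom \<Gamma> (graph_aut_group V E)"
    and "free_action \<Gamma> V \<theta>"
    and "\<tau> \<in> hom \<Gamma> orthogonal_group"
    and "\<tau> ` carrier \<Gamma> = C3"
    and "generic_framework \<Gamma> \<theta> \<tau> V p"
    and "mixed_connected 6 V E"
  shows "infinitesimally_rigid V E p"
proof -
  interpret \<Gamma>: group \<Gamma> by (rule assms(2))
  define a where "a v = complex_of (p v)" for v
  obtain g where g: "g \<in> carrier \<Gamma>" "\<tau> g = rot3"
  proof -
    have "rot3 \<in> C3" unfolding C3_def by (rule generate.incl) simp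
    then show ?thesis using assms(6) that by (metis imageE)
  qed
  have symm: "inj_on p V" "\<And>h i. h \<in> carrier \<Gamma> \<Longrightarrow> i \<in> V \<Longrightarrow> \<tau> h *v p i = p (\<theta> h i)"
    using assms(7) unfolding generic_framework_def symmetric_framework_def framework_def by auto
  obtain R where R: "R \<subseteq> V" "\<And>i. i \<in> V \<Longrightarrow> \<exists>!r. r \<in> R \<and> r \<in> Group_Action.orbit \<Gamma> \<theta> i"
    and alg: "algebraically_independent_over (matrix_field C3) (R \<times> UNIV) (\<lambda>(i, k). p i $ k)"
    using assms(6,7) unfolding generic_framework_def orbit_representatives_def by auto
  have aut: "\<theta> h \<in> graph_automorphisms V E" if "h \<in> carrier \<Gamma>" for h
    using hom_in_carrier[OF assms(3) that] by (simp add: graph_aut_group_def)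
  have Bij: "\<theta> h \<in> Bij V" if "h \<in> carrier \<Gamma>" for h
    using aut[OF that] by (simp add: graph_automorphisms_def)
  have \<theta>_V: "\<theta> h i \<in> V" if "h \<in> carrier \<Gamma>" "i \<in> V" for h i
    using Bij_imp_funcset[OF Bij[OF that(1)]] that(2) by blast
  have \<theta>_mult: "\<theta> (h \<otimes>\<^bsub>\<Gamma>\<^esub> k) i = \<theta> h (\<theta> k i)" if "h \<in> carrier \<Gamma>" "k \<in> carrier \<Gamma>" "i \<in> V" for h k i
    using hom_mult[OF assms(3) that(1,2)] Bij[OF that(1)] Bij[OF that(2)] that(3)
    by (simp add: graph_aut_group_def BijGroup_def compose_eq)
  define \<sigma> where "\<sigma> = \<theta> g"
  have a_inj: "x = y" if "x \<in> V" "y \<in> V" "a x = a y" for x y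
    using complex_of_inj[of "p x" "p y"] that symm(1) by (simp add: a_def inj_on_def)
  have \<sigma>_V: "\<sigma> x \<in> V" if "x \<in> V" for x using \<theta>_V[OF g(1) that] by (simp add: \<sigma>_def)
  have a_\<sigma>: "a (\<sigma> x) = zeta3 * a x" if "x \<in> V" for x
    using symm(2)[OF g(1) that] g(2) complex_of_rotation[of "2 * pi / 3" "p x"]
    by (simp add: a_def \<sigma>_def zeta3_def)
  have w: "zeta3 * zeta3 * zeta3 = 1" using zeta3_cube by (simp add: power3_eq_cube)
  have \<sigma>3: "\<sigma> (\<sigma> (\<sigma> x)) = x" if "x \<in> V" for x
    by (rule a_inj) (use that w in \<open>simp_all add: \<sigma>_V a_\<sigma> mult.assoc[symmetric]\<close>)
  have "g \<noteq> \<one>\<^bsub>\<Gamma>\<^esub>"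
  proof
    assume "g = \<one>\<^bsub>\<Gamma>\<^esub>"
    then have "rot3 = rot3 ** rot3"
      using hom_mult[OF assms(5) g(1) g(1)] g by (simp add: orthogonal_group_def)
    then have "complex_of (rot3 *v axis 1 1) = complex_of (rot3 *v (rot3 *v axis 1 1))"
      by (simp only: matrix_vector_mul_assoc)
    then have "zeta3 * 1 = zeta3 * (zeta3 * 1)"
      unfolding complex_of_rotation zeta3_def[symmetric] by (simp add: axis_def one_complex.code[symmetric])
    moreover have "zeta3 \<noteq> 0" by (simp add: zeta3_def)
    ultimately show False using zeta3_neq_1 by simp
  qed
  then have \<sigma>_free: "\<sigma> x \<noteq> x" if "x \<in> V" for x
    using assms(4) g(1) that unfolding free_action_def \<sigma>_def by blast
  have orbit: "r \<in> Group_Action.orbit \<Gamma> \<theta> i \<longleftrightarrow> i \<in> {r, \<sigma> r, \<sigma> (\<sigma> r)}" if i: "i \<in> V" and r: "r \<in> V" for i r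
  proof
    assume "r \<in> Group_Action.orbit \<Gamma> \<theta> i"
    then obtain h where h: "h \<in> carrier \<Gamma>" "r = \<theta> h i" by (auto simp: orbit_def)
    have "\<tau> h \<in> C3" using h(1) assms(6) by blast
    then obtain k where k0: "\<forall>x. complex_of (\<tau> h *v x) = zeta3 ^ k * complex_of x" using C3_power by blast
    have k: "a r = zeta3 ^ k * a i"
      using spec[OF k0, of "p i"] unfolding symm(2)[OF h(1) i] h(2) a_def .
    have "zeta3 ^ k = zeta3 ^ (k mod 3)"
    proof -
      have "zeta3 ^ k = zeta3 ^ (3 * (k div 3) + k mod 3)" by simp
      also have "\<dots> = zeta3 ^ (k mod 3)" unfolding power_add power_mult zeta3_cube by simp
      finally show ?thesis .
    qed
    moreover have "k mod 3 = 0 \<or> k mod 3 = 1 \<or> k mod 3 = 2" by presburger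
    ultimately have "a r = a i \<or> a r = a (\<sigma> i) \<or> a r = a (\<sigma> (\<sigma> i))"
      using k i by (auto simp: a_\<sigma> \<sigma>_V power2_eq_square)
    then have "r = i \<or> r = \<sigma> i \<or> r = \<sigma> (\<sigma> i)" using a_inj r i \<sigma>_V by blast
    then show "i \<in> {r, \<sigma> r, \<sigma> (\<sigma> r)}" using \<sigma>3[OF i] by auto
  next
    assume "i \<in> {r, \<sigma> r, \<sigma> (\<sigma> r)}"
    then have "r = \<sigma> (\<sigma> (\<sigma> i)) \<or> r = \<sigma> (\<sigma> i) \<or> r = \<sigma> i" using \<sigma>3[OF r] \<sigma>3[OF i] by auto
    moreover have "\<sigma> (\<sigma> i) = \<theta> (g \<otimes>\<^bsub>\<Gamma>\<^esub> g) i" using \<theta>_mult[OF g(1) g(1) i] by (simp add: \<sigma>_def)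
    moreover have "\<sigma> (\<sigma> (\<sigma> i)) = \<theta> (g \<otimes>\<^bsub>\<Gamma>\<^esub> (g \<otimes>\<^bsub>\<Gamma>\<^esub> g)) i"
      using \<theta>_mult[OF g(1) \<Gamma>.m_closed[OF g(1) g(1)] i] \<theta>_mult[OF g(1) g(1) i] by (simp add: \<sigma>_def)
    moreover have "g \<otimes>\<^bsub>\<Gamma>\<^esub> g \<in> carrier \<Gamma>" "g \<otimes>\<^bsub>\<Gamma>\<^esub> (g \<otimes>\<^bsub>\<Gamma>\<^esub> g) \<in> carrier \<Gamma>" using g(1) by simp_all
    ultimately show "r \<in> Group_Action.orbit \<Gamma> \<theta> i" unfolding orbit_def \<sigma>_def using g(1) by blast
  qed
  have reps: "\<exists>!r. r \<in> R \<and> i \<in> {r, \<sigma> r, \<sigma> (\<sigma> r)}" if "i \<in> V" for i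
  proof -
    have "r \<in> R \<and> i \<in> {r, \<sigma> r, \<sigma> (\<sigma> r)} \<longleftrightarrow> r \<in> R \<and> r \<in> Group_Action.orbit \<Gamma> \<theta> i" for r
      using orbit[OF that, of r] R(1) by blast
    then show ?thesis using R(2)[OF that] by simp
  qed
  have finV: "finite V" using assms(1) by (simp add: finite_simple_graph_def)
  have sym: "{\<sigma> x, \<sigma> y} \<in> E" if "x \<in> V" "y \<in> V" "{x, y} \<in> E" for x y
    using aut[OF g(1)] that unfolding graph_automorphisms_def \<sigma>_def by blast
  have K: "real_subring (matrix_field C3)" by (rule real_subring_matrix_field)
  have rotC: "rot3 \<in> C3" using g assms(6) by (metis imageI)
  have "Re zeta3 = rot3 $ 1 $ 1" "Im zeta3 = rot3 $ 2 $ 1"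
    by (simp_all add: zeta3_def rotation2_def)
  then have entries: "Re zeta3 \<in> matrix_field C3" "Im zeta3 \<in> matrix_field C3"
    using matrix_field_entry[OF rotC] by simp_all
  show ?thesis
    unfolding infinitesimally_rigid_def
  proof (intro allI impI)
    fix u assume u: "infinitesimal_motion V E p u"
    define f where "f v = complex_of (u v)" for v
    have mot: "cnj (a x - a y) * (f x - f y) + (a x - a y) * (cnj (f x) - cnj (f y)) = 0"
      if "x \<in> V" "y \<in> V" "{x, y} \<in> E" for x y
    proof -
      have "(p x - p y) \<bullet> (u x - u y) = 0" using u that unfolding infinitesimal_motion_def by blast
      then show ?thesis by (simp add: a_def f_def complex_eq_iff inner_vec_def sum_2 algebra_simps)
    qed
    have comp: "\<exists>c s t. \<forall>v\<in>V.
        f v + (h * zeta3) * (h * zeta3) * f (\<sigma> v) + h * zeta3 * f (\<sigma> (\<sigma> v)) = c * a v + s \<and>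
        cnj (f v) + (h * (zeta3 * zeta3)) * (h * (zeta3 * zeta3)) * cnj (f (\<sigma> v)) +
          h * (zeta3 * zeta3) * cnj (f (\<sigma> (\<sigma> v))) = - c * cnj (a v) + t"
      if h: "h \<in> {1, zeta3, zeta3 * zeta3}" for h
    proof -
      have h3: "h ^ 3 = 1" using h zeta3_cube by (auto simp: power_mult_distrib)
      interpret threefold_action V \<sigma> R zeta3 h
        by unfold_locales (use finV \<sigma>_V \<sigma>3 \<sigma>_free R(1) reps zeta3_cube zeta3_neq_1 h3 in auto)
      have K1: "entries_in (matrix_field C3) zeta3" using entries by (simp add: entries_in_def)
      have K2: "entries_in (matrix_field C3) h"
        using h K1 entries_in_mult[OF K K1 K1] K by (auto simp: entries_in_def real_subring_def)
      have "configuration a" unfolding configuration_def using a_\<sigma> by blast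
      then have "a v = placed (\<lambda>(i, k). p i $ k) v" if "v \<in> V" for v
        using configuration_phase[of a v] that by (simp add: placed_def a_def)
      from generic_threefoldI[OF K K1 K2 alg this]
      interpret generic_threefold V \<sigma> R zeta3 h a .
      show ?thesis
        by (rule component_rigid[OF sym mot mixed_connected_imp_rigid[OF assms(1,8)]])
    qed
    have "\<exists>c s t. \<forall>v\<in>V. f v = c * a v + s \<and> cnj (f v) = - c * cnj (a v) + t"
      by (rule sum_of_components[OF w zeta3_neq_1 comp])
    then obtain c s t where cst: "\<forall>v\<in>V. f v = c * a v + s \<and> cnj (f v) = - c * cnj (a v) + t" by blast
    \<comment> \<open>For a real motion the rotational part of \<open>c\<close> is its imaginary part: the equation for \<open>cnj f\<close>,
      conjugated and averaged with the one for \<open>f\<close>, removes the real part.\<close>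
    define \<beta> where "\<beta> = Im c"
    define d where "d = (s + cnj t) / 2"
    define S :: "real^2^2" where "S = vector [vector [0, - \<beta>], vector [\<beta>, 0]]"
    define q :: "real^2" where "q = vector [Re d, Im d]"
    have "u i = S *v p i + q" if i: "i \<in> V" for i
    proof -
      have 1: "f i = c * a i + s" and 2: "cnj (f i) = - c * cnj (a i) + t" using cst i by blast+
      have "f i = cnj (cnj (f i))" by simp
      then have "f i = - cnj c * a i + cnj t" unfolding 2 by simp
      then have "2 * f i = (c - cnj c) * a i + (s + cnj t)" using 1 by (simp add: algebra_simps)
      then have "f i = ((c - cnj c) / 2) * a i + d" by (simp add: d_def field_simps)
      also have "(c - cnj c) / 2 = \<i> * of_real \<beta>" by (simp add: complex_eq_iff \<beta>_def)
      finally have "f i = \<i> * of_real \<beta> * a i + d" .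
      then have "u i $ 1 = - \<beta> * p i $ 2 + Re d" "u i $ 2 = \<beta> * p i $ 1 + Im d"
        by (simp_all add: f_def a_def complex_eq_iff)
      then show ?thesis
        by (simp add: vec_eq_iff forall_2 S_def q_def matrix_vector_mult_def sum_2)
    qed
    moreover have "transpose S = - S"
      by (simp add: vec_eq_iff forall_2 S_def transpose_def)
    ultimately show "trivial_motion V p u" unfolding trivial_motion_def by blast
  qed
qed

end
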